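(* Let $R$ be a ring. The following statements are equivalent. 1. $Q_l^s(R)$ is a semisimple ring. 2. $R/\mathfrak{l}^s_R$ is a semiprime left Goldie ring. 3. $Q_l(R/\mathfrak{l}^s_R)$ is a semisimple ring. 4. $Q_{l,cl}(R/\mathfrak{l}^s_R)$ (exists and) is a semisimple ring. If one of the equivalent conditions holds then $Q_l^s(R)\simeq Q_l(R/\mathfrak{l}^s_R)\simeq Q_{l,cl}(R/\mathfrak{l}^s_R)$, $T_l(R)=\pi^{-1}(\mathcal{C}_{R/\mathfrak{l}^s_R})$ and $T_l(R/\mathfrak{l}^s_R)=\mathcal{C}_{R/\mathfrak{l}^s_R}$, where $\pi : R\to R/\mathfrak{l}^s_R$, $r\mapsto r+\mathfrak{l}^s_R$, and $\mathcal{C}_{R/\mathfrak{l}^s_R}$ is the set of regular elements of the ring $R/\mathfrak{l}^s_R$.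
   Context: Rings are associative with $1$ and nonzero. A multiplicative subset $S$ of $R$ is a submonoid of $(R,\cdot)$ with $1\in S$, $0\notin S$. It is a left Ore set if $Sr\cap Rs\neq\emptyset$ for all $r\in R$, $s\in S$; then $\mathrm{ass}(S):=\{r\in R\mid sr=0 \text{ for some } s\in S\}$ is an ideal. A left Ore set $S$ is a left denominator set if $rs=0$ with $r\in R$, $s\in S$ implies $r\in\mathrm{ass}(S)$. $\mathrm{Den}_l(R)$ is the set of left denominator sets of $R$; for $S\in\mathrm{Den}_l(R)$, $S^{-1}R=\{s^{-1}r\mid s\in S,r\in R\}$ is the left localization. $\mathrm{max.Den}_l(R)$ is the (non-empty) set of elements of $\mathrm{Den}_l(R)$ maximal under inclusion. $\mathcal{L}^s_l(R):=\bigcap_{S\in \mathrm{max.Den}_l(R)}S$. $T_l(R)$ is the union of all $S\in\mathrm{Den}_l(R)$ with $S\subseteq\mathcal{L}^s_l(R)$; it is the largest left denominator set of $R$ contained in $\mathcal{L}^s_l(R)$. $Q_l^s(R):=T_l(R)^{-1}R$ and $\mathfrak{l}^s_R:=\mathrm{ass}(T_l(R))$. $S_{l,0}(R)$ is the largest (under inclusion) left denominator set $S$ of $R$ with $\mathrm{ass}(S)=0$ (it exists), and $Q_l(R):=S_{l,0}(R)^{-1}R$. $\mathcal{C}_R$ is the set of regular elements (non-zero-divisors) of $R$, and $Q_{l,cl}(R):=\mathcal{C}_R^{-1}R$ is the classical left quotient ring, which exists iff $\mathcal{C}_R$ is a left Ore set. A ring is left Goldie if it contains no infinite direct sum of nonzero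 left ideals and satisfies the ascending chain condition on left annihilators. "Semisimple" means semisimple Artinian. *)

theory Defs
  imports "HOL-Algebra.QuotRing" "HOL-Algebra.Ideal_Product"
begin

section \<open>Left Ore sets and left denominator sets\<close>

definition left_ass :: "('a, 'b) ring_scheme \<Rightarrow> 'a set \<Rightarrow> 'a set" where
  "left_ass R S = {r \<in> carrier R. \<exists>s\<in>S. s \<otimes>\<^bsub>R\<^esub> r = \<zero>\<^bsub>R\<^esub>}"

definition mult_subset :: "('a, 'b) ring_scheme \<Rightarrow> 'a set \<Rightarrow> bool" where
  "mult_subset R S \<longleftrightarrow> submonoid S R \<and> \<zero>\<^bsub>R\<^esub> \<notin> S"

definition left_Ore_set :: "('a, 'b) ring_scheme \<Rightarrow> 'a set \<Rightarrow> bool" where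
  "left_Ore_set R S \<longleftrightarrow> mult_subset R S \<and>
     (\<forall>r\<in>carrier R. \<forall>s\<in>S. (S #>\<^bsub>R\<^esub> r) \<inter> (carrier R #>\<^bsub>R\<^esub> s) \<noteq> {})"

definition Den_l :: "('a, 'b) ring_scheme \<Rightarrow> 'a set set" where
  "Den_l R = {S. left_Ore_set R S \<and>
     (\<forall>r\<in>carrier R. \<forall>s\<in>S. r \<otimes>\<^bsub>R\<^esub> s = \<zero>\<^bsub>R\<^esub> \<longrightarrow> r \<in> left_ass R S)}"

definition max_Den_l :: "('a, 'b) ring_scheme \<Rightarrow> 'a set set" where
  "max_Den_l R = {S \<in> Den_l R. \<forall>S'\<in>Den_l R. S \<subseteq> S' \<longrightarrow> S' = S}"

definition strong_L :: "('a, 'b) ring_scheme \<Rightarrow> 'a set" where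
  "strong_L R = \<Inter> (max_Den_l R)"

definition T_l :: "('a, 'b) ring_scheme \<Rightarrow> 'a set" where
  "T_l R = \<Union> {S \<in> Den_l R. S \<subseteq> strong_L R}"

definition strong_l :: "('a, 'b) ring_scheme \<Rightarrow> 'a set" where
  "strong_l R = left_ass R (T_l R)"

definition S_l0 :: "('a, 'b) ring_scheme \<Rightarrow> 'a set" where
  "S_l0 R = (GREATEST S. S \<in> Den_l R \<and> left_ass R S = {\<zero>\<^bsub>R\<^esub>})"

definition regular_elements :: "('a, 'b) ring_scheme \<Rightarrow> 'a set" where
  "regular_elements R = {c \<in> carrier R. \<forall>x\<in>carrier R.
     (c \<otimes>\<^bsub>R\<^esub> x = \<zero>\<^bsub>R\<^esub> \<longrightarrow> x = \<zero>\<^bsub>R\<^esub>) \<and> (x \<otimes>\<^bsub>R\<^esub> c = \<zero>\<^bsub>R\<^esub> \<longrightarrow> x = \<zero>\<^bsub>R\<^esub>)}"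


section \<open>Left localization\<close>

text \<open>The pair \<open>(s, r)\<close> represents the left fraction \<open>s\<^sup>-\<^sup>1 r\<close>. Two fractions agree
  iff they can be expanded on the left to a common one.\<close>

definition frac_rel ::
  "('a, 'b) ring_scheme \<Rightarrow> 'a set \<Rightarrow> (('a \<times> 'a) \<times> ('a \<times> 'a)) set" where
  "frac_rel R S = {((s, r), (s', r')) | s r s' r'.
     s \<in> S \<and> r \<in> carrier R \<and> s' \<in> S \<and> r' \<in> carrier R \<and>
     (\<exists>c\<in>carrier R. \<exists>d\<in>carrier R.
        c \<otimes>\<^bsub>R\<^esub> s = d \<otimes>\<^bsub>R\<^esub> s' \<and> c \<otimes>\<^bsub>R\<^esub> s \<in> S \<and> c \<otimes>\<^bsub>R\<^esub> r = d \<otimes>\<^bsub>R\<^esub> r')}"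

definition left_frac :: "('a, 'b) ring_scheme \<Rightarrow> 'a set \<Rightarrow> 'a \<Rightarrow> 'a \<Rightarrow> ('a \<times> 'a) set" where
  "left_frac R S s r = frac_rel R S `` {(s, r)}"

text \<open>The product is \<open>s\<^sub>1\<^sup>-\<^sup>1 r\<^sub>1 \<cdot> s\<^sub>2\<^sup>-\<^sup>1 r\<^sub>2 = (s' s\<^sub>1)\<^sup>-\<^sup>1 (r' r\<^sub>2)\<close> where \<open>s' r\<^sub>1 = r' s\<^sub>2\<close>, and the sum is
  \<open>s\<^sub>1\<^sup>-\<^sup>1 r\<^sub>1 + s\<^sub>2\<^sup>-\<^sup>1 r\<^sub>2 = (c s\<^sub>1)\<^sup>-\<^sup>1 (c r\<^sub>1 + d r\<^sub>2)\<close> where \<open>c s\<^sub>1 = d s\<^sub>2\<close>; here \<open>s', c \<in> S\<close> and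
  \<open>r', d \<in> R\<close> are supplied by the left Ore condition. For a left denominator set the resulting class
  does not depend on any choice, so the unions below are unions of copies of a single class.\<close>

definition left_loc :: "('a, 'b) ring_scheme \<Rightarrow> 'a set \<Rightarrow> ('a \<times> 'a) set ring" where
  "left_loc R S =
    \<lparr>carrier = (S \<times> carrier R) // frac_rel R S,
     mult = (\<lambda>A B. \<Union> {left_frac R S (s' \<otimes>\<^bsub>R\<^esub> s1) (r' \<otimes>\<^bsub>R\<^esub> r2) | s1 r1 s2 r2 s' r'.
        (s1, r1) \<in> A \<and> (s2, r2) \<in> B \<and> s' \<in> S \<and> r' \<in> carrier R \<and>
        s' \<otimes>\<^bsub>R\<^esub> r1 = r' \<otimes>\<^bsub>R\<^esub> s2}),
     one = left_frac R S \<one>\<^bsub>R\<^esub> \<one>\<^bsub>R\<^esub>,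
     zero = left_frac R S \<one>\<^bsub>R\<^esub> \<zero>\<^bsub>R\<^esub>,
     add = (\<lambda>A B. \<Union> {left_frac R S (c \<otimes>\<^bsub>R\<^esub> s1) ((c \<otimes>\<^bsub>R\<^esub> r1) \<oplus>\<^bsub>R\<^esub> (d \<otimes>\<^bsub>R\<^esub> r2)) | s1 r1 s2 r2 c d.
        (s1, r1) \<in> A \<and> (s2, r2) \<in> B \<and> c \<in> S \<and> d \<in> carrier R \<and>
        c \<otimes>\<^bsub>R\<^esub> s1 = d \<otimes>\<^bsub>R\<^esub> s2})\<rparr>"

definition Q_ls :: "('a, 'b) ring_scheme \<Rightarrow> ('a \<times> 'a) set ring" where
  "Q_ls R = left_loc R (T_l R)"

definition Q_l :: "('a, 'b) ring_scheme \<Rightarrow> ('a \<times> 'a) set ring" where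
  "Q_l R = left_loc R (S_l0 R)"

text \<open>\<open>Q_lcl R\<close> is meaningful only when \<open>left_Ore_set R (regular_elements R)\<close> holds, which is what
  existence of the classical left quotient ring means.\<close>

definition Q_lcl :: "('a, 'b) ring_scheme \<Rightarrow> ('a \<times> 'a) set ring" where
  "Q_lcl R = left_loc R (regular_elements R)"


section \<open>Left ideals, semisimple rings and left Goldie rings\<close>

definition left_ideal :: "('a, 'b) ring_scheme \<Rightarrow> 'a set \<Rightarrow> bool" where
  "left_ideal R I \<longleftrightarrow> additive_subgroup I R \<and> (\<forall>r\<in>carrier R. \<forall>x\<in>I. r \<otimes>\<^bsub>R\<^esub> x \<in> I)"

definition minimal_left_ideal :: "('a, 'b) ring_scheme \<Rightarrow> 'a set \<Rightarrow> bool" where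
  "minimal_left_ideal R I \<longleftrightarrow> left_ideal R I \<and> I \<noteq> {\<zero>\<^bsub>R\<^esub>} \<and>
     (\<forall>J. left_ideal R J \<and> J \<subseteq> I \<longrightarrow> J = {\<zero>\<^bsub>R\<^esub>} \<or> J = I)"

definition sum_direct :: "('a, 'b) ring_scheme \<Rightarrow> 'a set set \<Rightarrow> bool" where
  "sum_direct R \<F> \<longleftrightarrow> (\<forall>F f. finite F \<and> F \<subseteq> \<F> \<and> (\<forall>I\<in>F. f I \<in> I) \<and>
     (\<Oplus>\<^bsub>R\<^esub>I\<in>F. f I) = \<zero>\<^bsub>R\<^esub> \<longrightarrow> (\<forall>I\<in>F. f I = \<zero>\<^bsub>R\<^esub>))"

definition left_ideal_sum :: "('a, 'b) ring_scheme \<Rightarrow> 'a set set \<Rightarrow> 'a set" where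
  "left_ideal_sum R \<F> = {(\<Oplus>\<^bsub>R\<^esub>I\<in>F. f I) | F f. finite F \<and> F \<subseteq> \<F> \<and> (\<forall>I\<in>F. f I \<in> I)}"

definition left_artinian :: "('a, 'b) ring_scheme \<Rightarrow> bool" where
  "left_artinian R \<longleftrightarrow> (\<forall>A :: nat \<Rightarrow> 'a set.
     (\<forall>n. left_ideal R (A n) \<and> A (Suc n) \<subseteq> A n) \<longrightarrow> (\<exists>N. \<forall>n\<ge>N. A n = A N))"

text \<open>Semisimple Artinian: the left regular module is Artinian and a direct sum of simple
  submodules.\<close>

definition semisimple_ring :: "('a, 'b) ring_scheme \<Rightarrow> bool" where
  "semisimple_ring R \<longleftrightarrow> ring R \<and> left_artinian R \<and>
     (\<exists>\<F>. (\<forall>I\<in>\<F>. minimal_left_ideal R I) \<and> sum_direct R \<F> \<and> left_ideal_sum R \<F> = carrier R)"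

definition semiprime_ring :: "('a, 'b) ring_scheme \<Rightarrow> bool" where
  "semiprime_ring R \<longleftrightarrow> ring R \<and> (\<forall>I. ideal I R \<and> I \<cdot>\<^bsub>R\<^esub> I = {\<zero>\<^bsub>R\<^esub>} \<longrightarrow> I = {\<zero>\<^bsub>R\<^esub>})"

definition left_annihilator :: "('a, 'b) ring_scheme \<Rightarrow> 'a set \<Rightarrow> 'a set" where
  "left_annihilator R U = {r \<in> carrier R. \<forall>x\<in>U. r \<otimes>\<^bsub>R\<^esub> x = \<zero>\<^bsub>R\<^esub>}"

text \<open>A direct family of nonzero left ideals has pairwise distinct members, so it may be given as
  a set of left ideals.\<close>

definition left_Goldie_ring :: "('a, 'b) ring_scheme \<Rightarrow> bool" where
  "left_Goldie_ring R \<longleftrightarrow> ring R \<and>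
     \<not> (\<exists>\<F>. infinite \<F> \<and> (\<forall>I\<in>\<F>. left_ideal R I \<and> I \<noteq> {\<zero>\<^bsub>R\<^esub>}) \<and> sum_direct R \<F>) \<and>
     (\<forall>A :: nat \<Rightarrow> 'a set.
       (\<forall>n. (\<exists>U\<subseteq>carrier R. A n = left_annihilator R U) \<and> A n \<subseteq> A (Suc n)) \<longrightarrow>
       (\<exists>N. \<forall>n\<ge>N. A n = A N))"

end

theory Submission
  imports Defs
begin

text \<open>Write \<open>A = R/l\<close> with \<open>l = ass(T)\<close>, \<open>T = T_l(R)\<close>, and let \<open>C\<close> be the set of regular elements of
  \<open>A\<close>. The image of \<open>T\<close> in \<open>A\<close> is a denominator set inside \<open>C\<close> and localizing there gives
  \<open>Q_l^s(R)\<close>. If any localization of \<open>A\<close> at a denominator set inside \<open>C\<close> is semisimple, then \<open>C\<close> becomes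
  invertible in it, because injective right multiplications of an Artinian ring are surjective; so
  \<open>C\<close> is a denominator set with the same localization. Goldie's theorem relates this to condition 2.
  Conversely, if \<open>C\<^sup>-\<^sup>1A\<close> is semisimple, then for every denominator set \<open>S\<close> of the semiprime ring \<open>A\<close> the
  ideal \<open>ass(S)\<close> is a two-sided annihilator ideal, hence \<open>C\<close> stays regular modulo \<open>ass(S)\<close>. This puts \<open>C\<close> into
  every maximal denominator set, so \<open>C \<subseteq> T_l(A)\<close>; pulling back to \<open>R\<close> and using the maximality of
  \<open>T\<close> gives \<open>T_l(A) = C\<close> and \<open>T = \<pi>\<^sup>-\<^sup>1(C)\<close>.\<close>

section \<open>Denominator sets\<close>

text \<open>The delicate point is that a maximal denominator set \<open>E\<close> of
  \<open>A\<close> need not consist of regular elements, so the behaviour of \<open>C\<close> modulo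
  \<open>ass(E)\<close> is not visible from \<open>E\<close> alone. If the localization at
  \<open>C\<close> is semisimple, its descending chain condition yields a single s in
  \<open>E\<close> that kills all of \<open>ass(E)\<close>. Hence \<open>ass(E)\<close> is exactly
  the right annihilator of its own left annihilator b. In a semiprime ring the two annihilators of
  an ideal coincide, so c y \<in> ass(E) reads c y b = 0, and regularity of c turns this into y b =
  0; the other side is similar. A second difficulty is that suprema of denominator sets are not
  unions. They are replaced by generated monoids, which inherit both denominator conditions as soon
  as they avoid 0. Finally, several presentations of one ring of fractions have to be identified, so
  localizations are handled through a characterization up to isomorphism and not through classes of
  pairs.\<close>

context ring begin

lemma minus_eq_zero_iff:
  assumes "x \<in> carrier R" "y \<in> carrier R" shows "x \<ominus> y = \<zero> \<longleftrightarrow> x = y"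
proof
  assume "x \<ominus> y = \<zero>"
  then have "\<ominus> (\<ominus> y) = x" using assms by (intro minus_equality) (auto simp: a_minus_def)
  then show "x = y" using assms by simp
next
  assume "x = y"
  then show "x \<ominus> y = \<zero>" using assms by (simp add: a_minus_def r_neg)
qed

lemma mult_minus_eq_zero_iff:
  assumes "t \<in> carrier R" "x \<in> carrier R" "y \<in> carrier R"
  shows "t \<otimes> (x \<ominus> y) = \<zero> \<longleftrightarrow> t \<otimes> x = t \<otimes> y"
proof -
  have "t \<otimes> (x \<ominus> y) = t \<otimes> x \<ominus> t \<otimes> y" using assms by (simp add: a_minus_def r_distr r_minus)
  then show ?thesis using minus_eq_zero_iff assms by simp
qed

lemma Den_l_iff:
  "S \<in> Den_l R \<longleftrightarrow> S \<subseteq> carrier R \<and> \<one> \<in> S \<and> \<zero> \<notin> S \<and> (\<forall>s\<in>S. \<forall>t\<in>S. s \<otimes> t \<in> S) \<and>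
     (\<forall>r\<in>carrier R. \<forall>s\<in>S. \<exists>t\<in>S. \<exists>u\<in>carrier R. t \<otimes> r = u \<otimes> s) \<and>
     (\<forall>r\<in>carrier R. \<forall>s\<in>S. r \<otimes> s = \<zero> \<longrightarrow> (\<exists>t\<in>S. t \<otimes> r = \<zero>))"
  (is "_ \<longleftrightarrow> ?rhs")
proof -
  have 1: "(S #> r) \<inter> (carrier R #> s) \<noteq> {} \<longleftrightarrow> (\<exists>t\<in>S. \<exists>u\<in>carrier R. t \<otimes> r = u \<otimes> s)" for r s
    unfolding r_coset_def by force
  have 2: "submonoid S R \<longleftrightarrow> S \<subseteq> carrier R \<and> \<one> \<in> S \<and> (\<forall>s\<in>S. \<forall>t\<in>S. s \<otimes> t \<in> S)"
    unfolding submonoid_def by blast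
  have 3: "r \<in> left_ass R S \<longleftrightarrow> (\<exists>t\<in>S. t \<otimes> r = \<zero>)" if "r \<in> carrier R" for r
    using that unfolding left_ass_def by blast
  show ?thesis
    unfolding Den_l_def left_Ore_set_def mult_subset_def mem_Collect_eq 1 2
    by (simp add: 3 cong: ball_cong) meson
qed

lemma Den_lD:
  assumes "S \<in> Den_l R"
  shows "S \<subseteq> carrier R" "\<one> \<in> S" "\<zero> \<notin> S"
    "\<And>s t. s \<in> S \<Longrightarrow> t \<in> S \<Longrightarrow> s \<otimes> t \<in> S"
    "\<And>r s. r \<in> carrier R \<Longrightarrow> s \<in> S \<Longrightarrow> \<exists>t\<in>S. \<exists>u\<in>carrier R. t \<otimes> r = u \<otimes> s"
    "\<And>r s. r \<in> carrier R \<Longrightarrow> s \<in> S \<Longrightarrow> r \<otimes> s = \<zero> \<Longrightarrow> \<exists>t\<in>S. t \<otimes> r = \<zero>"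
    "\<And>s. s \<in> S \<Longrightarrow> s \<in> carrier R"
  using assms unfolding Den_l_iff by auto

end

section \<open>Monoids generated by families of denominator sets\<close>

inductive_set gen_monoid :: "('a, 'b) ring_scheme \<Rightarrow> 'a set \<Rightarrow> 'a set"
  for R and X where
  one: "\<one>\<^bsub>R\<^esub> \<in> gen_monoid R X"
| snoc: "m \<in> gen_monoid R X \<Longrightarrow> x \<in> X \<Longrightarrow> m \<otimes>\<^bsub>R\<^esub> x \<in> gen_monoid R X"

context ring begin

lemma gen_monoid_subset:
  assumes "X \<subseteq> M" "\<one> \<in> M" "\<And>s t. s \<in> M \<Longrightarrow> t \<in> M \<Longrightarrow> s \<otimes> t \<in> M"
  shows "gen_monoid R X \<subseteq> M"
proof
  fix m assume "m \<in> gen_monoid R X"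
  then show "m \<in> M" by induction (use assms in auto)
qed

lemma gen_monoid_incl:
  assumes "X \<subseteq> carrier R" shows "X \<subseteq> gen_monoid R X"
proof
  fix x assume "x \<in> X"
  then have "\<one> \<otimes> x \<in> gen_monoid R X" by (intro gen_monoid.intros)
  then show "x \<in> gen_monoid R X" using \<open>x \<in> X\<close> assms by auto
qed

lemma gen_monoid_closed:
  assumes "X \<subseteq> carrier R" "m \<in> gen_monoid R X" "n \<in> gen_monoid R X"
  shows "m \<otimes> n \<in> gen_monoid R X"
proof -
  have car: "gen_monoid R X \<subseteq> carrier R" by (rule gen_monoid_subset) (use assms in auto)
  show ?thesis using assms(3)
  proof induction
    case one then show ?case using assms car by auto
  next
    case (snoc k x)
    have "m \<otimes> (k \<otimes> x) = (m \<otimes> k) \<otimes> x"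
      using assms car snoc by (intro m_assoc[symmetric]) auto
    then show ?case using snoc gen_monoid.snoc by metis
  qed
qed

text \<open>Words grow on the right, so both conditions are proved by stripping the last factor x:
  solve t r = u x inside the denominator set containing x, then treat u and the shorter word m by
  induction, which gives (t' t) r = u' (m x). Cancellation goes the same way.\<close>

lemma gen_monoid_Den_l:
  assumes D: "\<S> \<subseteq> Den_l R" and nz: "\<zero> \<notin> gen_monoid R (\<Union>\<S>)"
  shows "gen_monoid R (\<Union>\<S>) \<in> Den_l R"
proof -
  let ?X = "\<Union>\<S>" let ?G = "gen_monoid R ?X"
  have Xc: "?X \<subseteq> carrier R" using D Den_lD(1) by blast
  have car: "?G \<subseteq> carrier R" by (rule gen_monoid_subset) (use Xc in auto)
  have G: "m \<otimes> n \<in> ?G" if "m \<in> ?G" "n \<in> ?G" for m n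
    using gen_monoid_closed[OF Xc that] .
  have XG: "?X \<subseteq> ?G" by (rule gen_monoid_incl[OF Xc])
  have ore: "\<exists>t\<in>?G. \<exists>u\<in>carrier R. t \<otimes> r = u \<otimes> m" if "r \<in> carrier R" "m \<in> ?G" for r m
    using that(2,1)
  proof (induction arbitrary: r)
    case one then show ?case by (intro bexI[of _ \<one>] bexI[of _ r]) (auto intro: gen_monoid.one)
  next
    case (snoc m x)
    obtain S where S: "S \<in> \<S>" "x \<in> S" using snoc by blast
    then have "S \<in> Den_l R" using D by auto
    then obtain t u where tu: "t \<in> S" "u \<in> carrier R" "t \<otimes> r = u \<otimes> x"
      using Den_lD(5)[of S r x] S snoc.prems by auto
    then obtain t' u' where tu': "t' \<in> ?G" "u' \<in> carrier R" "t' \<otimes> u = u' \<otimes> m"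
      using snoc.IH by blast
    have c: "t \<in> carrier R" "t' \<in> carrier R" "m \<in> carrier R" "x \<in> carrier R"
      using tu tu' S Xc car snoc by auto
    have "(t' \<otimes> t) \<otimes> r = u' \<otimes> (m \<otimes> x)"
      using tu tu' c snoc.prems by (metis m_assoc)
    moreover have "t' \<otimes> t \<in> ?G" using G tu' tu S XG by blast
    ultimately show ?case using tu' by blast
  qed
  have den: "\<exists>t\<in>?G. t \<otimes> r = \<zero>" if "r \<in> carrier R" "m \<in> ?G" "r \<otimes> m = \<zero>" for r m
    using that(2,1,3)
  proof (induction arbitrary: r)
    case one then show ?case by (intro bexI[of _ \<one>]) (auto intro: gen_monoid.one)
  next
    case (snoc m x)
    obtain S where S: "S \<in> \<S>" "x \<in> S" using snoc by blast
    have c: "m \<in> carrier R" "x \<in> carrier R" using S Xc car snoc by auto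
    have "(r \<otimes> m) \<otimes> x = \<zero>" using c snoc.prems by (simp add: m_assoc)
    moreover have "S \<in> Den_l R" using D S by auto
    ultimately obtain t where t: "t \<in> S" "t \<otimes> (r \<otimes> m) = \<zero>"
      using Den_lD(6)[of S "r \<otimes> m" x] S c snoc.prems by auto
    have tc: "t \<in> carrier R" using t S Xc by auto
    then obtain t' where t': "t' \<in> ?G" "t' \<otimes> (t \<otimes> r) = \<zero>"
      using snoc.IH[of "t \<otimes> r"] t c snoc.prems by (auto simp: m_assoc)
    have "(t' \<otimes> t) \<otimes> r = \<zero>" using t' tc snoc.prems car by (metis m_assoc subsetD)
    moreover have "t' \<otimes> t \<in> ?G" using G t' t S XG by blast
    ultimately show ?case by blast
  qed
  show ?thesis unfolding Den_l_iff
    using car gen_monoid.one[of R ?X] nz G ore den by (intro conjI ballI impI) auto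
qed

section \<open>Maximal denominator sets and \<open>T_l\<close>\<close>

lemma Den_l_one: "\<one> \<noteq> \<zero> \<Longrightarrow> {\<one>} \<in> Den_l R"
  unfolding Den_l_iff by auto

text \<open>Zorn's lemma; the union of a chain is closed under products and therefore equals the
  monoid it generates. Nonemptiness matters because the intersection of an empty family would be the
  universal set, while \<open>T_l_Den_l\<close> needs 0 outside \<open>strong_L R\<close>.\<close>

lemma max_Den_l_nonempty:
  assumes "\<one> \<noteq> \<zero>" shows "max_Den_l R \<noteq> {}"
proof -
  have "\<exists>M\<in>Den_l R. \<forall>X\<in>Den_l R. M \<subseteq> X \<longrightarrow> X = M"
  proof (rule subset_Zorn_nonempty)
    show "Den_l R \<noteq> {}" using Den_l_one assms by auto
    fix \<C> assume ne: "\<C> \<noteq> {}" and "subset.chain (Den_l R) \<C>"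
    then have D: "\<C> \<subseteq> Den_l R" and ch: "\<And>A B. A \<in> \<C> \<Longrightarrow> B \<in> \<C> \<Longrightarrow> A \<subseteq> B \<or> B \<subseteq> A"
      unfolding subset_chain_def by blast+
    have D': "S \<in> Den_l R" if "S \<in> \<C>" for S using that D by auto
    have mul: "s \<otimes> t \<in> \<Union>\<C>" if st: "s \<in> \<Union>\<C>" "t \<in> \<Union>\<C>" for s t
    proof -
      from st obtain A B where AB: "A \<in> \<C>" "B \<in> \<C>" "s \<in> A" "t \<in> B" by auto
      from ch[OF AB(1,2)] show ?thesis
        using Den_lD(4)[OF D'[OF AB(1)]] Den_lD(4)[OF D'[OF AB(2)]] AB by blast
    qed
    have "gen_monoid R (\<Union>\<C>) \<subseteq> \<Union>\<C>"
      by (rule gen_monoid_subset) (use mul ne Den_lD(2) D' in auto)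
    moreover have "\<Union>\<C> \<subseteq> gen_monoid R (\<Union>\<C>)"
      by (rule gen_monoid_incl) (use D' Den_lD(1) in blast)
    ultimately have eq: "gen_monoid R (\<Union>\<C>) = \<Union>\<C>" by blast
    have "\<zero> \<notin> \<Union>\<C>" using D' Den_lD(3) by blast
    then show "\<Union>\<C> \<in> Den_l R" using gen_monoid_Den_l[OF D] eq by simp
  qed
  then show ?thesis unfolding max_Den_l_def by auto
qed

lemma T_l_subset: "T_l R \<subseteq> strong_L R"
  unfolding T_l_def by auto

lemma T_l_upper: "S \<in> Den_l R \<Longrightarrow> S \<subseteq> strong_L R \<Longrightarrow> S \<subseteq> T_l R"
  unfolding T_l_def by auto

text \<open>A union of denominator sets is not obviously closed under products. The monoid it
  generates stays inside \<open>strong_L R\<close>, which is multiplicative and avoids 0, so that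
  monoid is itself one of the sets in the union and coincides with it.\<close>

lemma T_l_Den_l:
  assumes "\<one> \<noteq> \<zero>" shows "T_l R \<in> Den_l R"
proof -
  let ?\<S> = "{S \<in> Den_l R. S \<subseteq> strong_L R}"
  have D: "S \<in> Den_l R" if "S \<in> max_Den_l R" for S using that unfolding max_Den_l_def by auto
  have mul: "s \<otimes> t \<in> strong_L R" if "s \<in> strong_L R" "t \<in> strong_L R" for s t
    using that Den_lD(4)[OF D] unfolding strong_L_def by blast
  have one: "\<one> \<in> strong_L R" using Den_lD(2)[OF D] unfolding strong_L_def by blast
  have zero: "\<zero> \<notin> strong_L R"
    using max_Den_l_nonempty[OF assms] Den_lD(3)[OF D] unfolding strong_L_def by blast
  have sub: "gen_monoid R (\<Union>?\<S>) \<subseteq> strong_L R"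
    by (rule gen_monoid_subset) (use mul one in auto)
  then have den: "gen_monoid R (\<Union>?\<S>) \<in> Den_l R"
    using zero by (intro gen_monoid_Den_l) auto
  have "gen_monoid R (\<Union>?\<S>) \<subseteq> T_l R" using T_l_upper[OF den sub] .
  moreover have "T_l R \<subseteq> gen_monoid R (\<Union>?\<S>)"
    unfolding T_l_def by (rule gen_monoid_incl) (use Den_lD(1) in blast)
  ultimately show ?thesis using den by simp
qed

section \<open>Regular elements\<close>

lemma regular_elementsD:
  assumes "c \<in> regular_elements R"
  shows "c \<in> carrier R" "\<And>x. x \<in> carrier R \<Longrightarrow> c \<otimes> x = \<zero> \<Longrightarrow> x = \<zero>"
    "\<And>x. x \<in> carrier R \<Longrightarrow> x \<otimes> c = \<zero> \<Longrightarrow> x = \<zero>"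
  using assms unfolding regular_elements_def by blast+

lemma regular_elements_closed:
  assumes s: "s \<in> regular_elements R" and t: "t \<in> regular_elements R"
  shows "s \<otimes> t \<in> regular_elements R"
proof -
  note S = regular_elementsD[OF s] and T = regular_elementsD[OF t]
  have "x = \<zero>" if "x \<in> carrier R" "s \<otimes> t \<otimes> x = \<zero>" for x
    using that S(2)[of "t \<otimes> x"] T(2)[of x] S(1) T(1) by (simp add: m_assoc)
  moreover have "x = \<zero>" if "x \<in> carrier R" "x \<otimes> (s \<otimes> t) = \<zero>" for x
    using that S(3)[of x] T(3)[of "x \<otimes> s"] S(1) T(1) by (simp add: m_assoc)
  ultimately show ?thesis using S(1) T(1) unfolding regular_elements_def by blast
qed

text \<open>The denominator condition moves annihilation to the left: x s = 0 gives t x = 0 with t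
  in \<open>S\<close>. A vanishing \<open>left_ass R S\<close> thus yields cancellation on both
  sides.\<close>

lemma left_ass_zero_iff:
  assumes "S \<in> Den_l R"
  shows "left_ass R S = {\<zero>} \<longleftrightarrow> S \<subseteq> regular_elements R"
proof
  note D = Den_lD[OF assms]
  assume ass: "left_ass R S = {\<zero>}"
  then have l: "x = \<zero>" if "x \<in> carrier R" "s \<in> S" "s \<otimes> x = \<zero>" for x s
    using that unfolding left_ass_def by blast
  show "S \<subseteq> regular_elements R"
    unfolding regular_elements_def using D(6,7) l by blast
next
  note D = Den_lD[OF assms]
  assume reg: "S \<subseteq> regular_elements R"
  have "\<one> \<otimes> \<zero> = \<zero>" by simp
  then have "\<zero> \<in> left_ass R S" unfolding left_ass_def using D(2) by blast
  moreover have "x = \<zero>" if x: "x \<in> left_ass R S" for x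
  proof -
    obtain s where "s \<in> S" "s \<otimes> x = \<zero>" "x \<in> carrier R" using x unfolding left_ass_def by blast
    then show ?thesis using reg unfolding regular_elements_def by blast
  qed
  ultimately show "left_ass R S = {\<zero>}" by blast
qed

lemma one_regular: "\<one> \<in> regular_elements R"
  unfolding regular_elements_def by simp

text \<open>\<open>S_l0 R\<close> is defined by \<open>GREATEST\<close>, so existence has to come
  first. By \<open>left_ass_zero_iff\<close> the competing sets are the denominator sets of regular
  elements, and the monoid they generate again consists of regular elements.\<close>

lemma S_l0_greatest:
  assumes "\<one> \<noteq> \<zero>"
  shows "S_l0 R \<in> Den_l R" "S_l0 R \<subseteq> regular_elements R"
    "\<And>S. S \<in> Den_l R \<Longrightarrow> S \<subseteq> regular_elements R \<Longrightarrow> S \<subseteq> S_l0 R"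
proof -
  let ?\<S> = "{S \<in> Den_l R. S \<subseteq> regular_elements R}" let ?G = "gen_monoid R (\<Union>?\<S>)"
  have sub: "?G \<subseteq> regular_elements R"
    by (rule gen_monoid_subset) (auto intro: regular_elements_closed one_regular)
  have "\<zero> \<notin> regular_elements R" using assms unfolding regular_elements_def by auto
  then have den: "?G \<in> Den_l R" using sub by (intro gen_monoid_Den_l) auto
  have inc: "\<Union>?\<S> \<subseteq> ?G" by (rule gen_monoid_incl) (use Den_lD(1) in blast)
  have eq: "S_l0 R = ?G" unfolding S_l0_def
  proof (rule Greatest_equality)
    show "?G \<in> Den_l R \<and> left_ass R ?G = {\<zero>}"
      using den sub left_ass_zero_iff by blast
    fix S assume "S \<in> Den_l R \<and> left_ass R S = {\<zero>}"
    then show "S \<subseteq> ?G" using inc left_ass_zero_iff by blast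
  qed
  show "S_l0 R \<in> Den_l R" "S_l0 R \<subseteq> regular_elements R" unfolding eq by (fact den sub)+
  show "S \<subseteq> S_l0 R" if "S \<in> Den_l R" "S \<subseteq> regular_elements R" for S
    unfolding eq using that inc by auto
qed

lemma regular_elements_Den_lI:
  assumes "\<one> \<noteq> \<zero>"
    and "\<And>r s. r \<in> carrier R \<Longrightarrow> s \<in> regular_elements R \<Longrightarrow>
      \<exists>t\<in>regular_elements R. \<exists>u\<in>carrier R. t \<otimes> r = u \<otimes> s"
  shows "regular_elements R \<in> Den_l R"
proof -
  let ?C = "regular_elements R"
  have "?C \<subseteq> carrier R" "\<zero> \<notin> ?C" using assms(1) unfolding regular_elements_def by auto
  moreover have "\<exists>t\<in>?C. t \<otimes> r = \<zero>" if "r \<in> carrier R" "s \<in> ?C" "r \<otimes> s = \<zero>" for r s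
    using regular_elementsD(3)[OF that(2,1,3)] one_regular by (intro bexI[of _ \<one>]) simp_all
  ultimately show ?thesis
    unfolding Den_l_iff using one_regular regular_elements_closed assms(2)
    by (intro conjI ballI impI) simp_all
qed

text \<open>Translates existence of the classical quotient ring into membership in
  \<open>Den_l R\<close>: for regular s, r s = 0 already means r = 0, so 1 is a witness.\<close>

lemma left_Ore_regular_Den_l:
  "left_Ore_set R (regular_elements R) \<longleftrightarrow> regular_elements R \<in> Den_l R"
proof -
  have "r \<in> left_ass R (regular_elements R)"
    if "r \<in> carrier R" "s \<in> regular_elements R" "r \<otimes> s = \<zero>" for r s
    using regular_elementsD(3)[OF that(2,1,3)] one_regular that(1)
    unfolding left_ass_def by (auto intro!: bexI[of _ \<one>])
  then show ?thesis unfolding Den_l_def by blast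
qed

end

section \<open>The localization ring\<close>

locale left_denominator = ring R for R (structure) +
  fixes S assumes Den: "S \<in> Den_l R"
begin

lemmas D = Den_lD[OF Den]

lemma S_carrier [simp]: "s \<in> S \<Longrightarrow> s \<in> carrier R"
  using D(7) .

lemma one_S [simp]: "\<one> \<in> S"
  using D(2) .

lemma S_mult [simp]: "s \<in> S \<Longrightarrow> t \<in> S \<Longrightarrow> s \<otimes> t \<in> S"
  using D(4) .

lemma ore:
  assumes "r \<in> carrier R" "s \<in> S"
  obtains t u where "t \<in> S" "u \<in> carrier R" "t \<otimes> r = u \<otimes> s"
  using D(5)[OF assms] by blast

lemma S_cancel:
  assumes "s \<in> S" "x \<in> carrier R" "y \<in> carrier R" "x \<otimes> s = y \<otimes> s"
  obtains t where "t \<in> S" "t \<otimes> x = t \<otimes> y"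
proof -
  have "(x \<ominus> y) \<otimes> s = \<zero>"
    using assms by (simp add: a_minus_def l_distr l_minus r_neg)
  then obtain t where t: "t \<in> S" "t \<otimes> (x \<ominus> y) = \<zero>" using D(6)[of "x \<ominus> y" s] assms by auto
  then have "t \<otimes> x = t \<otimes> y" using mult_minus_eq_zero_iff assms by simp
  then show thesis using t that by blast
qed

text \<open>The common multiple is in \<open>S\<close> because u and s are; v is just a ring
  element.\<close>

lemma common_S:
  assumes "s \<in> S" "t \<in> S"
  obtains u v where "u \<in> S" "v \<in> carrier R" "u \<otimes> s = v \<otimes> t" "u \<otimes> s \<in> S"
  using ore[of s t] assms by (metis S_carrier S_mult)

section \<open>Equality of left fractions\<close>

abbreviation fr where "fr \<equiv> frac_rel R S"
abbreviation fc where "fc \<equiv> left_frac R S"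
abbreviation L where "L \<equiv> left_loc R S"
abbreviation mult_L (infixl "\<diamondop>" 70) where "x \<diamondop> y \<equiv> x \<otimes>\<^bsub>L\<^esub> y"

lemma frI:
  assumes "s \<in> S" "r \<in> carrier R" "s' \<in> S" "r' \<in> carrier R" "c \<in> carrier R" "d \<in> carrier R"
    "c \<otimes> s = d \<otimes> s'" "c \<otimes> s \<in> S" "c \<otimes> r = d \<otimes> r'"
  shows "((s, r), (s', r')) \<in> fr"
  using assms unfolding frac_rel_def by blast

lemma frE:
  assumes "((s, r), (s', r')) \<in> fr"
  obtains c d where "s \<in> S" "r \<in> carrier R" "s' \<in> S" "r' \<in> carrier R" "c \<in> carrier R"
    "d \<in> carrier R" "c \<otimes> s = d \<otimes> s'" "c \<otimes> s \<in> S" "c \<otimes> r = d \<otimes> r'"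
  using assms unfolding frac_rel_def by blast

lemma frD:
  assumes "((s, r), (s', r')) \<in> fr"
  shows "s \<in> S" "r \<in> carrier R" "s' \<in> S" "r' \<in> carrier R"
  using frE[OF assms] by metis+

text \<open>Equality of two fractions is witnessed by one pair e, f, but every other common multiple
  p s = q s' of the denominators has to give the same numerators up to a left factor. Transitivity
  and the independence of both operations from choices rest on this.\<close>

lemma fr_cancel:
  assumes "((s, r), (s', r')) \<in> fr" "p \<in> carrier R" "q \<in> carrier R" "p \<otimes> s = q \<otimes> s'"
  obtains t where "t \<in> S" "t \<otimes> (p \<otimes> r) = t \<otimes> (q \<otimes> r')"
proof -
  obtain e f where ef: "s \<in> S" "r \<in> carrier R" "s' \<in> S" "r' \<in> carrier R" "e \<in> carrier R"
    "f \<in> carrier R" "e \<otimes> s = f \<otimes> s'" "e \<otimes> s \<in> S" "e \<otimes> r = f \<otimes> r'"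
    using frE[OF assms(1)] .
  \<comment> \<open>Ore brings p s and the known common denominator e s together. Cancelling s
    compares p with e, and cancelling s' compares q with f.\<close>
  obtain u w where u: "u \<in> S" "w \<in> carrier R" "u \<otimes> (p \<otimes> s) = w \<otimes> (e \<otimes> s)"
    using ore[of "p \<otimes> s" "e \<otimes> s"] ef assms by auto
  have "(u \<otimes> p) \<otimes> s = (w \<otimes> e) \<otimes> s" using u ef assms by (simp add: m_assoc)
  then obtain t1 where t1: "t1 \<in> S" "t1 \<otimes> (u \<otimes> p) = t1 \<otimes> (w \<otimes> e)"
    using S_cancel[of s "u \<otimes> p" "w \<otimes> e"] u ef assms by auto
  have "(u \<otimes> q) \<otimes> s' = (w \<otimes> f) \<otimes> s'" using u ef assms by (simp add: m_assoc)
  then obtain t2 where t2: "t2 \<in> S" "t2 \<otimes> (u \<otimes> q) = t2 \<otimes> (w \<otimes> f)"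
    using S_cancel[of s' "u \<otimes> q" "w \<otimes> f"] u ef assms by auto
  \<comment> \<open>The two cancellations produce different multipliers t1 and t2; a common multiple
    in \<open>S\<close> serves both.\<close>
  obtain x y where xy: "x \<in> S" "y \<in> carrier R" "x \<otimes> t1 = y \<otimes> t2" "x \<otimes> t1 \<in> S"
    using common_S t1(1) t2(1) .
  let ?t = "x \<otimes> t1"
  have c: "t1 \<in> carrier R" "t2 \<in> carrier R" "x \<in> carrier R" "u \<in> carrier R" using t1 t2 xy u by auto
  have 1: "?t \<otimes> (u \<otimes> p) = ?t \<otimes> (w \<otimes> e)"
    using t1(2) c assms ef u by (simp add: m_assoc)
  have 2: "?t \<otimes> (u \<otimes> q) = ?t \<otimes> (w \<otimes> f)"
    unfolding xy(3) using t2(2) c assms ef u xy by (simp add: m_assoc)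
  have "?t \<otimes> u \<otimes> (p \<otimes> r) = ?t \<otimes> (u \<otimes> p) \<otimes> r"
    using c assms ef by (simp add: m_assoc)
  also have "\<dots> = ?t \<otimes> w \<otimes> (e \<otimes> r)"
    unfolding 1 using c assms ef u by (simp add: m_assoc)
  also have "\<dots> = ?t \<otimes> (w \<otimes> f) \<otimes> r'"
    unfolding ef(9) using c assms ef(1-8) u by (simp add: m_assoc)
  also have "\<dots> = ?t \<otimes> u \<otimes> (q \<otimes> r')"
    unfolding 2[symmetric] using c assms ef by (simp add: m_assoc)
  finally show thesis using that[of "?t \<otimes> u"] xy u t1 by simp
qed

lemma fr_expand:
  assumes "s \<in> S" "r \<in> carrier R" "c \<in> carrier R" "c \<otimes> s \<in> S"
  shows "((s, r), (c \<otimes> s, c \<otimes> r)) \<in> fr"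
  by (rule frI[of _ _ _ _ c \<one>]) (use assms in auto)

lemma fr_sym:
  assumes "((s, r), (s', r')) \<in> fr" shows "((s', r'), (s, r)) \<in> fr"
proof -
  obtain c d where "s \<in> S" "r \<in> carrier R" "s' \<in> S" "r' \<in> carrier R" "c \<in> carrier R"
    "d \<in> carrier R" "c \<otimes> s = d \<otimes> s'" "c \<otimes> s \<in> S" "c \<otimes> r = d \<otimes> r'"
    using frE[OF assms] .
  then show ?thesis by (intro frI[of _ _ _ _ d c]) auto
qed

text \<open>The common denominator d s' of the first relation is pushed into a multiple of s''. The
  witnesses of the second relation need not have that shape, which is what \<open>fr_cancel\<close>
  repairs.\<close>

lemma fr_trans:
  assumes "((s, r), (s', r')) \<in> fr" "((s', r'), (s'', r'')) \<in> fr"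
  shows "((s, r), (s'', r'')) \<in> fr"
proof -
  obtain c d where cd: "s \<in> S" "r \<in> carrier R" "s' \<in> S" "r' \<in> carrier R" "c \<in> carrier R"
    "d \<in> carrier R" "c \<otimes> s = d \<otimes> s'" "c \<otimes> s \<in> S" "c \<otimes> r = d \<otimes> r'"
    using frE[OF assms(1)] .
  have s'': "s'' \<in> S" "r'' \<in> carrier R" using frD[OF assms(2)] by auto
  obtain u v where uv: "u \<in> S" "v \<in> carrier R" "u \<otimes> (d \<otimes> s') = v \<otimes> s''" "u \<otimes> (d \<otimes> s') \<in> S"
    using common_S[of "d \<otimes> s'" s''] cd s'' by auto
  obtain t where t: "t \<in> S" "t \<otimes> ((u \<otimes> d) \<otimes> r') = t \<otimes> (v \<otimes> r'')"
    using fr_cancel[OF assms(2), of "u \<otimes> d" v] uv cd by (auto simp: m_assoc)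
  show ?thesis
  proof (rule frI[of _ _ _ _ "t \<otimes> u \<otimes> c" "t \<otimes> v"])
    have "t \<otimes> u \<otimes> c \<otimes> s = t \<otimes> (u \<otimes> (d \<otimes> s'))"
      unfolding cd(7)[symmetric] using t uv cd by (simp add: m_assoc)
    then show "t \<otimes> u \<otimes> c \<otimes> s = t \<otimes> v \<otimes> s''" "t \<otimes> u \<otimes> c \<otimes> s \<in> S"
      using uv t s'' by (auto simp: m_assoc)
    have "t \<otimes> u \<otimes> c \<otimes> r = t \<otimes> (u \<otimes> (d \<otimes> r'))"
      unfolding cd(9)[symmetric] using t uv cd by (simp add: m_assoc)
    then show "t \<otimes> u \<otimes> c \<otimes> r = t \<otimes> v \<otimes> r''"
      using t uv cd s'' by (simp add: m_assoc)
  qed (use t uv cd s'' in auto)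
qed

lemma fr_equiv: "equiv (S \<times> carrier R) fr"
proof (rule equivI)
  show "fr \<subseteq> (S \<times> carrier R) \<times> S \<times> carrier R"
    unfolding frac_rel_def by auto
  show "refl_on (S \<times> carrier R) fr"
    by (rule refl_onI) (auto intro!: frI[of _ _ _ _ \<one> \<one>])
  show "sym fr" by (rule symI) (auto intro: fr_sym)
  show "trans fr" by (rule transI) (auto intro: fr_trans)
qed

section \<open>Fraction classes and their operations\<close>

lemma mem_fc: "(s', r') \<in> fc s r \<longleftrightarrow> ((s, r), (s', r')) \<in> fr"
  unfolding left_frac_def by auto

lemma fc_eq_iff:
  assumes "s \<in> S" "r \<in> carrier R" "s' \<in> S" "r' \<in> carrier R"
  shows "fc s r = fc s' r' \<longleftrightarrow> ((s, r), (s', r')) \<in> fr"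
  unfolding left_frac_def using eq_equiv_class_iff[OF fr_equiv] assms by auto

lemma fc_expand:
  assumes "s \<in> S" "r \<in> carrier R" "c \<in> carrier R" "c \<otimes> s \<in> S"
  shows "fc (c \<otimes> s) (c \<otimes> r) = fc s r"
  using fc_eq_iff[of s r "c \<otimes> s" "c \<otimes> r"] fr_expand assms by auto

lemma fc_carrier [simp]: "s \<in> S \<Longrightarrow> r \<in> carrier R \<Longrightarrow> fc s r \<in> carrier L"
  unfolding left_loc_def left_frac_def by (auto intro: quotientI)

lemma carrier_fc:
  assumes "x \<in> carrier L"
  obtains s r where "s \<in> S" "r \<in> carrier R" "x = fc s r"
  using assms unfolding left_loc_def left_frac_def by (auto elim: quotientE)

text \<open>With the left numerator already of the form b s, the Ore choice can be 1 and b, so the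
  product has a closed formula. Its proof contains well-definedness: the union that defines the
  product has a single member.\<close>

lemma loc_mult:
  assumes "a \<in> S" "b \<in> carrier R" "s \<in> S" "r \<in> carrier R"
  shows "fc a (b \<otimes> s) \<diamondop> fc s r = fc a (b \<otimes> r)"
proof -
  let ?U = "{left_frac R S (s' \<otimes> s1) (r' \<otimes> r2) | s1 r1 s2 r2 s' r'.
        (s1, r1) \<in> fc a (b \<otimes> s) \<and> (s2, r2) \<in> fc s r \<and> s' \<in> S \<and> r' \<in> carrier R \<and>
        s' \<otimes> r1 = r' \<otimes> s2}"
  have eq: "fc (s' \<otimes> s1) (r' \<otimes> r2) = fc a (b \<otimes> r)"
    if 1: "((a, b \<otimes> s), (s1, r1)) \<in> fr" and 2: "((s, r), (s2, r2)) \<in> fr"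
      and s': "s' \<in> S" "r' \<in> carrier R" "s' \<otimes> r1 = r' \<otimes> s2" for s1 r1 s2 r2 s' r'
  proof -
    note 3 = frD[OF 1] frD[OF 2]
    have "((a, b \<otimes> s), (s' \<otimes> s1, s' \<otimes> r1)) \<in> fr"
      using fr_trans[OF 1 fr_expand[of s1 r1 s']] s' 3 by auto
    then obtain c d where cd: "c \<in> carrier R" "d \<in> carrier R" "c \<otimes> a = d \<otimes> (s' \<otimes> s1)"
      "c \<otimes> a \<in> S" "c \<otimes> (b \<otimes> s) = d \<otimes> (s' \<otimes> r1)"
      by (elim frE)
    \<comment> \<open>The elements c b and d r' give a common multiple of s and s2, the two
      denominators of the right factor, so \<open>fr_cancel\<close> can compare the numerators r and
      r2.\<close>
    have "c \<otimes> b \<otimes> s = d \<otimes> r' \<otimes> s2"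
      using cd(5) unfolding s'(3) using cd assms s' 3 by (simp add: m_assoc)
    then obtain t where t: "t \<in> S" "t \<otimes> (c \<otimes> b \<otimes> r) = t \<otimes> (d \<otimes> r' \<otimes> r2)"
      using fr_cancel[OF 2, of "c \<otimes> b" "d \<otimes> r'"] cd assms s' by auto
    have "((a, b \<otimes> r), (s' \<otimes> s1, r' \<otimes> r2)) \<in> fr"
    proof (rule frI[of _ _ _ _ "t \<otimes> c" "t \<otimes> d"])
      have e: "t \<otimes> c \<otimes> a = t \<otimes> (c \<otimes> a)" using t cd assms by (simp add: m_assoc)
      then show "t \<otimes> c \<otimes> a \<in> S" using t cd by simp
      show "t \<otimes> c \<otimes> a = t \<otimes> d \<otimes> (s' \<otimes> s1)"
        unfolding e cd(3) using t cd(1,2) s' 3 by (simp add: m_assoc)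
      show "t \<otimes> c \<otimes> (b \<otimes> r) = t \<otimes> d \<otimes> (r' \<otimes> r2)"
        using t cd(1,2) s' 3 assms by (simp add: m_assoc)
    qed (use s' 3 t cd assms in auto)
    from fr_sym[OF this] show ?thesis using fc_eq_iff s' 3 assms by auto
  qed
  have 1: "((a, b \<otimes> s), (a, b \<otimes> s)) \<in> fr" "((s, r), (s, r)) \<in> fr"
    using assms by (auto intro!: frI[of _ _ _ _ \<one> \<one>])
  have 2: "\<one> \<in> S" "b \<in> carrier R" "\<one> \<otimes> (b \<otimes> s) = b \<otimes> s" using assms by auto
  have "?U = {fc a (b \<otimes> r)}"
  proof (intro equalityI subsetI)
    fix X assume "X \<in> ?U"
    then obtain s1 r1 s2 r2 s' r' where "X = fc (s' \<otimes> s1) (r' \<otimes> r2)"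
      "((a, b \<otimes> s), (s1, r1)) \<in> fr" "((s, r), (s2, r2)) \<in> fr" "s' \<in> S" "r' \<in> carrier R"
      "s' \<otimes> r1 = r' \<otimes> s2"
      unfolding mem_fc mem_Collect_eq by (elim exE conjE)
    then show "X \<in> {fc a (b \<otimes> r)}" using eq by simp
  next
    fix X assume "X \<in> {fc a (b \<otimes> r)}"
    then have "X = fc (\<one> \<otimes> a) (b \<otimes> r)" using eq[OF 1 2] by simp
    with 1 2 show "X \<in> ?U" unfolding mem_fc mem_Collect_eq by (intro exI conjI)
  qed
  then show ?thesis unfolding left_loc_def by simp
qed

text \<open>Over a common denominator the choice c = d = 1 is available, and the defining union
  again collapses to one class.\<close>

lemma loc_add:
  assumes "s \<in> S" "p \<in> carrier R" "q \<in> carrier R"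
  shows "fc s p \<oplus>\<^bsub>L\<^esub> fc s q = fc s (p \<oplus> q)"
proof -
  let ?U = "{left_frac R S (c \<otimes> s1) ((c \<otimes> r1) \<oplus> (d \<otimes> r2)) | s1 r1 s2 r2 c d.
        (s1, r1) \<in> fc s p \<and> (s2, r2) \<in> fc s q \<and> c \<in> S \<and> d \<in> carrier R \<and>
        c \<otimes> s1 = d \<otimes> s2}"
  have eq: "fc (c \<otimes> s1) ((c \<otimes> r1) \<oplus> (d \<otimes> r2)) = fc s (p \<oplus> q)"
    if 1: "((s, p), (s1, r1)) \<in> fr" and 2: "((s, q), (s2, r2)) \<in> fr"
      and c: "c \<in> S" "d \<in> carrier R" "c \<otimes> s1 = d \<otimes> s2" for s1 r1 s2 r2 c d
  proof -
    note 3 = frD[OF 1] frD[OF 2]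
    have cs1: "c \<otimes> s1 \<in> S" using S_mult[OF c(1) 3(3)] .
    have "((s, p), (c \<otimes> s1, c \<otimes> r1)) \<in> fr"
      by (rule fr_trans[OF 1 fr_expand]) (use c(1) 3 cs1 in auto)
    then obtain e f where ef: "e \<in> carrier R" "f \<in> carrier R" "e \<otimes> s = f \<otimes> (c \<otimes> s1)"
      "e \<otimes> s \<in> S" "e \<otimes> p = f \<otimes> (c \<otimes> r1)"
      by (elim frE)
    have "((s2, r2), (c \<otimes> s1, d \<otimes> r2)) \<in> fr"
      unfolding c(3) by (rule fr_expand) (use c(2) 3 cs1[unfolded c(3)] in auto)
    from fr_trans[OF 2 this] have "((s, q), (c \<otimes> s1, d \<otimes> r2)) \<in> fr" .
    from fr_cancel[OF this ef(1,2,3)]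
    obtain t where t: "t \<in> S" "t \<otimes> (e \<otimes> q) = t \<otimes> (f \<otimes> (d \<otimes> r2))" .
    have "((s, p \<oplus> q), (c \<otimes> s1, (c \<otimes> r1) \<oplus> (d \<otimes> r2))) \<in> fr"
    proof (rule frI[of _ _ _ _ "t \<otimes> e" "t \<otimes> f"])
      have e: "t \<otimes> e \<otimes> s = t \<otimes> (e \<otimes> s)" using t ef assms by (simp add: m_assoc)
      then show "t \<otimes> e \<otimes> s \<in> S" using t ef by simp
      show "t \<otimes> e \<otimes> s = t \<otimes> f \<otimes> (c \<otimes> s1)"
        unfolding e ef(3) using t ef(1,2) c 3 by (simp add: m_assoc)
      have "t \<otimes> e \<otimes> (p \<oplus> q) = t \<otimes> (e \<otimes> p) \<oplus> t \<otimes> (e \<otimes> q)"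
        using t(1) ef(1) assms by (simp add: m_assoc r_distr)
      also have "\<dots> = t \<otimes> f \<otimes> ((c \<otimes> r1) \<oplus> (d \<otimes> r2))"
        unfolding t(2) ef(5) using t(1) ef(1,2) c 3 by (simp add: m_assoc r_distr)
      finally show "t \<otimes> e \<otimes> (p \<oplus> q) = t \<otimes> f \<otimes> ((c \<otimes> r1) \<oplus> (d \<otimes> r2))" .
    qed (use c(1,2) cs1 3 t ef(1,2) assms in auto)
    from fr_sym[OF this] show ?thesis using fc_eq_iff c(1,2) cs1 3 assms by auto
  qed
  have 1: "((s, p), (s, p)) \<in> fr" "((s, q), (s, q)) \<in> fr"
    using assms by (auto intro!: frI[of _ _ _ _ \<one> \<one>])
  have 2: "\<one> \<in> S" "\<one> \<in> carrier R" "\<one> \<otimes> s = \<one> \<otimes> s" by auto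
  have "?U = {fc s (p \<oplus> q)}"
  proof (intro equalityI subsetI)
    fix X assume "X \<in> ?U"
    then obtain s1 r1 s2 r2 c d where "X = fc (c \<otimes> s1) ((c \<otimes> r1) \<oplus> (d \<otimes> r2))"
      "((s, p), (s1, r1)) \<in> fr" "((s, q), (s2, r2)) \<in> fr" "c \<in> S" "d \<in> carrier R"
      "c \<otimes> s1 = d \<otimes> s2"
      unfolding mem_fc mem_Collect_eq by (elim exE conjE)
    then show "X \<in> {fc s (p \<oplus> q)}" using eq by simp
  next
    fix X assume "X \<in> {fc s (p \<oplus> q)}"
    then have "X = fc (\<one> \<otimes> s) (\<one> \<otimes> p \<oplus> \<one> \<otimes> q)" using eq[OF 1 2] by simp
    with 1 2 show "X \<in> ?U" unfolding mem_fc mem_Collect_eq by (intro exI conjI)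
  qed
  then show ?thesis unfolding left_loc_def by simp
qed

lemma loc_one: "\<one>\<^bsub>L\<^esub> = fc \<one> \<one>" and loc_zero: "\<zero>\<^bsub>L\<^esub> = fc \<one> \<zero>"
  unfolding left_loc_def by auto

lemma fc_zero: "s \<in> S \<Longrightarrow> fc s \<zero> = \<zero>\<^bsub>L\<^esub>"
  unfolding loc_zero using fc_expand[of \<one> \<zero> s] by simp

lemma fc_one: "s \<in> S \<Longrightarrow> fc s s = \<one>\<^bsub>L\<^esub>"
  unfolding loc_one using fc_expand[of \<one> \<one> s] by simp

section \<open>Common denominators and composable forms\<close>

lemma common_denominator:
  assumes "x \<in> carrier L" "s \<in> S"
  obtains c r where "c \<in> S" "c \<otimes> s \<in> S" "r \<in> carrier R" "x = fc (c \<otimes> s) r"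
proof -
  obtain s' r' where x: "s' \<in> S" "r' \<in> carrier R" "x = fc s' r'" using carrier_fc[OF assms(1)] .
  obtain u v where uv: "u \<in> S" "v \<in> carrier R" "u \<otimes> s = v \<otimes> s'" "u \<otimes> s \<in> S"
    using common_S[OF assms(2) x(1)] .
  have "x = fc (u \<otimes> s) (v \<otimes> r')"
    unfolding uv(3) x(3) using fc_expand[of s' r' v] uv x by simp
  then show thesis using that[of u "v \<otimes> r'"] uv x by auto
qed

lemma common_denominator2:
  assumes "x \<in> carrier L" "y \<in> carrier L"
  obtains s p q where "s \<in> S" "p \<in> carrier R" "q \<in> carrier R" "x = fc s p" "y = fc s q"
proof -
  obtain s r where x: "s \<in> S" "r \<in> carrier R" "x = fc s r" using carrier_fc[OF assms(1)] .
  obtain c q where "c \<in> S" "c \<otimes> s \<in> S" "q \<in> carrier R" "y = fc (c \<otimes> s) q"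
    using common_denominator[OF assms(2) x(1)] .
  then show thesis using that[of "c \<otimes> s" "c \<otimes> r" q] fc_expand[of s r c] x by auto
qed

lemma common_denominator3:
  assumes "x \<in> carrier L" "y \<in> carrier L" "z \<in> carrier L"
  obtains s p q r where "s \<in> S" "p \<in> carrier R" "q \<in> carrier R" "r \<in> carrier R"
    "x = fc s p" "y = fc s q" "z = fc s r"
proof -
  obtain s p q where x: "s \<in> S" "p \<in> carrier R" "q \<in> carrier R" "x = fc s p" "y = fc s q"
    using common_denominator2[OF assms(1,2)] .
  obtain c r where "c \<in> S" "c \<otimes> s \<in> S" "r \<in> carrier R" "z = fc (c \<otimes> s) r"
    using common_denominator[OF assms(3) x(1)] .
  then show thesis
    using that[of "c \<otimes> s" "c \<otimes> p" "c \<otimes> q" r] fc_expand[of s _ c] x by auto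
qed

lemma right_multiple_form:
  assumes "x \<in> carrier L" "s \<in> S"
  obtains a b where "a \<in> S" "b \<in> carrier R" "x = fc a (b \<otimes> s)"
proof -
  obtain s' r' where x: "s' \<in> S" "r' \<in> carrier R" "x = fc s' r'" using carrier_fc[OF assms(1)] .
  obtain t u where tu: "t \<in> S" "u \<in> carrier R" "t \<otimes> r' = u \<otimes> s" using ore[OF x(2) assms(2)] .
  then show thesis using that[of "t \<otimes> s'" u] fc_expand[of s' r' t] x by auto
qed

text \<open>Right distributivity multiplies two left factors by one fraction with denominator s, so
  both numerators must end in s over one denominator.\<close>

lemma right_multiple_form2:
  assumes "x \<in> carrier L" "y \<in> carrier L" "s \<in> S"
  obtains a b c where "a \<in> S" "b \<in> carrier R" "c \<in> carrier R" "x = fc a (b \<otimes> s)" "y = fc a (c \<otimes> s)"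
proof -
  obtain a p q where a: "a \<in> S" "p \<in> carrier R" "q \<in> carrier R" "x = fc a p" "y = fc a q"
    using common_denominator2[OF assms(1,2)] .
  obtain t u where t: "t \<in> S" "u \<in> carrier R" "t \<otimes> p = u \<otimes> s" using ore[OF a(2) assms(3)] .
  obtain t' u' where t': "t' \<in> S" "u' \<in> carrier R" "t' \<otimes> (t \<otimes> q) = u' \<otimes> s"
    using ore[of "t \<otimes> q" s] assms a t by auto
  have "x = fc (t' \<otimes> (t \<otimes> a)) ((t' \<otimes> u) \<otimes> s)"
    using fc_expand[of a p "t' \<otimes> t"] a t t' assms by (simp add: m_assoc)
  moreover have "y = fc (t' \<otimes> (t \<otimes> a)) (u' \<otimes> s)"
    using fc_expand[of a q "t' \<otimes> t"] a t t' assms by (simp add: m_assoc)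
  ultimately show thesis using that[of "t' \<otimes> (t \<otimes> a)" "t' \<otimes> u" u'] a t t' by auto
qed

lemma loc_mult_closed:
  assumes "x \<in> carrier L" "y \<in> carrier L" shows "x \<diamondop> y \<in> carrier L"
proof -
  obtain s r where y: "s \<in> S" "r \<in> carrier R" "y = fc s r" using carrier_fc[OF assms(2)] .
  obtain a b where "a \<in> S" "b \<in> carrier R" "x = fc a (b \<otimes> s)"
    using right_multiple_form[OF assms(1) y(1)] .
  then show ?thesis using loc_mult y by simp
qed

text \<open>Fractions are put into the shapes for which \<open>loc_mult\<close> and
  \<open>loc_add\<close> have closed formulas; the axioms then follow from those for
  numerators.\<close>

lemma loc_ring: "ring L"
proof (rule ringI)
  show "abelian_group L"
  proof (rule abelian_groupI)
    fix x y assume "x \<in> carrier L" "y \<in> carrier L"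
    then obtain s p q where "s \<in> S" "p \<in> carrier R" "q \<in> carrier R" "x = fc s p" "y = fc s q"
      by (rule common_denominator2)
    then show "x \<oplus>\<^bsub>L\<^esub> y \<in> carrier L" "x \<oplus>\<^bsub>L\<^esub> y = y \<oplus>\<^bsub>L\<^esub> x"
      by (auto simp: loc_add a_comm)
  next
    fix x y z assume "x \<in> carrier L" "y \<in> carrier L" "z \<in> carrier L"
    then obtain s p q r where "s \<in> S" "p \<in> carrier R" "q \<in> carrier R" "r \<in> carrier R"
      "x = fc s p" "y = fc s q" "z = fc s r"
      by (rule common_denominator3)
    then show "x \<oplus>\<^bsub>L\<^esub> y \<oplus>\<^bsub>L\<^esub> z = x \<oplus>\<^bsub>L\<^esub> (y \<oplus>\<^bsub>L\<^esub> z)"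
      by (simp add: loc_add a_assoc)
  next
    show "\<zero>\<^bsub>L\<^esub> \<in> carrier L" unfolding loc_zero by simp
    fix x assume "x \<in> carrier L"
    then obtain s r where x: "s \<in> S" "r \<in> carrier R" "x = fc s r" by (rule carrier_fc)
    then show "\<zero>\<^bsub>L\<^esub> \<oplus>\<^bsub>L\<^esub> x = x"
      unfolding fc_zero[OF x(1), symmetric] by (simp add: loc_add)
    have "fc s (\<ominus> r) \<oplus>\<^bsub>L\<^esub> x = \<zero>\<^bsub>L\<^esub>"
      using x by (simp add: loc_add l_neg fc_zero)
    then show "\<exists>y\<in>carrier L. y \<oplus>\<^bsub>L\<^esub> x = \<zero>\<^bsub>L\<^esub>" using x by (meson a_inv_closed fc_carrier)
  qed
  show "monoid L"
  proof (rule monoidI)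
    fix x y assume "x \<in> carrier L" "y \<in> carrier L"
    then show "x \<diamondop> y \<in> carrier L" by (rule loc_mult_closed)
  next
    fix x y z assume x: "x \<in> carrier L" and y: "y \<in> carrier L" and z: "z \<in> carrier L"
    \<comment> \<open>Representatives are fixed from right to left: the numerator of y must end in
      the denominator of z, and that of x in the denominator of y.\<close>
    obtain s r where z: "s \<in> S" "r \<in> carrier R" "z = fc s r" using carrier_fc[OF z] .
    obtain t u where y: "t \<in> S" "u \<in> carrier R" "y = fc t (u \<otimes> s)"
      using right_multiple_form[OF y z(1)] .
    obtain a b where x: "a \<in> S" "b \<in> carrier R" "x = fc a (b \<otimes> t)"
      using right_multiple_form[OF x y(1)] .
    have "x \<diamondop> y = fc a ((b \<otimes> u) \<otimes> s)" using loc_mult[of a b t "u \<otimes> s"] x y z by (simp add: m_assoc)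
    then have "(x \<diamondop> y) \<diamondop> z = fc a (b \<otimes> (u \<otimes> r))"
      using loc_mult[of a "b \<otimes> u" s r] x y z by (simp add: m_assoc)
    moreover have "y \<diamondop> z = fc t (u \<otimes> r)" using loc_mult y z by simp
    ultimately show "x \<diamondop> y \<diamondop> z = x \<diamondop> (y \<diamondop> z)"
      using loc_mult[of a b t "u \<otimes> r"] x y z by simp
  next
    show "\<one>\<^bsub>L\<^esub> \<in> carrier L" unfolding loc_one by simp
    fix x assume "x \<in> carrier L"
    then obtain s r where x: "s \<in> S" "r \<in> carrier R" "x = fc s r" by (rule carrier_fc)
    show "\<one>\<^bsub>L\<^esub> \<diamondop> x = x"
      unfolding fc_one[OF x(1), symmetric] using loc_mult[of s \<one> s r] x by simp
    show "x \<diamondop> \<one>\<^bsub>L\<^esub> = x"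
      unfolding loc_one using loc_mult[of s r \<one> \<one>] x by simp
  qed
next
  fix x y z assume x: "x \<in> carrier L" and y: "y \<in> carrier L" and z: "z \<in> carrier L"
  obtain s r where z': "s \<in> S" "r \<in> carrier R" "z = fc s r" using carrier_fc[OF z] .
  obtain a b c where xy: "a \<in> S" "b \<in> carrier R" "c \<in> carrier R" "x = fc a (b \<otimes> s)" "y = fc a (c \<otimes> s)"
    using right_multiple_form2[OF x y z'(1)] .
  have "x \<oplus>\<^bsub>L\<^esub> y = fc a ((b \<oplus> c) \<otimes> s)" using xy z' by (simp add: loc_add l_distr)
  then show "(x \<oplus>\<^bsub>L\<^esub> y) \<diamondop> z = x \<diamondop> z \<oplus>\<^bsub>L\<^esub> y \<diamondop> z"
    using xy z' loc_mult[of a "b \<oplus> c" s r] by (simp add: loc_add loc_mult l_distr)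
  obtain s p q where s: "s \<in> S" "p \<in> carrier R" "q \<in> carrier R" "x = fc s p" "y = fc s q"
    using common_denominator2[OF x y] .
  obtain a b where z: "a \<in> S" "b \<in> carrier R" "z = fc a (b \<otimes> s)"
    using right_multiple_form[OF z s(1)] .
  show "z \<diamondop> (x \<oplus>\<^bsub>L\<^esub> y) = z \<diamondop> x \<oplus>\<^bsub>L\<^esub> z \<diamondop> y"
    using s z by (simp add: loc_add loc_mult r_distr)
qed

section \<open>The canonical homomorphism\<close>

lemma loc_map_hom: "fc \<one> \<in> ring_hom R L"
proof (rule ring_hom_memI)
  fix x y assume x: "x \<in> carrier R" "y \<in> carrier R"
  show "fc \<one> x \<in> carrier L" using x by simp
  show "fc \<one> (x \<otimes> y) = fc \<one> x \<diamondop> fc \<one> y" using loc_mult[of \<one> x \<one> y] x by simp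
  show "fc \<one> (x \<oplus> y) = fc \<one> x \<oplus>\<^bsub>L\<^esub> fc \<one> y" using x by (simp add: loc_add)
next
  show "fc \<one> \<one> = \<one>\<^bsub>L\<^esub>" by (simp add: loc_one)
qed

lemma loc_map_unit:
  assumes "s \<in> S" shows "fc \<one> s \<in> Units L"
proof -
  have "fc s \<one> \<diamondop> fc \<one> s = \<one>\<^bsub>L\<^esub>" "fc \<one> s \<diamondop> fc s \<one> = \<one>\<^bsub>L\<^esub>"
    using loc_mult[of s \<one> \<one> s] loc_mult[of \<one> \<one> s \<one>] assms by (simp_all add: fc_one)
  then show ?thesis unfolding Units_def using assms by force
qed

lemma loc_map_zero_iff:
  assumes "r \<in> carrier R" shows "fc \<one> r = \<zero>\<^bsub>L\<^esub> \<longleftrightarrow> (\<exists>s\<in>S. s \<otimes> r = \<zero>)"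
proof
  assume "fc \<one> r = \<zero>\<^bsub>L\<^esub>"
  then have "((\<one>, r), (\<one>, \<zero>)) \<in> fr" using fc_eq_iff assms by (simp add: loc_zero)
  then obtain c d where "c \<in> carrier R" "d \<in> carrier R" "c \<otimes> \<one> \<in> S" "c \<otimes> r = d \<otimes> \<zero>"
    by (elim frE)
  then have "c \<in> S" "c \<otimes> r = \<zero>" by simp_all
  then show "\<exists>s\<in>S. s \<otimes> r = \<zero>" by blast
next
  assume "\<exists>s\<in>S. s \<otimes> r = \<zero>"
  then obtain s where s: "s \<in> S" "s \<otimes> r = \<zero>" by blast
  then have "fc \<one> r = fc s \<zero>" using fc_expand[of \<one> r s] assms by simp
  then show "fc \<one> r = \<zero>\<^bsub>L\<^esub>" using fc_zero s by simp
qed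

lemma loc_fraction:
  assumes "x \<in> carrier L"
  obtains s r where "s \<in> S" "r \<in> carrier R" "fc \<one> s \<diamondop> x = fc \<one> r"
proof -
  obtain s r where x: "s \<in> S" "r \<in> carrier R" "x = fc s r" using carrier_fc[OF assms] .
  have "fc \<one> s \<diamondop> fc s r = fc \<one> r" using loc_mult[of \<one> \<one> s r] x(1,2) by simp
  then show thesis using that x by blast
qed

end

section \<open>Localizations up to isomorphism\<close>

context ring begin

lemma left_ideal_iff:
  "left_ideal R I \<longleftrightarrow> I \<subseteq> carrier R \<and> \<zero> \<in> I \<and> (\<forall>x\<in>I. \<forall>y\<in>I. x \<oplus> y \<in> I) \<and>
     (\<forall>r\<in>carrier R. \<forall>x\<in>I. r \<otimes> x \<in> I)" (is "?l \<longleftrightarrow> ?r")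
proof
  assume l: ?l
  then interpret additive_subgroup I R unfolding left_ideal_def by auto
  show ?r using l unfolding left_ideal_def by (auto simp: a_subset)
next
  assume r: ?r
  have "subgroup I (add_monoid R)"
  proof (rule add.subgroupI)
    fix a assume a: "a \<in> I"
    have ac: "a \<in> carrier R" using a r by blast
    have "(\<ominus> \<one>) \<otimes> a \<in> I" using r a by (meson a_inv_closed one_closed)
    then show "\<ominus> a \<in> I" using ac by (simp add: l_minus)
  qed (use r in auto)
  then show ?l unfolding left_ideal_def using r by (auto intro: additive_subgroup.intro)
qed

lemma left_idealD:
  assumes "left_ideal R I"
  shows "I \<subseteq> carrier R" "\<zero> \<in> I" "\<And>x y. x \<in> I \<Longrightarrow> y \<in> I \<Longrightarrow> x \<oplus> y \<in> I"
    "\<And>r x. r \<in> carrier R \<Longrightarrow> x \<in> I \<Longrightarrow> r \<otimes> x \<in> I" "\<And>x. x \<in> I \<Longrightarrow> x \<in> carrier R"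
  using assms unfolding left_ideal_iff by auto

lemma left_ideal_neg: "left_ideal R I \<Longrightarrow> x \<in> I \<Longrightarrow> \<ominus> x \<in> I"
  unfolding left_ideal_def by (auto simp: additive_subgroup.a_inv_closed abelian_group_axioms)

lemma left_ideal_minus: "left_ideal R I \<Longrightarrow> x \<in> I \<Longrightarrow> y \<in> I \<Longrightarrow> x \<ominus> y \<in> I"
  unfolding a_minus_def using left_ideal_neg left_idealD(3) by blast

end

text \<open>A characterization in place of the construction: \<open>S\<close> becomes invertible,
  the kernel is \<open>left_ass R S\<close>, and every element is a left fraction. One ring
  \<open>Q\<close> can then be viewed as a localization at different sets, or of different rings.
  Stating \<open>frac\<close> as \<phi>(s) q = \<phi>(r) avoids inverses.\<close>

locale left_localization = left_denominator R S + Q: ring Q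
  for R (structure) and S and Q (structure) +
  fixes \<phi>
  assumes hom: "\<phi> \<in> ring_hom R Q"
    and unit: "s \<in> S \<Longrightarrow> \<phi> s \<in> Units Q"
    and ker: "r \<in> carrier R \<Longrightarrow> \<phi> r = \<zero>\<^bsub>Q\<^esub> \<longleftrightarrow> (\<exists>s\<in>S. s \<otimes> r = \<zero>)"
    and frac: "q \<in> carrier Q \<Longrightarrow> \<exists>s\<in>S. \<exists>r\<in>carrier R. \<phi> s \<otimes>\<^bsub>Q\<^esub> q = \<phi> r"
begin

abbreviation mult_Q (infixl "\<star>" 70) where "x \<star> y \<equiv> x \<otimes>\<^bsub>Q\<^esub> y"

lemma phi_closed [simp]: "r \<in> carrier R \<Longrightarrow> \<phi> r \<in> carrier Q"
  by (rule ring_hom_closed[OF hom])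

lemma phi_mult: "r \<in> carrier R \<Longrightarrow> s \<in> carrier R \<Longrightarrow> \<phi> (r \<otimes> s) = \<phi> r \<star> \<phi> s"
  by (rule ring_hom_mult[OF hom])

lemma phi_add: "r \<in> carrier R \<Longrightarrow> s \<in> carrier R \<Longrightarrow> \<phi> (r \<oplus> s) = \<phi> r \<oplus>\<^bsub>Q\<^esub> \<phi> s"
  by (rule ring_hom_add[OF hom])

lemma phi_one [simp]: "\<phi> \<one> = \<one>\<^bsub>Q\<^esub>"
  by (rule ring_hom_one[OF hom])

lemma phi_zero [simp]: "\<phi> \<zero> = \<zero>\<^bsub>Q\<^esub>"
proof -
  have "\<one> \<otimes> \<zero> = \<zero>" by simp
  then show ?thesis using ker[of \<zero>] one_S zero_closed by blast
qed

lemma phi_eq_iff: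
  assumes "a \<in> carrier R" "b \<in> carrier R"
  shows "\<phi> a = \<phi> b \<longleftrightarrow> (\<exists>t\<in>S. t \<otimes> a = t \<otimes> b)"
proof -
  have "\<phi> (a \<ominus> b) \<oplus>\<^bsub>Q\<^esub> \<phi> b = \<phi> a"
    using assms by (simp add: phi_add[symmetric]) (simp add: a_minus_def a_assoc l_neg)
  then have "\<phi> (a \<ominus> b) = \<zero>\<^bsub>Q\<^esub> \<longleftrightarrow> \<phi> a = \<phi> b"
    using assms by (metis Q.add.l_cancel_one' Q.l_zero minus_closed phi_closed Q.add.m_comm)
  moreover have "t \<otimes> (a \<ominus> b) = \<zero> \<longleftrightarrow> t \<otimes> a = t \<otimes> b" if "t \<in> S" for t
    using mult_minus_eq_zero_iff assms that by simp
  ultimately show ?thesis using ker[of "a \<ominus> b"] assms by auto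
qed

lemma unit_cancel:
  assumes "s \<in> S" "x \<in> carrier Q" "y \<in> carrier Q" "\<phi> s \<star> x = \<phi> s \<star> y"
  shows "x = y"
  using Q.Units_l_cancel[OF unit] assms by blast

lemma unit_zero:
  assumes "s \<in> S" "x \<in> carrier Q" "\<phi> s \<star> x = \<zero>\<^bsub>Q\<^esub>" shows "x = \<zero>\<^bsub>Q\<^esub>"
  using unit_cancel[of s x "\<zero>\<^bsub>Q\<^esub>"] assms by simp

lemma fraction_ex:
  assumes "s \<in> S" "r \<in> carrier R"
  obtains q where "q \<in> carrier Q" "\<phi> s \<star> q = \<phi> r"
proof
  show "inv\<^bsub>Q\<^esub> (\<phi> s) \<star> \<phi> r \<in> carrier Q" using unit assms by simp
  have "\<phi> s \<star> (inv\<^bsub>Q\<^esub> (\<phi> s) \<star> \<phi> r) = \<phi> s \<star> inv\<^bsub>Q\<^esub> (\<phi> s) \<star> \<phi> r"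
    using unit assms by (intro Q.m_assoc[symmetric]) auto
  also have "\<dots> = \<phi> r" using unit assms by simp
  finally show "\<phi> s \<star> (inv\<^bsub>Q\<^esub> (\<phi> s) \<star> \<phi> r) = \<phi> r" .
qed

lemma numerator_scale:
  assumes "q \<in> carrier Q" "s \<in> S" "r \<in> carrier R" "\<phi> s \<star> q = \<phi> r" "u \<in> carrier R"
  shows "\<phi> (u \<otimes> s) \<star> q = \<phi> (u \<otimes> r)"
  using assms by (simp add: phi_mult Q.m_assoc)

lemma numerator_add:
  assumes "p \<in> carrier Q" "q \<in> carrier Q" "s \<in> S" "a \<in> carrier R" "b \<in> carrier R"
    "\<phi> s \<star> p = \<phi> a" "\<phi> s \<star> q = \<phi> b"
  shows "\<phi> s \<star> (p \<oplus>\<^bsub>Q\<^esub> q) = \<phi> (a \<oplus> b)"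
  using assms by (simp add: phi_add Q.r_distr)

text \<open>The relation u a = v t moves the numerator of p past the denominator of q. It mentions
  \<open>R\<close> only, so two localizations can share the same u and v.\<close>

lemma numerator_mult:
  assumes "p \<in> carrier Q" "q \<in> carrier Q" "s \<in> S" "t \<in> S" "a \<in> carrier R" "b \<in> carrier R"
    "\<phi> s \<star> p = \<phi> a" "\<phi> t \<star> q = \<phi> b"
    "u \<in> S" "v \<in> carrier R" "u \<otimes> a = v \<otimes> t"
  shows "\<phi> (u \<otimes> s) \<star> (p \<star> q) = \<phi> (v \<otimes> b)"
proof -
  have "\<phi> (u \<otimes> s) \<star> (p \<star> q) = \<phi> u \<star> (\<phi> s \<star> p) \<star> q"
    using assms(1-5,9) by (simp add: phi_mult Q.m_assoc)
  also have "\<dots> = \<phi> (u \<otimes> a) \<star> q" unfolding assms(7) using assms(5,9) by (simp add: phi_mult)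
  also have "\<dots> = \<phi> v \<star> (\<phi> t \<star> q)"
    unfolding assms(11) using assms by (simp add: phi_mult Q.m_assoc)
  also have "\<dots> = \<phi> (v \<otimes> b)" using assms by (simp add: phi_mult)
  finally show ?thesis .
qed

section \<open>Contraction and extension of left ideals\<close>

lemma left_ideal_contraction:
  assumes "left_ideal Q J" shows "left_ideal R {r \<in> carrier R. \<phi> r \<in> J}"
  using Q.left_idealD[OF assms] unfolding left_ideal_iff by (auto simp: phi_add phi_mult)

text \<open>For a left ideal \<open>I\<close> this is the left ideal of \<open>Q\<close> generated
  by the image of \<open>I\<close>, that is, the fractions with numerator in
  \<open>I\<close>.\<close>

definition extension where
  "extension I = {q \<in> carrier Q. \<exists>s\<in>S. \<exists>r\<in>I. \<phi> s \<star> q = \<phi> r}"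

lemma left_ideal_extension:
  assumes "left_ideal R I" shows "left_ideal Q (extension I)"
  unfolding Q.left_ideal_iff
proof (intro conjI ballI)
  note I = left_idealD[OF assms]
  show "extension I \<subseteq> carrier Q" unfolding extension_def by auto
  have "\<phi> \<one> \<star> \<zero>\<^bsub>Q\<^esub> = \<phi> \<zero>" by simp
  then show "\<zero>\<^bsub>Q\<^esub> \<in> extension I" unfolding extension_def using I(2) one_S by blast
  fix p assume "p \<in> extension I"
  then obtain s a where p: "p \<in> carrier Q" "s \<in> S" "a \<in> I" "\<phi> s \<star> p = \<phi> a"
    unfolding extension_def by blast
  {
    fix q assume "q \<in> extension I"
    then obtain t b where q: "q \<in> carrier Q" "t \<in> S" "b \<in> I" "\<phi> t \<star> q = \<phi> b"
      unfolding extension_def by blast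
    obtain u v where uv: "u \<in> S" "v \<in> carrier R" "u \<otimes> s = v \<otimes> t" "u \<otimes> s \<in> S"
      using common_S[OF p(2) q(2)] .
    have 1: "\<phi> (u \<otimes> s) \<star> p = \<phi> (u \<otimes> a)" using p uv I by (intro numerator_scale) auto
    have 2: "\<phi> (u \<otimes> s) \<star> q = \<phi> (v \<otimes> b)"
      unfolding uv(3) using q uv I by (intro numerator_scale) auto
    have "\<phi> (u \<otimes> s) \<star> (p \<oplus>\<^bsub>Q\<^esub> q) = \<phi> (u \<otimes> a \<oplus> v \<otimes> b)"
      using numerator_add[OF _ _ _ _ _ 1 2] p q uv I by auto
    moreover have "u \<otimes> a \<oplus> v \<otimes> b \<in> I" using p q uv I by auto
    moreover have "p \<oplus>\<^bsub>Q\<^esub> q \<in> carrier Q" using p q by simp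
    ultimately show "p \<oplus>\<^bsub>Q\<^esub> q \<in> extension I" unfolding extension_def using uv(4) by blast
  }
  fix x assume x: "x \<in> carrier Q"
  then obtain t b where xb: "t \<in> S" "b \<in> carrier R" "\<phi> t \<star> x = \<phi> b" using frac by blast
  obtain u v where uv: "u \<in> S" "v \<in> carrier R" "u \<otimes> b = v \<otimes> s" using ore[OF xb(2) p(2)] .
  have "\<phi> (u \<otimes> t) \<star> (x \<star> p) = \<phi> (v \<otimes> a)"
    using numerator_mult[OF x p(1) xb(1) p(2) xb(2) _ xb(3) p(4) uv] p I by auto
  moreover have "v \<otimes> a \<in> I" "u \<otimes> t \<in> S" "x \<star> p \<in> carrier Q" using p uv xb x I by auto
  ultimately show "x \<star> p \<in> extension I" unfolding extension_def by blast
qed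

lemma phi_mem_extension:
  assumes "left_ideal R I" "x \<in> I" shows "\<phi> x \<in> extension I"
  unfolding extension_def using left_idealD(5)[OF assms] assms(2)
  by (auto intro!: bexI[OF _ one_S] bexI[of _ x])

end

section \<open>Uniqueness of localizations\<close>

lemma (in left_denominator) left_loc_localization:
  "left_localization R S (left_loc R S) (left_frac R S \<one>)"
proof -
  interpret L: ring L by (rule loc_ring)
  show ?thesis
  proof
    show "fc \<one> \<in> ring_hom R L" by (rule loc_map_hom)
    show "fc \<one> s \<in> Units L" if "s \<in> S" for s using that by (rule loc_map_unit)
    show "fc \<one> r = \<zero>\<^bsub>L\<^esub> \<longleftrightarrow> (\<exists>s\<in>S. s \<otimes> r = \<zero>)" if "r \<in> carrier R" for r
      using that by (rule loc_map_zero_iff)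
    show "\<exists>s\<in>S. \<exists>r\<in>carrier R. fc \<one> s \<otimes>\<^bsub>L\<^esub> q = fc \<one> r" if "q \<in> carrier L" for q
      using loc_fraction[OF that] by metis
  qed
qed

text \<open>Over a common denominator the two numerators of x agree in \<open>Q1\<close>. By
  \<open>phi_eq_iff\<close> they then agree in \<open>R\<close> after a left factor from
  \<open>S\<close>, a condition that does not see which localization is used, so they agree in
  \<open>Q2\<close> too.\<close>

lemma fraction_correspondence_unique:
  fixes R (structure)
  assumes "left_localization R S Q1 \<phi>1" "left_localization R S Q2 \<phi>2"
    and x: "x \<in> carrier Q1" and y: "y \<in> carrier Q2" "y' \<in> carrier Q2"
    and s: "s \<in> S" "r \<in> carrier R" "\<phi>1 s \<otimes>\<^bsub>Q1\<^esub> x = \<phi>1 r" "\<phi>2 s \<otimes>\<^bsub>Q2\<^esub> y = \<phi>2 r"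
    and t: "t \<in> S" "q \<in> carrier R" "\<phi>1 t \<otimes>\<^bsub>Q1\<^esub> x = \<phi>1 q" "\<phi>2 t \<otimes>\<^bsub>Q2\<^esub> y' = \<phi>2 q"
  shows "y = y'"
proof -
  interpret A: left_localization R S Q1 \<phi>1 by fact
  interpret B: left_localization R S Q2 \<phi>2 by fact
  obtain u v where uv: "u \<in> S" "v \<in> carrier R" "u \<otimes> s = v \<otimes> t" "u \<otimes> s \<in> S"
    using A.common_S[OF s(1) t(1)] .
  have u: "u \<in> carrier R" using uv by simp
  have "\<phi>1 (u \<otimes> r) = \<phi>1 (v \<otimes> q)"
    using A.numerator_scale[OF x s(1-3) u] A.numerator_scale[OF x t(1-3) uv(2)] uv(3) by simp
  then have "\<exists>w\<in>S. w \<otimes> (u \<otimes> r) = w \<otimes> (v \<otimes> q)"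
    using A.phi_eq_iff s t u uv(2) by simp
  then have "\<phi>2 (u \<otimes> r) = \<phi>2 (v \<otimes> q)"
    using B.phi_eq_iff s t u uv(2) by simp
  then have "\<phi>2 (u \<otimes> s) \<otimes>\<^bsub>Q2\<^esub> y = \<phi>2 (u \<otimes> s) \<otimes>\<^bsub>Q2\<^esub> y'"
    using B.numerator_scale[OF y(1) s(1,2,4) u] B.numerator_scale[OF y(2) t(1,2,4) uv(2)] uv(3) by simp
  then show ?thesis using B.unit_cancel uv(4) y by blast
qed

text \<open>The isomorphism sends a fraction to the fraction with the same denominator and
  numerator. Representations are not unique, so it starts as a relation; that it is single-valued
  and that it is injective are one lemma with the two localizations exchanged.\<close>

theorem left_localization_unique:
  fixes R (structure)
  assumes A: "left_localization R S Q1 \<phi>1" and B: "left_localization R S Q2 \<phi>2"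
  shows "Q1 \<simeq> Q2"
proof -
  interpret A: left_localization R S Q1 \<phi>1 by fact
  interpret B: left_localization R S Q2 \<phi>2 by fact
  define G where "G x y \<longleftrightarrow> x \<in> carrier Q1 \<and> y \<in> carrier Q2 \<and>
    (\<exists>s\<in>S. \<exists>r\<in>carrier R. \<phi>1 s \<otimes>\<^bsub>Q1\<^esub> x = \<phi>1 r \<and> \<phi>2 s \<otimes>\<^bsub>Q2\<^esub> y = \<phi>2 r)" for x y
  have fn: "y = y'" if "G x y" "G x y'" for x y y'
    using that fraction_correspondence_unique[OF A B, of x y y'] unfolding G_def by blast
  have inj: "x = x'" if "G x y" "G x' y" for x x' y
    using that fraction_correspondence_unique[OF B A, of y x x'] unfolding G_def by blast
  have ex: "\<exists>y. G x y" if x: "x \<in> carrier Q1" for x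
  proof -
    obtain s r where s: "s \<in> S" "r \<in> carrier R" "\<phi>1 s \<otimes>\<^bsub>Q1\<^esub> x = \<phi>1 r" using A.frac[OF x] by blast
    obtain y where "y \<in> carrier Q2" "\<phi>2 s \<otimes>\<^bsub>Q2\<^esub> y = \<phi>2 r" using B.fraction_ex[OF s(1,2)] .
    then show ?thesis unfolding G_def using x s by blast
  qed
  have surj: "\<exists>x. G x y" if y: "y \<in> carrier Q2" for y
  proof -
    obtain s r where s: "s \<in> S" "r \<in> carrier R" "\<phi>2 s \<otimes>\<^bsub>Q2\<^esub> y = \<phi>2 r" using B.frac[OF y] by blast
    obtain x where "x \<in> carrier Q1" "\<phi>1 s \<otimes>\<^bsub>Q1\<^esub> x = \<phi>1 r" using A.fraction_ex[OF s(1,2)] .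
    then show ?thesis unfolding G_def using y s by blast
  qed
  have one: "G \<one>\<^bsub>Q1\<^esub> \<one>\<^bsub>Q2\<^esub>"
    unfolding G_def by (auto intro!: bexI[of _ "\<one>"])
  have add: "G (x \<oplus>\<^bsub>Q1\<^esub> x') (y \<oplus>\<^bsub>Q2\<^esub> y')" if xy: "G x y" "G x' y'" for x y x' y'
  proof -
    obtain s a where s: "x \<in> carrier Q1" "y \<in> carrier Q2" "s \<in> S" "a \<in> carrier R"
      "\<phi>1 s \<otimes>\<^bsub>Q1\<^esub> x = \<phi>1 a" "\<phi>2 s \<otimes>\<^bsub>Q2\<^esub> y = \<phi>2 a" using xy(1) unfolding G_def by blast
    obtain t b where t: "x' \<in> carrier Q1" "y' \<in> carrier Q2" "t \<in> S" "b \<in> carrier R"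
      "\<phi>1 t \<otimes>\<^bsub>Q1\<^esub> x' = \<phi>1 b" "\<phi>2 t \<otimes>\<^bsub>Q2\<^esub> y' = \<phi>2 b" using xy(2) unfolding G_def by blast
    obtain u v where uv: "u \<in> S" "v \<in> carrier R" "u \<otimes> s = v \<otimes> t" "u \<otimes> s \<in> S"
      using A.common_S[OF s(3) t(3)] .
    have u: "u \<in> carrier R" using uv by simp
    have ab: "u \<otimes> a \<in> carrier R" "v \<otimes> b \<in> carrier R" using u uv s t by auto
    note 1 = A.numerator_add[OF s(1) t(1) uv(4) ab A.numerator_scale[OF s(1,3,4,5) u]
      A.numerator_scale[OF t(1,3,4,5) uv(2), folded uv(3)]]
    note 2 = B.numerator_add[OF s(2) t(2) uv(4) ab B.numerator_scale[OF s(2,3,4,6) u]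
      B.numerator_scale[OF t(2,3,4,6) uv(2), folded uv(3)]]
    show ?thesis unfolding G_def using 1 2 uv(4) ab s(1,2) t(1,2)
      by (meson A.Q.add.m_closed B.Q.add.m_closed A.add.m_closed)
  qed
  have mult: "G (x \<otimes>\<^bsub>Q1\<^esub> x') (y \<otimes>\<^bsub>Q2\<^esub> y')" if xy: "G x y" "G x' y'" for x y x' y'
  proof -
    obtain s a where s: "x \<in> carrier Q1" "y \<in> carrier Q2" "s \<in> S" "a \<in> carrier R"
      "\<phi>1 s \<otimes>\<^bsub>Q1\<^esub> x = \<phi>1 a" "\<phi>2 s \<otimes>\<^bsub>Q2\<^esub> y = \<phi>2 a" using xy(1) unfolding G_def by blast
    obtain t b where t: "x' \<in> carrier Q1" "y' \<in> carrier Q2" "t \<in> S" "b \<in> carrier R"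
      "\<phi>1 t \<otimes>\<^bsub>Q1\<^esub> x' = \<phi>1 b" "\<phi>2 t \<otimes>\<^bsub>Q2\<^esub> y' = \<phi>2 b" using xy(2) unfolding G_def by blast
    obtain u v where uv: "u \<in> S" "v \<in> carrier R" "u \<otimes> a = v \<otimes> t"
      using A.ore[OF s(4) t(3)] .
    have c: "u \<otimes> s \<in> S" "v \<otimes> b \<in> carrier R" "x \<otimes>\<^bsub>Q1\<^esub> x' \<in> carrier Q1"
      "y \<otimes>\<^bsub>Q2\<^esub> y' \<in> carrier Q2" using uv s t by auto
    show ?thesis unfolding G_def
      using A.numerator_mult[OF s(1) t(1) s(3) t(3) s(4) t(4) s(5) t(5) uv]
        B.numerator_mult[OF s(2) t(2) s(3) t(3) s(4) t(4) s(6) t(6) uv] c by blast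
  qed
  define f where "f x = (SOME y. G x y)" for x
  have f: "G x (f x)" if "x \<in> carrier Q1" for x
    unfolding f_def using ex[OF that] by (rule someI_ex)
  have "f \<in> ring_iso Q1 Q2"
  proof (rule ring_iso_memI)
    show "bij_betw f (carrier Q1) (carrier Q2)"
    proof (rule bij_betwI')
      show "f x = f y \<longleftrightarrow> x = y" if "x \<in> carrier Q1" "y \<in> carrier Q1" for x y
        using inj f[OF that(1)] f[OF that(2)] by auto
      show "f x \<in> carrier Q2" if "x \<in> carrier Q1" for x using f[OF that] unfolding G_def by blast
      fix y assume "y \<in> carrier Q2"
      then obtain x where x: "G x y" using surj by blast
      then have "x \<in> carrier Q1" unfolding G_def by blast
      then show "\<exists>x\<in>carrier Q1. y = f x" using x f fn by blast
    qed
    show "f x \<in> carrier Q2" if "x \<in> carrier Q1" for x using f[OF that] unfolding G_def by blast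
    show "f (x \<otimes>\<^bsub>Q1\<^esub> y) = f x \<otimes>\<^bsub>Q2\<^esub> f y" "f (x \<oplus>\<^bsub>Q1\<^esub> y) = f x \<oplus>\<^bsub>Q2\<^esub> f y"
      if "x \<in> carrier Q1" "y \<in> carrier Q1" for x y
      using fn[OF f mult[OF f f]] fn[OF f add[OF f f]] that by auto
    show "f \<one>\<^bsub>Q1\<^esub> = \<one>\<^bsub>Q2\<^esub>" using fn[OF f one] by simp
  qed
  then show ?thesis unfolding is_ring_iso_def by blast
qed

section \<open>Semisimple rings and idempotent generators of left ideals\<close>

text \<open>This property characterizes semisimplicity and, unlike the definition, passes along
  isomorphisms and localizations without effort.\<close>

definition left_ideals_split :: "('a, 'b) ring_scheme \<Rightarrow> bool" where
  "left_ideals_split R \<longleftrightarrow> (\<forall>I. left_ideal R I \<longrightarrow> (\<exists>e\<in>I. \<forall>x\<in>I. x \<otimes>\<^bsub>R\<^esub> e = x))"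

definition left_ideal_plus :: "('a, 'b) ring_scheme \<Rightarrow> 'a set \<Rightarrow> 'a set \<Rightarrow> 'a set" where
  "left_ideal_plus R I J = {x \<oplus>\<^bsub>R\<^esub> y | x y. x \<in> I \<and> y \<in> J}"

context ring begin

section \<open>Left ideals and their sums\<close>

lemma add_minus_cancel_left:
  "x \<in> carrier R \<Longrightarrow> y \<in> carrier R \<Longrightarrow> (x \<oplus> y) \<ominus> x = y"
  unfolding a_minus_def by (simp add: a_comm[of x y] a_assoc r_neg)

lemma splitE:
  assumes "left_ideals_split R" "left_ideal R I"
  obtains e where "e \<in> I" "\<And>x. x \<in> I \<Longrightarrow> x \<otimes> e = x"
  using assms unfolding left_ideals_split_def by blast

lemma left_ideal_zero: "left_ideal R {\<zero>}"
  unfolding left_ideal_iff by auto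

lemma left_ideal_Int: "left_ideal R I \<Longrightarrow> left_ideal R J \<Longrightarrow> left_ideal R (I \<inter> J)"
  unfolding left_ideal_iff by auto

lemma left_ideal_principal:
  assumes "a \<in> carrier R" shows "left_ideal R {r \<otimes> a | r. r \<in> carrier R}"
  unfolding left_ideal_iff
proof (intro conjI ballI)
  have "\<zero> = \<zero> \<otimes> a" using assms by simp
  then show "\<zero> \<in> {r \<otimes> a | r. r \<in> carrier R}" by blast
  show "{r \<otimes> a | r. r \<in> carrier R} \<subseteq> carrier R" using assms by auto
  fix x assume "x \<in> {r \<otimes> a | r. r \<in> carrier R}"
  then obtain r where r: "r \<in> carrier R" "x = r \<otimes> a" by blast
  {
    fix y assume "y \<in> {r \<otimes> a | r. r \<in> carrier R}"
    then obtain s where s: "s \<in> carrier R" "y = s \<otimes> a" by blast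
    have "x \<oplus> y = (r \<oplus> s) \<otimes> a" using r s assms by (simp add: l_distr)
    then show "x \<oplus> y \<in> {r \<otimes> a | r. r \<in> carrier R}" using r s by blast
  }
  fix s assume s: "s \<in> carrier R"
  have "s \<otimes> x = (s \<otimes> r) \<otimes> a" using r s assms by (simp add: m_assoc)
  then show "s \<otimes> x \<in> {r \<otimes> a | r. r \<in> carrier R}" using r s by blast
qed

lemma mem_principal: "a \<in> carrier R \<Longrightarrow> a \<in> {r \<otimes> a | r. r \<in> carrier R}"
  by (metis (mono_tags, lifting) l_one mem_Collect_eq one_closed)

lemma left_ideal_annihilator_elt:
  assumes "a \<in> carrier R" shows "left_ideal R {x \<in> carrier R. x \<otimes> a = \<zero>}"
  unfolding left_ideal_iff using assms by (auto simp: l_distr m_assoc)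

lemma left_ideal_plus:
  assumes "left_ideal R I" "left_ideal R J"
  shows "left_ideal R (left_ideal_plus R I J)"
  unfolding left_ideal_iff
proof (intro conjI ballI)
  note I = left_idealD[OF assms(1)] and J = left_idealD[OF assms(2)]
  let ?S = "left_ideal_plus R I J"
  show "?S \<subseteq> carrier R" unfolding left_ideal_plus_def using I(5) J(5) by auto
  have "\<zero> = \<zero> \<oplus> \<zero>" by simp
  then show "\<zero> \<in> ?S" unfolding left_ideal_plus_def using I(2) J(2) by blast
  fix u assume "u \<in> ?S"
  then obtain x y where u: "u = x \<oplus> y" "x \<in> I" "y \<in> J" unfolding left_ideal_plus_def by blast
  {
    fix v assume "v \<in> ?S"
    then obtain x' y' where v: "v = x' \<oplus> y'" "x' \<in> I" "y' \<in> J"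
      unfolding left_ideal_plus_def by blast
    have "u \<oplus> v = (x \<oplus> x') \<oplus> (y \<oplus> y')" using u v I(5) J(5) by (simp add: a_ac)
    then show "u \<oplus> v \<in> ?S" unfolding left_ideal_plus_def using u v I(3) J(3) by blast
  }
  fix r assume r: "r \<in> carrier R"
  have "r \<otimes> u = r \<otimes> x \<oplus> r \<otimes> y" using u r I(5) J(5) by (simp add: r_distr)
  then show "r \<otimes> u \<in> ?S" unfolding left_ideal_plus_def using u r I(4) J(4) by blast
qed

lemma left_ideal_plus_incl:
  assumes "left_ideal R I" "left_ideal R J"
  shows "I \<subseteq> left_ideal_plus R I J" "J \<subseteq> left_ideal_plus R I J"
proof -
  note I = left_idealD[OF assms(1)] and J = left_idealD[OF assms(2)]
  have "x = x \<oplus> \<zero>" if "x \<in> I" for x using that I(5) by simp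
  then show "I \<subseteq> left_ideal_plus R I J" unfolding left_ideal_plus_def using J(2) by blast
  have "x = \<zero> \<oplus> x" if "x \<in> J" for x using that J(5) by simp
  then show "J \<subseteq> left_ideal_plus R I J" unfolding left_ideal_plus_def using I(2) by blast
qed

lemma left_ideal_finsum:
  assumes "left_ideal R I" "\<And>i. i \<in> A \<Longrightarrow> f i \<in> I"
  shows "(\<Oplus>i\<in>A. f i) \<in> I"
proof (cases "finite A")
  case True
  then show ?thesis using assms(2)
  proof (induction A)
    case empty then show ?case using left_idealD(2)[OF assms(1)] by simp
  next
    case (insert x F)
    have "f \<in> F \<rightarrow> carrier R" "f x \<in> carrier R"
      using insert.prems left_idealD(5)[OF assms(1)] by auto
    then show ?case using insert left_idealD(3)[OF assms(1)] by simp
  qed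
next
  case False
  then show ?thesis using left_idealD(2)[OF assms(1)] by simp
qed

lemma left_ideal_eq_carrier: "left_ideal R I \<Longrightarrow> \<one> \<in> I \<Longrightarrow> I = carrier R"
  using left_idealD(1,4)[of I] by (metis r_one subsetI subset_antisym)

text \<open>Write 1 = e + f. For x in \<open>I\<close> the element x f lies in \<open>J\<close> and
  equals x - x e in \<open>I\<close>, hence vanishes.\<close>

lemma complement_imp_generator:
  assumes I: "left_ideal R I" and J: "left_ideal R J" and IJ: "I \<inter> J \<subseteq> {\<zero>}"
    and one: "\<one> \<in> left_ideal_plus R I J"
  shows "\<exists>e\<in>I. \<forall>x\<in>I. x \<otimes> e = x"
proof -
  obtain e f where ef: "e \<in> I" "f \<in> J" "\<one> = e \<oplus> f"
    using one unfolding left_ideal_plus_def by blast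
  note cI = left_idealD[OF I] and cJ = left_idealD[OF J]
  have "x \<otimes> e = x" if x: "x \<in> I" for x
  proof -
    have c: "x \<in> carrier R" "e \<in> carrier R" "f \<in> carrier R" using x ef cI(5) cJ(5) by auto
    have "x \<otimes> e \<oplus> x \<otimes> f = x \<otimes> \<one>" unfolding ef(3) using c by (simp add: r_distr)
    then have eq: "x = x \<otimes> e \<oplus> x \<otimes> f" using c by simp
    have "x \<otimes> e \<oplus> x \<otimes> f \<ominus> x \<otimes> e = x \<otimes> f" using c by (simp add: add_minus_cancel_left)
    then have "x \<otimes> f = x \<ominus> x \<otimes> e" using eq by simp
    moreover have "x \<ominus> x \<otimes> e \<in> I" using left_ideal_minus[OF I x] cI(4) c ef by blast
    moreover have "x \<otimes> f \<in> J" using cJ(4) c ef by blast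
    ultimately have "x \<otimes> f = \<zero>" using IJ by auto
    then show ?thesis using eq c by simp
  qed
  then show ?thesis using ef by blast
qed

text \<open>Induction on \<open>F\<close>: a minimal left ideal \<open>M\<close> is either contained
  in \<open>I\<close> + \<open>J\<close> or meets it in 0. In the second case \<open>J\<close> +
  \<open>M\<close> still meets \<open>I\<close> only in 0 and replaces \<open>J\<close>.\<close>

lemma complement_of_minimals:
  assumes I: "left_ideal R I" and "finite F" and "\<And>M. M \<in> F \<Longrightarrow> minimal_left_ideal R M"
  shows "\<exists>J. left_ideal R J \<and> I \<inter> J \<subseteq> {\<zero>} \<and> (\<forall>M\<in>F. M \<subseteq> left_ideal_plus R I J)"
  using assms(2,3)
proof (induction F)
  case empty
  then show ?case using left_ideal_zero by blast
next
  case (insert M F)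
  then obtain J where J: "left_ideal R J" "I \<inter> J \<subseteq> {\<zero>}" "\<forall>M\<in>F. M \<subseteq> left_ideal_plus R I J" by blast
  have M: "left_ideal R M" "\<And>K. left_ideal R K \<Longrightarrow> K \<subseteq> M \<Longrightarrow> K = {\<zero>} \<or> K = M"
    using insert.prems unfolding minimal_left_ideal_def by auto
  note IJ = left_ideal_plus[OF I J(1)]
  show ?case
  proof (cases "left_ideal_plus R I J \<inter> M = M")
    case True
    then show ?thesis using J by blast
  next
    case False
    then have z: "left_ideal_plus R I J \<inter> M = {\<zero>}"
      using M(2)[OF left_ideal_Int[OF IJ M(1)]] by blast
    let ?J = "left_ideal_plus R J M"
    have J': "left_ideal R ?J" using left_ideal_plus J M by blast
    have JJ: "J \<subseteq> ?J" "M \<subseteq> ?J" using left_ideal_plus_incl J M by blast+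
    have "I \<inter> ?J \<subseteq> {\<zero>}"
    proof
      fix i assume i: "i \<in> I \<inter> ?J"
      then obtain j m where jm: "i = j \<oplus> m" "j \<in> J" "m \<in> M" unfolding left_ideal_plus_def by blast
      have c: "i \<in> carrier R" "j \<in> carrier R" "m \<in> carrier R"
        using i jm left_idealD(5)[OF I] left_idealD(5)[OF J(1)] left_idealD(5)[OF M(1)] by auto
      \<comment> \<open>From i = j + m the element m lies both in \<open>M\<close> and in
        \<open>I\<close> + \<open>J\<close>.\<close>
      have "m = i \<oplus> \<ominus> j"
        unfolding jm(1) using add_minus_cancel_left[of j m] c by (simp add: a_minus_def)
      moreover have "\<ominus> j \<in> J" using left_ideal_neg J(1) jm(2) by blast
      ultimately have "m \<in> left_ideal_plus R I J" unfolding left_ideal_plus_def using i by blast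
      then have "m = \<zero>" using z jm by blast
      then have "i = j" using jm c by simp
      then show "i \<in> {\<zero>}" using i jm J(2) by blast
    qed
    moreover have "left_ideal_plus R I J \<subseteq> left_ideal_plus R I ?J"
      unfolding left_ideal_plus_def[of R I] using JJ by blast
    moreover have "?J \<subseteq> left_ideal_plus R I ?J" using left_ideal_plus_incl(2)[OF I J'] .
    ultimately show ?thesis using J J' JJ by (intro exI[of _ ?J]) blast
  qed
qed

text \<open>The element 1 already lies in a sum of finitely many minimal left ideals, so a left
  ideal \<open>J\<close> that takes care of these has all of \<open>R\<close> as its sum with
  \<open>I\<close>.\<close>

lemma semisimple_imp_split:
  assumes "semisimple_ring R" shows "left_ideals_split R"
  unfolding left_ideals_split_def
proof (intro allI impI)
  fix I assume I: "left_ideal R I"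
  obtain \<F> where \<F>: "\<And>M. M \<in> \<F> \<Longrightarrow> minimal_left_ideal R M" "left_ideal_sum R \<F> = carrier R"
    using assms unfolding semisimple_ring_def by blast
  have "\<one> \<in> left_ideal_sum R \<F>" using \<F>(2) by simp
  then obtain F f where F: "finite F" "F \<subseteq> \<F>" "\<And>M. M \<in> F \<Longrightarrow> f M \<in> M" "\<one> = (\<Oplus>M\<in>F. f M)"
    unfolding left_ideal_sum_def by blast
  obtain J where J: "left_ideal R J" "I \<inter> J \<subseteq> {\<zero>}" "\<forall>M\<in>F. M \<subseteq> left_ideal_plus R I J"
    using complement_of_minimals[OF I F(1)] F(2) \<F>(1) by blast
  have "\<one> \<in> left_ideal_plus R I J"
    unfolding F(4) by (rule left_ideal_finsum[OF left_ideal_plus[OF I J(1)]]) (use F J in blast)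
  then show "\<exists>e\<in>I. \<forall>x\<in>I. x \<otimes> e = x" using complement_imp_generator[OF I J(1,2)] by blast
qed

section \<open>Chain conditions from idempotent generators\<close>

lemma left_ideal_chain_Union:
  assumes "\<C> \<noteq> {}" "\<And>K. K \<in> \<C> \<Longrightarrow> left_ideal R K"
    and lin: "\<And>K M. K \<in> \<C> \<Longrightarrow> M \<in> \<C> \<Longrightarrow> K \<subseteq> M \<or> M \<subseteq> K"
  shows "left_ideal R (\<Union>\<C>)"
  unfolding left_ideal_iff
proof (intro conjI ballI)
  note K = left_idealD[OF assms(2)]
  show "\<Union>\<C> \<subseteq> carrier R" using K(1) by blast
  show "\<zero> \<in> \<Union>\<C>" using K(2) assms(1) by blast
  fix x assume "x \<in> \<Union>\<C>"
  then obtain K where x: "K \<in> \<C>" "x \<in> K" by blast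
  show "r \<otimes> x \<in> \<Union>\<C>" if "r \<in> carrier R" for r using K(4)[OF x(1) that x(2)] x(1) by blast
  fix y assume "y \<in> \<Union>\<C>"
  then obtain M where y: "M \<in> \<C>" "y \<in> M" by blast
  from lin[OF x(1) y(1)] show "x \<oplus> y \<in> \<Union>\<C>"
  proof
    assume "K \<subseteq> M"
    then have "x \<oplus> y \<in> M" using K(3)[OF y(1)] x y by blast
    then show ?thesis using y(1) by blast
  next
    assume "M \<subseteq> K"
    then have "x \<oplus> y \<in> K" using K(3)[OF x(1)] x y by blast
    then show ?thesis using x(1) by blast
  qed
qed

lemma left_ideal_nat_chain_Union:
  fixes K :: "nat \<Rightarrow> 'a set"
  assumes "\<And>n. left_ideal R (K n)" "\<And>n. K n \<subseteq> K (Suc n)"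
  shows "left_ideal R (\<Union>n. K n)"
proof (rule left_ideal_chain_Union)
  have mono: "K m \<subseteq> K n" if "m \<le> n" for m n using lift_Suc_mono_le[of K] assms(2) that by blast
  then show "A \<subseteq> B \<or> B \<subseteq> A" if "A \<in> range K" "B \<in> range K" for A B
    using that by (metis imageE nat_le_linear)
qed (use assms(1) in auto)

text \<open>A generator e of the union lies in some \<open>K N\<close>, and x = x e puts the whole
  union there.\<close>

lemma split_acc:
  fixes K :: "nat \<Rightarrow> 'a set"
  assumes "left_ideals_split R" "\<And>n. left_ideal R (K n)" "\<And>n. K n \<subseteq> K (Suc n)"
  shows "\<exists>N. \<forall>n\<ge>N. K n = K N"
proof -
  note K = left_idealD[OF assms(2)]
  have mono: "K m \<subseteq> K n" if "m \<le> n" for m n using lift_Suc_mono_le[of K] assms(3) that by blast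
  obtain e where e: "e \<in> (\<Union>n. K n)" "\<And>x. x \<in> (\<Union>n. K n) \<Longrightarrow> x \<otimes> e = x"
    using splitE[OF assms(1) left_ideal_nat_chain_Union[of K]] assms(2,3) by metis
  then obtain N where N: "e \<in> K N" by blast
  have "K n \<subseteq> K N" for n
  proof
    fix x assume x: "x \<in> K n"
    then have "x \<otimes> e = x" "x \<in> carrier R" using e(2) K(5) by blast+
    then show "x \<in> K N" using K(4)[OF _ N, of x] by simp
  qed
  then show ?thesis using mono by blast
qed

text \<open>The descending chain is converted into the ascending chain of left annihilators of
  suitable generators, to which \<open>split_acc\<close> applies.\<close>

lemma split_imp_artinian:
  assumes sp: "left_ideals_split R" shows "left_artinian R"
  unfolding left_artinian_def
proof (intro allI impI)
  fix A :: "nat \<Rightarrow> 'a set"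
  assume "\<forall>n. left_ideal R (A n) \<and> A (Suc n) \<subseteq> A n"
  then have lA: "\<And>n. left_ideal R (A n)" and dec: "\<And>n. A (Suc n) \<subseteq> A n" by auto
  note A = left_idealD[OF lA]
  have mono: "A n \<subseteq> A m" if "m \<le> n" for m n using lift_Suc_antimono_le[of A] dec that by blast
  have "\<forall>n. \<exists>e. e \<in> A n \<and> (\<forall>x\<in>A n. x \<otimes> e = x)" using sp lA unfolding left_ideals_split_def by blast
  then obtain e where e: "\<And>n. e n \<in> A n" "\<And>n x. x \<in> A n \<Longrightarrow> x \<otimes> e n = x" by metis
  \<comment> \<open>Independently chosen generators e(n) need not have increasing left annihilators.
    The products e(0) e(1) ... e(n) do, and each is still a right identity on
    \<open>A n\<close>.\<close>
  define g where "g = rec_nat (e 0) (\<lambda>n x. x \<otimes> e (Suc n))"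
  have g0: "g 0 = e 0" and gS: "\<And>n. g (Suc n) = g n \<otimes> e (Suc n)" unfolding g_def by auto
  have ec: "e n \<in> carrier R" for n using e(1) A(5) by blast
  have g: "g n \<in> A n \<and> (\<forall>x\<in>A n. x \<otimes> g n = x)" for n
  proof (induction n)
    case 0 then show ?case using e g0 by auto
  next
    case (Suc n)
    have gc: "g n \<in> carrier R" using Suc A(5) by blast
    have "g (Suc n) \<in> A (Suc n)" unfolding gS using A(4) gc e(1) by blast
    moreover have "x \<otimes> g (Suc n) = x" if x: "x \<in> A (Suc n)" for x
    proof -
      have "x \<in> carrier R" "x \<in> A n" using x A(5) dec by blast+
      then have "x \<otimes> g (Suc n) = (x \<otimes> g n) \<otimes> e (Suc n)" unfolding gS using gc ec m_assoc by simp
      also have "\<dots> = x" using Suc x \<open>x \<in> A n\<close> e(2) by simp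
      finally show ?thesis .
    qed
    ultimately show ?case by blast
  qed
  have gc: "g n \<in> carrier R" for n using g A(5) by blast
  define K where "K n = {x \<in> carrier R. x \<otimes> g n = \<zero>}" for n
  have lK: "left_ideal R (K n)" for n unfolding K_def using left_ideal_annihilator_elt gc by simp
  have incK: "K n \<subseteq> K (Suc n)" for n
  proof
    fix x assume "x \<in> K n"
    then have x: "x \<in> carrier R" "x \<otimes> g n = \<zero>" unfolding K_def by auto
    have "x \<otimes> g (Suc n) = (x \<otimes> g n) \<otimes> e (Suc n)" unfolding gS using x(1) gc ec by (simp add: m_assoc)
    then show "x \<in> K (Suc n)" unfolding K_def using x ec by simp
  qed
  have "\<exists>N. \<forall>n\<ge>N. K n = K N" by (rule split_acc[OF sp]) (fact lK incK)+
  then obtain N where *: "\<forall>n\<ge>N. K n = K N" by (rule exE)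
  have N: "K n = K N" if "n \<ge> N" for n using *[rule_format, OF that] .
  have "A n = A N" if n: "n \<ge> N" for n
  proof
    show "A n \<subseteq> A N" using mono n by blast
    show "A N \<subseteq> A n"
    proof
      fix x assume x: "x \<in> A N"
      have xc: "x \<in> carrier R" using x A(5) by blast
      \<comment> \<open>This element lies in the annihilator of g(n), which equals that of g(N), and
        in \<open>A N\<close>, where g(N) is a right identity; so it is 0.\<close>
      let ?y = "x \<ominus> x \<otimes> g n"
      have gg: "g n \<otimes> g n = g n" using g by blast
      have "?y \<otimes> g n = \<zero>" using xc gc gg by (simp add: a_minus_def l_distr l_minus m_assoc r_neg)
      then have "?y \<in> K n" unfolding K_def using xc gc by simp
      then have yK: "?y \<in> K N" unfolding N[OF n] .
      have "x \<otimes> g n \<in> A N" using A(4) xc g mono[OF n] by blast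
      then have "?y \<in> A N" using left_ideal_minus[OF lA x] by blast
      then have "?y = ?y \<otimes> g N" using g by simp
      also have "\<dots> = \<zero>" using yK unfolding K_def by blast
      finally have "x = x \<otimes> g n" using minus_eq_zero_iff xc gc by simp
      then show "x \<in> A n" using A(4)[OF xc, of "g n"] g by metis
    qed
  qed
  then show "\<exists>N. \<forall>n\<ge>N. A n = A N" by blast
qed

lemma artinian_minimal:
  assumes "left_artinian R" "X \<noteq> {}" "\<And>I. I \<in> X \<Longrightarrow> left_ideal R I"
  shows "\<exists>M\<in>X. \<forall>J\<in>X. J \<subseteq> M \<longrightarrow> J = M"
proof (rule ccontr)
  assume "\<not> ?thesis"
  then have step: "\<exists>J\<in>X. J \<subset> M" if "M \<in> X" for M using that by blast
  have "\<exists>A. \<forall>n::nat. A n \<in> X \<and> A (Suc n) \<subset> A n"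
    by (rule dependent_nat_choice) (use assms(2) step in blast)+
  then obtain A :: "nat \<Rightarrow> 'a set" where A: "\<And>n. A n \<in> X" "\<And>n. A (Suc n) \<subset> A n" by blast
  then have "\<forall>n. left_ideal R (A n) \<and> A (Suc n) \<subseteq> A n" using assms(3) by blast
  then obtain N where "\<forall>n\<ge>N. A n = A N" using assms(1) unfolding left_artinian_def by blast
  then have "A (Suc N) = A N" by (meson le_SucI order_refl)
  then show False using A(2) by blast
qed

section \<open>Direct sums of minimal left ideals\<close>

lemma left_ideal_left_ideal_sum:
  assumes "\<And>I. I \<in> \<F> \<Longrightarrow> left_ideal R I"
  shows "left_ideal R (left_ideal_sum R \<F>)"
  unfolding left_ideal_iff
proof (intro conjI ballI)
  let ?L = "left_ideal_sum R \<F>"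
  have fc: "f \<in> F \<rightarrow> carrier R" if "F \<subseteq> \<F>" "\<forall>I\<in>F. f I \<in> I" for F f
    using that left_idealD(5)[OF assms] by blast
  show "?L \<subseteq> carrier R" unfolding left_ideal_sum_def using fc by auto
  have "(\<Oplus>I\<in>{}. undefined I) = \<zero>" by simp
  then show "\<zero> \<in> ?L" unfolding left_ideal_sum_def
    by (intro CollectI exI[of _ "{}"] exI[of _ undefined]) auto
  fix x assume "x \<in> ?L"
  then obtain F f where x: "x = (\<Oplus>I\<in>F. f I)" "finite F" "F \<subseteq> \<F>" "\<forall>I\<in>F. f I \<in> I"
    unfolding left_ideal_sum_def by blast
  {
    fix y assume "y \<in> ?L"
    then obtain G g where y: "y = (\<Oplus>I\<in>G. g I)" "finite G" "G \<subseteq> \<F>" "\<forall>I\<in>G. g I \<in> I"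
      unfolding left_ideal_sum_def by blast
    let ?H = "F \<union> G"
    \<comment> \<open>Both families are padded with zero to the same index set, so that the sums can
      be added termwise.\<close>
    let ?f = "\<lambda>I. if I \<in> F then f I else \<zero>" and ?g = "\<lambda>I. if I \<in> G then g I else \<zero>"
    have f: "\<forall>I\<in>?H. ?f I \<in> I" and g: "\<forall>I\<in>?H. ?g I \<in> I"
      using x y left_idealD(2)[OF assms] by auto
    have fgc: "?f \<in> ?H \<rightarrow> carrier R" "?g \<in> ?H \<rightarrow> carrier R"
      using fc[of ?H, OF _ f] fc[of ?H, OF _ g] x(3) y(3) by auto
    have "x = (\<Oplus>I\<in>?H. ?f I)"
      unfolding x(1) by (rule add.finprod_mono_neutral_cong_left) (use x y fgc in auto)
    moreover have "y = (\<Oplus>I\<in>?H. ?g I)"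
      unfolding y(1) by (rule add.finprod_mono_neutral_cong_left) (use x y fgc in auto)
    ultimately have "x \<oplus> y = (\<Oplus>I\<in>?H. ?f I \<oplus> ?g I)"
      using finsum_addf[OF fgc] by simp
    moreover have "\<forall>I\<in>?H. ?f I \<oplus> ?g I \<in> I"
    proof
      fix I assume I: "I \<in> ?H"
      then have "left_ideal R I" using assms x(3) y(3) by blast
      then show "?f I \<oplus> ?g I \<in> I" using left_idealD(3) f g I by blast
    qed
    moreover have "finite ?H" "?H \<subseteq> \<F>" using x y by auto
    ultimately show "x \<oplus> y \<in> ?L"
      unfolding left_ideal_sum_def mem_Collect_eq by (intro exI conjI)
  }
  fix r assume r: "r \<in> carrier R"
  have "r \<otimes> x = (\<Oplus>I\<in>F. r \<otimes> f I)"
    unfolding x(1) by (rule finsum_rdistr[OF x(2) r fc[OF x(3,4)]])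
  moreover have "\<forall>I\<in>F. r \<otimes> f I \<in> I"
  proof
    fix I assume "I \<in> F"
    then have "left_ideal R I" "f I \<in> I" using assms x(3,4) by auto
    then show "r \<otimes> f I \<in> I" using left_idealD(4) r by simp
  qed
  ultimately show "r \<otimes> x \<in> ?L"
    unfolding left_ideal_sum_def mem_Collect_eq using x(2,3) by (intro exI conjI)
qed

lemma left_ideal_sum_incl:
  assumes "\<And>I. I \<in> \<F> \<Longrightarrow> left_ideal R I" "I \<in> \<F>" "x \<in> I"
  shows "x \<in> left_ideal_sum R \<F>"
proof -
  have xc: "x \<in> carrier R" using assms left_idealD(5) by blast
  then have "x = (\<Oplus>J\<in>{I}. x)" by simp
  then show ?thesis unfolding left_ideal_sum_def
    using assms by (intro CollectI exI[of _ "{I}"] exI[of _ "\<lambda>_. x"]) auto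
qed

lemma sum_direct_insert:
  assumes \<F>: "\<And>I. I \<in> \<F> \<Longrightarrow> left_ideal R I" and d: "sum_direct R \<F>"
    and N: "left_ideal R N" "N \<inter> left_ideal_sum R \<F> \<subseteq> {\<zero>}"
  shows "sum_direct R (insert N \<F>)"
  unfolding sum_direct_def
proof (intro allI impI)
  fix F f assume A: "finite F \<and> F \<subseteq> insert N \<F> \<and> (\<forall>I\<in>F. f I \<in> I) \<and> (\<Oplus>I\<in>F. f I) = \<zero>"
  let ?G = "F - {N}"
  have G: "finite ?G" "?G \<subseteq> \<F>" "\<forall>I\<in>?G. f I \<in> I" using A by auto
  have fc: "f \<in> F \<rightarrow> carrier R" using A \<F> N(1) left_idealD(5) by blast
  show "\<forall>I\<in>F. f I = \<zero>"
  proof (cases "N \<in> F")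
    case False
    then have "?G = F" by auto
    then show ?thesis using d A G unfolding sum_direct_def by metis
  next
    case True
    then have "(\<Oplus>I\<in>F. f I) = f N \<oplus> (\<Oplus>I\<in>?G. f I)"
      using finsum_insert[OF G(1), of N f] fc by (auto simp: insert_absorb)
    then have s: "f N \<oplus> (\<Oplus>I\<in>?G. f I) = \<zero>" using A by simp
    let ?s = "\<Oplus>I\<in>?G. f I"
    have sL: "?s \<in> left_ideal_sum R \<F>" unfolding left_ideal_sum_def using G by blast
    have c: "f N \<in> carrier R" "?s \<in> carrier R" using fc True by (auto intro!: finsum_closed)
    have "f N = \<ominus> ?s" using minus_equality[OF s c(2,1)] by simp
    then have "f N \<in> left_ideal_sum R \<F>"
      using left_ideal_neg[OF left_ideal_left_ideal_sum sL] \<F> by simp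
    moreover have "f N \<in> N" using A True by blast
    ultimately have N0: "f N = \<zero>" using N(2) by blast
    then have "?s = \<zero>" using s c by simp
    then have "\<forall>I\<in>?G. f I = \<zero>" using d G unfolding sum_direct_def by blast
    then show ?thesis using N0 by blast
  qed
qed

text \<open>Take a maximal direct family of minimal left ideals, with sum R e. If the complement R
  (1 - e) were nonzero, it would contain a minimal left ideal by the descending chain condition, and
  that one could be added to the family. Hence 1 = e.\<close>

lemma split_imp_semisimple:
  assumes sp: "left_ideals_split R" shows "semisimple_ring R"
proof -
  note art = split_imp_artinian[OF sp]
  let ?A = "{\<F>. (\<forall>I\<in>\<F>. minimal_left_ideal R I) \<and> sum_direct R \<F>}"
  have "\<exists>\<F>\<in>?A. \<forall>\<G>\<in>?A. \<F> \<subseteq> \<G> \<longrightarrow> \<G> = \<F>"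
  proof (rule subset_Zorn_nonempty)
    have "{} \<in> ?A" unfolding sum_direct_def by auto
    then show "?A \<noteq> {}" by blast
    fix C assume ne: "C \<noteq> {}" and ch: "subset.chain ?A C"
    then have CA: "C \<subseteq> ?A" unfolding subset_chain_def by blast
    have "sum_direct R (\<Union>C)"
      unfolding sum_direct_def
    proof (intro allI impI)
      fix F f assume A: "finite F \<and> F \<subseteq> \<Union>C \<and> (\<forall>I\<in>F. f I \<in> I) \<and> (\<Oplus>I\<in>F. f I) = \<zero>"
      then obtain B where "B \<in> C" "F \<subseteq> B" using finite_subset_Union_chain[OF _ _ ne ch] by blast
      moreover then have "sum_direct R B" using CA by blast
      ultimately show "\<forall>I\<in>F. f I = \<zero>" using A unfolding sum_direct_def by blast
    qed
    then show "\<Union>C \<in> ?A" using CA by blast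
  qed
  then obtain \<F> where FA: "\<F> \<in> ?A" and max: "\<forall>\<G>\<in>?A. \<F> \<subseteq> \<G> \<longrightarrow> \<G> = \<F>"
    by (rule bexE)
  have min: "minimal_left_ideal R I" if "I \<in> \<F>" for I using FA that by simp
  have d: "sum_direct R \<F>" using FA by simp
  have \<F>: "left_ideal R I" if "I \<in> \<F>" for I using min that unfolding minimal_left_ideal_def by blast
  let ?L = "left_ideal_sum R \<F>"
  have L: "left_ideal R ?L" using left_ideal_left_ideal_sum \<F> by blast
  obtain e where e: "e \<in> ?L" "\<And>x. x \<in> ?L \<Longrightarrow> x \<otimes> e = x"
    using sp L unfolding left_ideals_split_def by blast
  have ec: "e \<in> carrier R" using left_idealD(5)[OF L e(1)] .
  define K where "K = {x \<in> carrier R. x \<otimes> e = \<zero>}"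
  have K: "left_ideal R K" unfolding K_def using left_ideal_annihilator_elt ec by simp
  have KL: "K \<inter> ?L \<subseteq> {\<zero>}" unfolding K_def using e(2) by force
  have "K = {\<zero>}"
  proof (rule ccontr)
    assume "K \<noteq> {\<zero>}"
    let ?X = "{I. left_ideal R I \<and> I \<subseteq> K \<and> I \<noteq> {\<zero>}}"
    have "K \<in> ?X" using K \<open>K \<noteq> {\<zero>}\<close> by simp
    then have "?X \<noteq> {}" by blast
    then have "\<exists>N\<in>?X. \<forall>J\<in>?X. J \<subseteq> N \<longrightarrow> J = N"
      by (rule artinian_minimal[OF art]) simp
    then obtain N where NX: "N \<in> ?X" and Nmin: "\<forall>J\<in>?X. J \<subseteq> N \<longrightarrow> J = N"
      by (rule bexE)
    have N: "left_ideal R N" "N \<subseteq> K" "N \<noteq> {\<zero>}" using NX by simp_all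
    have "J = {\<zero>} \<or> J = N" if J: "left_ideal R J" "J \<subseteq> N" for J
    proof (cases "J = {\<zero>}")
      case False
      then have "J \<in> ?X" using J N(2) by simp
      then show ?thesis using Nmin J(2) by simp
    qed simp
    then have mN: "minimal_left_ideal R N" unfolding minimal_left_ideal_def using N by simp
    have NL: "N \<inter> ?L \<subseteq> {\<zero>}" using N KL by blast
    have "sum_direct R (insert N \<F>)" using sum_direct_insert[OF \<F> d N(1) NL] by simp
    then have "insert N \<F> \<in> ?A" using mN min by simp
    then have "insert N \<F> = \<F>" using bspec[OF max] by blast
    then have "N \<in> \<F>" by blast
    then have "N \<subseteq> ?L" using left_ideal_sum_incl[OF \<F>] by blast
    then show False using NL N left_idealD(2)[OF N(1)] by blast
  qed
  moreover have "(\<one> \<ominus> e) \<otimes> e = \<zero>"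
    using ec e by (simp add: a_minus_def l_distr l_minus r_neg)
  then have "\<one> \<ominus> e \<in> K" unfolding K_def using ec by simp
  ultimately have "\<one> = e" using minus_eq_zero_iff ec by simp
  then have "?L = carrier R" using left_ideal_eq_carrier[OF L] e by simp
  then show ?thesis unfolding semisimple_ring_def using ring_axioms art min d by blast
qed

lemma semisimple_iff_split: "semisimple_ring R \<longleftrightarrow> left_ideals_split R"
  using semisimple_imp_split split_imp_semisimple by blast

section \<open>Units in Artinian rings\<close>

lemma right_cancel_power:
  assumes c: "c \<in> carrier R" and inj: "\<And>x. x \<in> carrier R \<Longrightarrow> x \<otimes> c = \<zero> \<Longrightarrow> x = \<zero>"
    and x: "x \<in> carrier R" "x \<otimes> c [^] (n::nat) = \<zero>"
  shows "x = \<zero>"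
  using x
proof (induction n)
  case (Suc n)
  then have "(x \<otimes> c [^] n) \<otimes> c = \<zero>" using c by (simp add: m_assoc)
  then show ?case using inj[of "x \<otimes> c [^] n"] Suc c by simp
qed simp

text \<open>The chain R c^n stabilizes, so c^N = q c^(N+1). Cancelling c^N on the right gives q c =
  1, and (1 - c q) c = 0 then gives c q = 1.\<close>

lemma artinian_right_cancel_imp_unit:
  assumes art: "left_artinian R" and c: "c \<in> carrier R"
    and inj: "\<And>x. x \<in> carrier R \<Longrightarrow> x \<otimes> c = \<zero> \<Longrightarrow> x = \<zero>"
  shows "c \<in> Units R"
proof -
  note pow = right_cancel_power[OF c inj]
  define A where "A n = {r \<otimes> c [^] n | r. r \<in> carrier R}" for n :: nat
  have "\<forall>n. left_ideal R (A n) \<and> A (Suc n) \<subseteq> A n"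
  proof (intro allI conjI subsetI)
    fix n show "left_ideal R (A n)" unfolding A_def using left_ideal_principal c by simp
    fix x assume "x \<in> A (Suc n)"
    then obtain r where r: "r \<in> carrier R" "x = r \<otimes> c [^] Suc n" unfolding A_def by blast
    then have "x = (r \<otimes> c) \<otimes> c [^] n" using c nat_pow_Suc2[of c n] by (simp add: m_assoc)
    then show "x \<in> A n" unfolding A_def using r c by blast
  qed
  then obtain N where N: "\<forall>n\<ge>N. A n = A N" using art unfolding left_artinian_def by blast
  have "c [^] N \<in> A N" unfolding A_def by (rule mem_principal) (use c in simp)
  moreover have "A (Suc N) = A N" by (rule N[rule_format]) simp
  ultimately have "c [^] N \<in> A (Suc N)" by simp
  then obtain q where q: "q \<in> carrier R" "c [^] N = q \<otimes> c [^] Suc N" unfolding A_def by blast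
  have "(q \<otimes> c) \<otimes> c [^] N = q \<otimes> c [^] Suc N"
    unfolding nat_pow_Suc2[OF c] using q(1) c by (simp add: m_assoc)
  then have "(q \<otimes> c) \<otimes> c [^] N = c [^] N" unfolding q(2)[symmetric] .
  then have "(\<one> \<ominus> q \<otimes> c) \<otimes> c [^] N = \<zero>"
    using q(1) c by (simp add: a_minus_def l_distr l_minus r_neg)
  then have "\<one> \<ominus> q \<otimes> c = \<zero>" using pow[of "\<one> \<ominus> q \<otimes> c" N] q(1) c by simp
  then have qc: "q \<otimes> c = \<one>" using minus_eq_zero_iff[of \<one> "q \<otimes> c"] q(1) c by simp
  have "(\<one> \<ominus> c \<otimes> q) \<otimes> c = \<zero>"
    using q(1) c qc by (simp add: a_minus_def l_distr l_minus r_neg m_assoc)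
  then have "\<one> \<ominus> c \<otimes> q = \<zero>" using inj[of "\<one> \<ominus> c \<otimes> q"] q(1) c by simp
  then have "c \<otimes> q = \<one>" using minus_eq_zero_iff[of \<one> "c \<otimes> q"] q(1) c by simp
  then show ?thesis unfolding Units_def using q(1) c qc by (intro CollectI conjI bexI[of _ q])
qed

end

lemma left_ideals_split_iso:
  assumes R: "ring R" and S: "ring S" and iso: "R \<simeq> S" and sp: "left_ideals_split R"
  shows "left_ideals_split S"
  unfolding left_ideals_split_def
proof (intro allI impI)
  interpret R: ring R by fact
  interpret S: ring S by fact
  fix I assume I: "left_ideal S I"
  note ID = S.left_idealD[OF I]
  obtain h where h: "h \<in> ring_iso R S" using iso unfolding is_ring_iso_def by blast
  note H = ring_iso_memE[OF h]
  have "h \<zero>\<^bsub>R\<^esub> \<oplus>\<^bsub>S\<^esub> h \<zero>\<^bsub>R\<^esub> = h \<zero>\<^bsub>R\<^esub>" using H(3)[of "\<zero>\<^bsub>R\<^esub>" "\<zero>\<^bsub>R\<^esub>"] by simp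
  then have h0: "h \<zero>\<^bsub>R\<^esub> = \<zero>\<^bsub>S\<^esub>" using H(1)[OF R.zero_closed] by (simp add: S.add.l_cancel_one)
  have "left_ideal R {x \<in> carrier R. h x \<in> I}"
    unfolding R.left_ideal_iff using ID H h0 by auto
  then obtain e where e: "e \<in> carrier R" "h e \<in> I" "\<And>x. x \<in> carrier R \<Longrightarrow> h x \<in> I \<Longrightarrow> x \<otimes>\<^bsub>R\<^esub> e = x"
    using sp unfolding left_ideals_split_def by blast
  have "y \<otimes>\<^bsub>S\<^esub> h e = y" if y: "y \<in> I" for y
  proof -
    obtain x where "x \<in> carrier R" "y = h x" using H(5) ID(5)[OF y] unfolding bij_betw_def by blast
    then show ?thesis using e y H(2)[of x e] by simp
  qed
  then show "\<exists>e\<in>I. \<forall>x\<in>I. x \<otimes>\<^bsub>S\<^esub> e = x" using e by blast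
qed

section \<open>Orders in semisimple rings are semiprime left Goldie\<close>

context ring begin

section \<open>Annihilators and direct families\<close>

lemma left_annihilator_left_ideal:
  assumes "U \<subseteq> carrier R" shows "left_ideal R (left_annihilator R U)"
  unfolding left_ideal_iff left_annihilator_def using assms
  by (auto simp: l_distr m_assoc subset_iff)

lemma ideal_prod_self_zeroI:
  assumes I: "ideal I R" and "\<And>x y. x \<in> I \<Longrightarrow> y \<in> I \<Longrightarrow> x \<otimes> y = \<zero>"
  shows "I \<cdot> I = {\<zero>}"
proof -
  have z: "x = \<zero>" if "x \<in> I \<cdot> I" for x
    using that
  proof induction
    case (prod i j) then show ?case by (rule assms(2))
  next
    case (sum s t) then show ?case by simp
  qed
  have "\<zero> \<in> I" using additive_subgroup.zero_closed[OF ideal.axioms(1)[OF I]] .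
  then have "\<zero> \<otimes> \<zero> \<in> I \<cdot> I" by (intro ideal_prod.prod)
  then have "\<zero> \<in> I \<cdot> I" by simp
  then show ?thesis using z by blast
qed

lemma left_ideal_imp_ideal:
  assumes "left_ideal R I" "\<And>x r. x \<in> I \<Longrightarrow> r \<in> carrier R \<Longrightarrow> x \<otimes> r \<in> I"
  shows "ideal I R"
  using assms left_idealD(4)[OF assms(1)] unfolding left_ideal_def
  by (intro idealI ring_axioms) (auto simp: additive_subgroup.a_subgroup)

lemma ideal_imp_left_ideal: "ideal I R \<Longrightarrow> left_ideal R I"
  unfolding left_ideal_def by (auto intro: ideal.axioms(1) ideal.I_l_closed)

lemma left_annihilator_ideal:
  assumes "left_ideal R I" shows "ideal (left_annihilator R I) R"
proof (rule left_ideal_imp_ideal)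
  note I = left_idealD[OF assms]
  show "left_ideal R (left_annihilator R I)" by (rule left_annihilator_left_ideal[OF I(1)])
  fix x r assume A: "x \<in> left_annihilator R I" "r \<in> carrier R"
  then have x: "x \<in> carrier R" "\<forall>z\<in>I. x \<otimes> z = \<zero>" unfolding left_annihilator_def by auto
  have "x \<otimes> r \<otimes> z = \<zero>" if z: "z \<in> I" for z
    using x(1) bspec[OF x(2) I(4)[OF A(2) z]] A(2) I(5)[OF z] by (simp add: m_assoc)
  then show "x \<otimes> r \<in> left_annihilator R I" unfolding left_annihilator_def using x(1) A(2) by simp
qed

lemma right_annihilator_ideal:
  assumes I: "ideal I R" shows "ideal {y \<in> carrier R. \<forall>x\<in>I. x \<otimes> y = \<zero>} R" (is "ideal ?N R")
proof (rule left_ideal_imp_ideal)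
  note Ic = ideal.Icarr[OF I]
  show "left_ideal R ?N"
    unfolding left_ideal_iff
  proof (intro conjI ballI)
    show "?N \<subseteq> carrier R" "\<zero> \<in> ?N" using Ic by auto
    fix x assume x: "x \<in> ?N"
    show "x \<oplus> y \<in> ?N" if "y \<in> ?N" for y using x that Ic by (simp add: r_distr)
    show "r \<otimes> x \<in> ?N" if r: "r \<in> carrier R" for r
    proof -
      have "y \<otimes> (r \<otimes> x) = \<zero>" if y: "y \<in> I" for y
      proof -
        have "(y \<otimes> r) \<otimes> x = \<zero>" using x ideal.I_r_closed[OF I y r] by blast
        then show ?thesis using x r Ic[OF y] by (simp add: m_assoc)
      qed
      then show ?thesis using x r by simp
    qed
  qed
  fix x r assume A: "x \<in> ?N" "r \<in> carrier R"
  then have "y \<otimes> (x \<otimes> r) = \<zero>" if "y \<in> I" for y using that Ic by (simp add: m_assoc[symmetric])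
  then show "x \<otimes> r \<in> ?N" using A by simp
qed

lemma sum_directD:
  assumes "sum_direct R \<F>" "finite F" "F \<subseteq> \<F>" "\<forall>I\<in>F. f I \<in> I" "(\<Oplus>I\<in>F. f I) = \<zero>" "I \<in> F"
  shows "f I = \<zero>"
  using assms(1)[unfolded sum_direct_def, THEN spec, THEN spec, THEN mp, OF conjI[OF assms(2)
    conjI[OF assms(3) conjI[OF assms(4,5)]]]] assms(6) by (rule bspec)

lemma sum_direct_disjoint:
  assumes \<F>: "\<And>I. I \<in> \<F> \<Longrightarrow> left_ideal R I" and d: "sum_direct R \<F>"
    and I: "I \<in> \<F>" "I \<notin> \<G>" "\<G> \<subseteq> \<F>" and x: "x \<in> I" "x \<in> left_ideal_sum R \<G>"
  shows "x = \<zero>"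
proof -
  obtain F f where F: "x = (\<Oplus>J\<in>F. f J)" "finite F" "F \<subseteq> \<G>" "\<forall>J\<in>F. f J \<in> J"
    using x(2) unfolding left_ideal_sum_def by blast
  have xc: "x \<in> carrier R" using left_idealD(5)[OF \<F>[OF I(1)] x(1)] .
  have IF: "I \<notin> F" using F(3) I(2) by blast
  \<comment> \<open>Putting -x into the slot of \<open>I\<close> turns the equation for x into a
    vanishing sum over the direct family.\<close>
  let ?g = "\<lambda>J. if J = I then \<ominus> x else f J"
  have fc: "f \<in> F \<rightarrow> carrier R"
  proof
    fix J assume J: "J \<in> F"
    then have "left_ideal R J" using F(3) I(3) \<F> by blast
    then show "f J \<in> carrier R" using left_idealD(5) F(4) J by blast
  qed
  have gc: "?g \<in> F \<rightarrow> carrier R" using fc xc by auto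
  have "(\<Oplus>J\<in>F. ?g J) = (\<Oplus>J\<in>F. f J)"
    using IF fc by (intro finsum_cong') auto
  then have "(\<Oplus>J\<in>insert I F. ?g J) = \<zero>"
    using finsum_insert[OF F(2) IF, of ?g] gc xc F(1)[symmetric] by (simp add: l_neg)
  moreover have "\<forall>J\<in>insert I F. ?g J \<in> J"
    using F(4) left_ideal_neg[OF \<F>[OF I(1)] x(1)] IF by auto
  moreover have "finite (insert I F)" "insert I F \<subseteq> \<F>" using F I by auto
  ultimately have "?g I = \<zero>"
    by (intro sum_directD[OF d, of "insert I F" ?g I] insertI1)
  then have "\<ominus> x = \<zero>" by simp
  then have "\<ominus> (\<ominus> x) = \<zero>" by simp
  then show ?thesis using xc by simp
qed

end

section \<open>Orders in rings with split left ideals\<close>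

context left_localization begin

context
  assumes reg: "S \<subseteq> regular_elements R" and split: "left_ideals_split Q"
begin

lemma phi_eq_zero:
  assumes "r \<in> carrier R" "\<phi> r = \<zero>\<^bsub>Q\<^esub>" shows "r = \<zero>"
proof -
  obtain s where "s \<in> S" "s \<otimes> r = \<zero>" using ker assms by blast
  then show ?thesis using regular_elementsD(2) reg assms(1) by blast
qed

lemma phi_inj:
  assumes "a \<in> carrier R" "b \<in> carrier R" "\<phi> a = \<phi> b" shows "a = b"
proof -
  obtain t where t: "t \<in> S" "t \<otimes> a = t \<otimes> b" using phi_eq_iff assms by blast
  then have "t \<otimes> (a \<ominus> b) = \<zero>" using mult_minus_eq_zero_iff assms by simp
  then have "a \<ominus> b = \<zero>" using regular_elementsD(2)[of t "a \<ominus> b"] reg t assms by auto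
  then show ?thesis using minus_eq_zero_iff assms by simp
qed

text \<open>The bridge from \<open>Q\<close> back to \<open>R\<close>, used for semiprimeness and
  for both Goldie conditions: the right identity e of the extended left ideal is a fraction with
  denominator c and a numerator b that lies in \<open>I\<close> itself.\<close>

lemma extension_generator:
  assumes "left_ideal R I"
  obtains e c b where "e \<in> carrier Q" "c \<in> S" "b \<in> I" "\<phi> c \<star> e = \<phi> b"
    "\<forall>x\<in>I. \<phi> x \<star> e = \<phi> x"
proof -
  obtain e where e: "e \<in> extension I" "\<And>x. x \<in> extension I \<Longrightarrow> x \<star> e = x"
    using Q.splitE[OF split left_ideal_extension[OF assms]] by metis
  have "\<phi> x \<star> e = \<phi> x" if "x \<in> I" for x
    using e(2) phi_mem_extension[OF assms that] by blast
  then show thesis using e(1) that unfolding extension_def by blast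
qed

text \<open>The right annihilator of an ideal with square zero is an essential left ideal, so it
  meets \<open>S\<close>.\<close>

lemma order_semiprime: "semiprime_ring R"
  unfolding semiprime_ring_def
proof (intro conjI allI impI)
  show "ring R" by (rule ring_axioms)
  fix I assume A: "ideal I R \<and> I \<cdot> I = {\<zero>}"
  then have I: "ideal I R" by blast
  note lI = left_idealD[OF ideal_imp_left_ideal[OF I]]
  have II: "x \<otimes> y = \<zero>" if "x \<in> I" "y \<in> I" for x y
    using ideal_prod.prod[OF that, of R] A by blast
  define N where "N = {x \<in> carrier R. \<forall>y\<in>I. y \<otimes> x = \<zero>}"
  have N: "left_ideal R N" unfolding N_def by (rule ideal_imp_left_ideal[OF right_annihilator_ideal[OF I]])
  obtain e c b where e: "e \<in> carrier Q" "c \<in> S" "b \<in> N" "\<phi> c \<star> e = \<phi> b"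
    "\<forall>x\<in>N. \<phi> x \<star> e = \<phi> x"
    by (rule extension_generator[OF N])
  \<comment> \<open>The goal is e = 1. The numerator a of 1 - e is shown to vanish: R a meets
    \<open>N\<close> in 0, and yet a turns out to lie in \<open>N\<close>.\<close>
  let ?q = "\<one>\<^bsub>Q\<^esub> \<ominus>\<^bsub>Q\<^esub> e"
  have qc: "?q \<in> carrier Q" using e(1) by simp
  obtain d a where da: "d \<in> S" "a \<in> carrier R" "\<phi> d \<star> ?q = \<phi> a" using frac[OF qc] by blast
  \<comment> \<open>Right multiplication by e fixes the image of \<open>N\<close> but kills \<phi>(r
    a) = \<phi>(r d) (1 - e), because e is idempotent.\<close>
  have zero: "r \<otimes> a = \<zero>" if r: "r \<in> carrier R" "r \<otimes> a \<in> N" for r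
  proof -
    have "\<phi> (r \<otimes> a) = (\<phi> r \<star> (\<phi> d \<star> ?q))" using r da by (simp add: phi_mult)
    then have 1: "\<phi> (r \<otimes> a) = \<phi> (r \<otimes> d) \<star> ?q"
      using r da(1) qc by (simp add: phi_mult Q.m_assoc)
    have c: "\<phi> (r \<otimes> d) \<in> carrier Q" using r da by simp
    have "\<phi> (r \<otimes> d) \<star> ?q = \<phi> (r \<otimes> d) \<ominus>\<^bsub>Q\<^esub> \<phi> (r \<otimes> d) \<star> e"
      using c e(1) by (simp add: a_minus_def Q.r_distr Q.r_minus)
    also have "\<dots> \<star> e = \<phi> (r \<otimes> d) \<star> e \<ominus>\<^bsub>Q\<^esub> \<phi> (r \<otimes> d) \<star> (e \<star> e)"
      using c e(1) by (simp add: a_minus_def Q.l_distr Q.l_minus Q.m_assoc)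
    finally have 2: "\<phi> (r \<otimes> a) \<star> e = \<phi> (r \<otimes> d) \<star> e \<ominus>\<^bsub>Q\<^esub> \<phi> (r \<otimes> d) \<star> (e \<star> e)"
      using 1 by simp
    have "\<phi> c \<star> (e \<star> e) = \<phi> c \<star> e"
      using e(5)[THEN bspec, OF e(3)] e(1,2) by (simp add: Q.m_assoc[symmetric] e(4))
    then have "e \<star> e = e" using unit_cancel[OF e(2)] e(1) by simp
    then have "\<phi> (r \<otimes> a) \<star> e = \<zero>\<^bsub>Q\<^esub>"
      using 2 c e(1) by (simp add: a_minus_def Q.r_neg)
    then have "\<phi> (r \<otimes> a) = \<zero>\<^bsub>Q\<^esub>" using e(5)[THEN bspec, OF r(2)] by simp
    then show ?thesis using phi_eq_zero r da by simp
  qed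
  \<comment> \<open>Products of two elements of \<open>I\<close> vanish, so y a is again killed by
    \<open>I\<close> from the left. It lies in \<open>N\<close> and is 0 by the previous step; hence
    a itself lies in \<open>N\<close>.\<close>
  have Ia: "y \<otimes> a = \<zero>" if y: "y \<in> I" for y
  proof -
    have "z \<otimes> (y \<otimes> a) = \<zero>" if z: "z \<in> I" for z
      using II[OF z y] lI(5)[OF z] lI(5)[OF y] da(2) by (simp add: m_assoc[symmetric])
    then have "y \<otimes> a \<in> N" unfolding N_def using lI(5)[OF y] da(2) by simp
    then show ?thesis using zero lI(5)[OF y] by blast
  qed
  then have "\<one> \<otimes> a \<in> N" unfolding N_def using da(2) by simp
  then have "a = \<zero>" using zero[of \<one>] da(2) by simp
  then have "?q = \<zero>\<^bsub>Q\<^esub>" using unit_zero[OF da(1) qc] da(3) by simp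
  then have "\<one>\<^bsub>Q\<^esub> = e" using Q.minus_eq_zero_iff e(1) by simp
  then have "\<phi> c \<star> \<one>\<^bsub>Q\<^esub> = \<phi> b" using e(4) by simp
  then have "\<phi> c = \<phi> b" using e(2) by simp
  \<comment> \<open>With e = 1 the fraction for e says c = b, so \<open>N\<close> contains the
    regular element c, and y c = 0 for all y in \<open>I\<close>.\<close>
  then have "c = b" by (rule phi_inj[rotated 2]) (use e(2) left_idealD(5)[OF N e(3)] in simp_all)
  then have cN: "c \<in> N" using e(3) by simp
  have "y = \<zero>" if y: "y \<in> I" for y
  proof -
    have "y \<otimes> c = \<zero>" using cN y unfolding N_def by blast
    then show ?thesis using regular_elementsD(3) reg e(2) lI(5)[OF y] by blast
  qed
  then show "I = {\<zero>}" using lI(2) by blast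
qed

text \<open>The numerator b involves only finitely many members \<open>F\<close> of the family. For
  nonzero x in another member, an Ore multiple t x = u c satisfies t x = u b, so it lies in the sum
  over \<open>F\<close> and vanishes, against the regularity of t.\<close>

lemma order_no_infinite_direct_sum:
  assumes \<F>: "\<And>I. I \<in> \<F> \<Longrightarrow> left_ideal R I" "\<And>I. I \<in> \<F> \<Longrightarrow> I \<noteq> {\<zero>}"
    and d: "sum_direct R \<F>"
  shows "finite \<F>"
proof -
  have L: "left_ideal R (left_ideal_sum R \<F>)" using left_ideal_left_ideal_sum \<F>(1) by blast
  obtain e c b where e: "e \<in> carrier Q" "c \<in> S" "b \<in> left_ideal_sum R \<F>" "\<phi> c \<star> e = \<phi> b"
    "\<forall>x\<in>left_ideal_sum R \<F>. \<phi> x \<star> e = \<phi> x"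
    by (rule extension_generator[OF L])
  obtain F f where F: "b = (\<Oplus>J\<in>F. f J)" "finite F" "F \<subseteq> \<F>" "\<forall>J\<in>F. f J \<in> J"
    using e(3) unfolding left_ideal_sum_def by blast
  have bF: "b \<in> left_ideal_sum R F" unfolding left_ideal_sum_def using F by blast
  have LF: "left_ideal R (left_ideal_sum R F)"
    by (rule left_ideal_left_ideal_sum) (use F \<F> in blast)
  have "I \<in> F" if I: "I \<in> \<F>" for I
  proof (rule ccontr)
    assume nI: "I \<notin> F"
    note lI = left_idealD[OF \<F>(1)[OF I]]
    obtain x where x: "x \<in> I" "x \<noteq> \<zero>" using \<F>(2)[OF I] lI(2) by blast
    have xc: "x \<in> carrier R" using x lI(5) by blast
    obtain t u where tu: "t \<in> S" "u \<in> carrier R" "t \<otimes> x = u \<otimes> c" using ore[OF xc e(2)] .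
    have bc: "b \<in> carrier R" using left_idealD(5)[OF L e(3)] .
    have tx: "t \<otimes> x \<in> I" by (rule lI(4)) (use x tu(1) in simp_all)
    have "\<phi> (t \<otimes> x) = \<phi> (t \<otimes> x) \<star> e"
      using e(5)[THEN bspec, OF left_ideal_sum_incl[OF \<F>(1) I tx]] by simp
    also have "\<dots> = \<phi> u \<star> (\<phi> c \<star> e)"
      unfolding tu(3) using tu(2) e(1,2) by (simp add: phi_mult Q.m_assoc)
    also have "\<dots> = \<phi> (u \<otimes> b)" unfolding e(4) using tu(2) bc by (simp add: phi_mult)
    finally have "t \<otimes> x = u \<otimes> b" using phi_inj[of "t \<otimes> x" "u \<otimes> b"] tu(1,2) xc bc by simp
    then have "t \<otimes> x \<in> left_ideal_sum R F" using left_idealD(4)[OF LF tu(2) bF] by simp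
    then have "t \<otimes> x = \<zero>" using sum_direct_disjoint[OF \<F>(1) d I nI F(3) tx] by blast
    then show False using regular_elementsD(2) reg tu(1) x xc by blast
  qed
  then have "\<F> \<subseteq> F" by blast
  then show ?thesis using F(2) finite_subset by blast
qed

text \<open>Let e be the right identity for the union of the chain, with numerator b in
  \<open>A N\<close>, the annihilator of \<open>U\<close>. Then b u = 0 gives e \<phi>(u) = 0, and x
  u = 0 for every x in the union since \<phi>(x) = \<phi>(x) e.\<close>

lemma order_acc_annihilators:
  fixes A :: "nat \<Rightarrow> 'a set"
  assumes A: "\<And>n. \<exists>U\<subseteq>carrier R. A n = left_annihilator R U" "\<And>n. A n \<subseteq> A (Suc n)"
  shows "\<exists>N. \<forall>n\<ge>N. A n = A N"
proof -
  have lA: "left_ideal R (A n)" for n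
  proof -
    obtain U where "U \<subseteq> carrier R" "A n = left_annihilator R U" using A(1) by blast
    then show ?thesis using left_annihilator_left_ideal by simp
  qed
  have mono: "A m \<subseteq> A n" if "m \<le> n" for m n using lift_Suc_mono_le[of A] A(2) that by blast
  have L: "left_ideal R (\<Union>n. A n)" by (rule left_ideal_nat_chain_Union) (fact lA A(2))+
  obtain e c b where e: "e \<in> carrier Q" "c \<in> S" "b \<in> (\<Union>n. A n)" "\<phi> c \<star> e = \<phi> b"
    "\<forall>x\<in>(\<Union>n. A n). \<phi> x \<star> e = \<phi> x"
    by (rule extension_generator[OF L])
  obtain N where N: "b \<in> A N" using e(3) by blast
  obtain U where U: "U \<subseteq> carrier R" "A N = left_annihilator R U" using A(1) by blast
  have "x \<in> A N" if x: "x \<in> A n" for x n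
  proof -
    have xc: "x \<in> carrier R" using left_idealD(5)[OF lA x] .
    have bc: "b \<in> carrier R" using left_idealD(5)[OF lA N] .
    have "x \<otimes> u = \<zero>" if u: "u \<in> U" for u
    proof -
      have uc: "u \<in> carrier R" using u U by blast
      have "b \<otimes> u = \<zero>" using N u unfolding U(2) left_annihilator_def by blast
      then have "\<phi> c \<star> (e \<star> \<phi> u) = \<zero>\<^bsub>Q\<^esub>"
        using e(1,2) uc bc by (simp add: Q.m_assoc[symmetric] e(4) phi_mult[symmetric])
      then have 0: "e \<star> \<phi> u = \<zero>\<^bsub>Q\<^esub>" using unit_zero[OF e(2)] e(1) uc by simp
      have "x \<in> (\<Union>n. A n)" using x by blast
      then have xe: "\<phi> x \<star> e = \<phi> x" using e(5) by blast
      have "\<phi> (x \<otimes> u) = (\<phi> x \<star> e) \<star> \<phi> u" using xe phi_mult[OF xc uc] by simp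
      also have "\<dots> = \<zero>\<^bsub>Q\<^esub>" using 0 e(1) xc uc by (simp add: Q.m_assoc)
      finally show ?thesis using phi_eq_zero xc uc by simp
    qed
    then show ?thesis unfolding U(2) left_annihilator_def using xc by blast
  qed
  then have "A n = A N" if "n \<ge> N" for n using mono[OF that] by blast
  then show ?thesis by blast
qed

lemma order_Goldie: "left_Goldie_ring R"
  unfolding left_Goldie_ring_def
proof (intro conjI notI allI impI)
  show "ring R" by (rule ring_axioms)
  show False if "\<exists>\<F>. infinite \<F> \<and> (\<forall>I\<in>\<F>. left_ideal R I \<and> I \<noteq> {\<zero>}) \<and> sum_direct R \<F>"
    using that order_no_infinite_direct_sum by blast
  fix A :: "nat \<Rightarrow> 'a set"
  assume "\<forall>n. (\<exists>U\<subseteq>carrier R. A n = left_annihilator R U) \<and> A n \<subseteq> A (Suc n)"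
  then show "\<exists>N. \<forall>n\<ge>N. A n = A N" by (intro order_acc_annihilators) simp_all
qed

end

end

section \<open>Goldie's theorem\<close>

text \<open>Equivalent to meeting every nonzero left ideal in a nonzero element, tested on principal
  left ideals.\<close>

definition left_essential :: "('a, 'b) ring_scheme \<Rightarrow> 'a set \<Rightarrow> bool" where
  "left_essential R E \<longleftrightarrow> left_ideal R E \<and>
     (\<forall>x\<in>carrier R. x \<noteq> \<zero>\<^bsub>R\<^esub> \<longrightarrow> (\<exists>r\<in>carrier R. r \<otimes>\<^bsub>R\<^esub> x \<in> E \<and> r \<otimes>\<^bsub>R\<^esub> x \<noteq> \<zero>\<^bsub>R\<^esub>))"

context ring begin

text \<open>Semiprimeness speaks of two-sided ideals. In place of the ideal generated by a, the
  proof uses \<open>J1 \<inter> J2\<close>: it has square zero because \<open>J1\<close> kills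
  \<open>J2\<close> from the left, and it contains a.\<close>

lemma semiprime_elt:
  assumes sp: "semiprime_ring R" and a: "a \<in> carrier R"
    and aRa: "\<And>r. r \<in> carrier R \<Longrightarrow> a \<otimes> r \<otimes> a = \<zero>"
  shows "a = \<zero>"
proof -
  define J1 where "J1 = left_annihilator R {r \<otimes> a | r. r \<in> carrier R}"
  define J2 where "J2 = {y \<in> carrier R. \<forall>x\<in>J1. x \<otimes> y = \<zero>}"
  have J1: "ideal J1 R" unfolding J1_def by (rule left_annihilator_ideal[OF left_ideal_principal[OF a]])
  have J2: "ideal J2 R" unfolding J2_def by (rule right_annihilator_ideal[OF J1])
  have I: "ideal (J1 \<inter> J2) R" by (rule i_intersect[OF J1 J2])
  have "(J1 \<inter> J2) \<cdot> (J1 \<inter> J2) = {\<zero>}"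
    by (rule ideal_prod_self_zeroI[OF I]) (auto simp: J2_def)
  then have z: "J1 \<inter> J2 = {\<zero>}" using sp I unfolding semiprime_ring_def by blast
  have "a \<otimes> (r \<otimes> a) = \<zero>" if "r \<in> carrier R" for r using aRa[OF that] a that by (simp add: m_assoc)
  then have "a \<in> J1" unfolding J1_def left_annihilator_def using a by auto
  moreover have "x \<otimes> a = \<zero>" if x: "x \<in> J1" for x
    using x mem_principal[OF a] unfolding J1_def left_annihilator_def by blast
  then have "a \<in> J2" unfolding J2_def using a by simp
  ultimately show ?thesis using z by blast
qed

section \<open>Nilpotence and maximal annihilators\<close>

abbreviation lann :: "'a \<Rightarrow> 'a set" where "lann a \<equiv> left_annihilator R {a}"

lemma left_annihilator_elt: "lann a = {x \<in> carrier R. x \<otimes> a = \<zero>}"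
  unfolding left_annihilator_def by auto

lemma annihilator_maximal:
  assumes G: "left_Goldie_ring R" and X: "X \<noteq> {}" "X \<subseteq> carrier R"
  shows "\<exists>a\<in>X. \<forall>b\<in>X. lann a \<subseteq> lann b \<longrightarrow>
    lann b \<subseteq> lann a"
proof (rule ccontr)
  assume "\<not> ?thesis"
  then have step: "\<exists>b. b \<in> X \<and> lann a \<subset> lann b" if "a \<in> X" for a
    using that by blast
  obtain x0 where x0: "x0 \<in> X" using X by blast
  have "\<exists>f. \<forall>n::nat. f n \<in> X \<and> lann (f n) \<subset> lann (f (Suc n))"
    by (rule dependent_nat_choice[where P="\<lambda>n x. x \<in> X"
          and Q="\<lambda>n x y. lann x \<subset> lann y"])
      (use x0 step in auto)
  then obtain f :: "nat \<Rightarrow> 'a" where f: "\<And>n. f n \<in> X"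
    "\<And>n. lann (f n) \<subset> lann (f (Suc n))" by blast
  have "\<forall>n. (\<exists>U\<subseteq>carrier R. lann (f n) = left_annihilator R U) \<and>
      lann (f n) \<subseteq> lann (f (Suc n))"
  proof (intro allI conjI)
    fix n
    show "\<exists>U\<subseteq>carrier R. lann (f n) = left_annihilator R U"
      by (rule exI[of _ "{f n}"]) (use f(1)[of n] X(2) in auto)
    show "lann (f n) \<subseteq> lann (f (Suc n))" using f(2)[of n] by blast
  qed
  then have "\<exists>N. \<forall>n\<ge>N. lann (f n) = lann (f N)"
    using G[unfolded left_Goldie_ring_def, THEN conjunct2, THEN conjunct2, THEN spec,
      of "\<lambda>n. lann (f n)"] by (rule mp[rotated])
  then obtain N where N: "\<forall>n\<ge>N. lann (f n) = lann (f N)" by (rule exE)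
  have "lann (f (Suc N)) = lann (f N)" by (rule N[rule_format]) simp
  then show False using f(2)[of N] by blast
qed

text \<open>Rests on (y s)^(n+1) = y (s y)^n s, and carries nilpotence from R y over to y R.\<close>

lemma pow_zero_mult:
  assumes "y \<in> carrier R" "s \<in> carrier R" "(s \<otimes> y) [^] (n::nat) = \<zero>"
  shows "(y \<otimes> s) [^] Suc n = \<zero>"
proof -
  have "(y \<otimes> s) [^] Suc n = y \<otimes> (s \<otimes> y) [^] n \<otimes> s" for n :: nat
  proof (induction n)
    case (Suc n)
    have "(y \<otimes> s) [^] Suc (Suc n) = (y \<otimes> s) [^] Suc n \<otimes> (y \<otimes> s)" using assms by simp
    also have "\<dots> = y \<otimes> ((s \<otimes> y) [^] n \<otimes> (s \<otimes> y)) \<otimes> s"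
      unfolding Suc using assms(1,2) by (simp add: m_assoc)
    finally show ?case by simp
  qed (use assms in simp)
  then show ?thesis using assms by simp
qed

text \<open>If every element of \<open>R y\<close> is nilpotent, so is every element of \<open>y R\<close>; an element of
  \<open>y R\<close> with maximal annihilator then satisfies \<open>x r x = 0\<close> for all \<open>r\<close>.\<close>

lemma nil_left_ideal_zero:
  assumes sp: "semiprime_ring R" and G: "left_Goldie_ring R"
    and I: "left_ideal R I" and nil: "\<And>x. x \<in> I \<Longrightarrow> \<exists>n::nat. x [^] n = \<zero>"
  shows "I = {\<zero>}"
proof (rule ccontr)
  assume "I \<noteq> {\<zero>}"
  then obtain y where y: "y \<in> I" "y \<noteq> \<zero>" using left_idealD(2)[OF I] by blast
  have yc: "y \<in> carrier R" using left_idealD(5)[OF I y(1)] .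
  define X where "X = {y \<otimes> r | r. r \<in> carrier R} - {\<zero>}"
  have XI: "y \<otimes> r \<in> X" if "r \<in> carrier R" "y \<otimes> r \<noteq> \<zero>" for r using that unfolding X_def by blast
  have "y \<otimes> \<one> \<in> X" using XI[of \<one>] y yc by simp
  then have "X \<noteq> {}" by blast
  moreover have "X \<subseteq> carrier R" unfolding X_def using yc by auto
  ultimately have "\<exists>a\<in>X. \<forall>b\<in>X. lann a \<subseteq> lann b \<longrightarrow>
    lann b \<subseteq> lann a" by (rule annihilator_maximal[OF G])
  then obtain x where x: "x \<in> X" and xmax: "\<forall>b\<in>X. lann x \<subseteq> lann b \<longrightarrow>
    lann b \<subseteq> lann x" by (rule bexE)
  obtain r0 where r0: "r0 \<in> carrier R" "x = y \<otimes> r0" "x \<noteq> \<zero>" using x unfolding X_def by blast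
  have xc: "x \<in> carrier R" using r0 yc by simp
  have "x \<otimes> r \<otimes> x = \<zero>" if r: "r \<in> carrier R" for r
  proof (cases "x \<otimes> r = \<zero>")
    case True then show ?thesis using xc by simp
  next
    case False
    let ?z = "x \<otimes> r"
    have zc: "?z \<in> carrier R" using xc r by simp
    have "(r0 \<otimes> r) \<otimes> y \<in> I" using left_idealD(4)[OF I] r0 r y by simp
    then obtain n where "((r0 \<otimes> r) \<otimes> y) [^] (n::nat) = \<zero>" using nil by blast
    then have "(y \<otimes> (r0 \<otimes> r)) [^] Suc n = \<zero>" using pow_zero_mult[of y "r0 \<otimes> r" n] yc r0(1) r by simp
    then have ex: "?z [^] Suc n = \<zero>" unfolding r0(2) using yc r0(1) r by (simp add: m_assoc)
    \<comment> \<open>k is one less than the nilpotency index of z = x r, so w = z^k is nonzero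
      while z w = 0. Since w begins with x, its left annihilator contains that of x; maximality
      gives equality, and z w = 0 becomes z x = 0.\<close>
    define k where "k = (LEAST k. ?z [^] Suc k = \<zero>)"
    have k: "?z [^] Suc k = \<zero>" unfolding k_def by (rule LeastI[of _ n]) (rule ex)
    have kmin: "?z [^] Suc j \<noteq> \<zero>" if "j < k" for j
      using that not_less_Least unfolding k_def by blast
    have "k \<noteq> 0" using k False zc by (intro notI) simp
    then obtain j where j: "k = Suc j" by (cases k) auto
    let ?w = "?z [^] k"
    have w0: "?w \<noteq> \<zero>" using kmin[of j] j by simp
    have w: "?w = x \<otimes> (r \<otimes> ?z [^] j)" unfolding j nat_pow_Suc2[OF zc] using xc r zc by (simp add: m_assoc)
    have w': "?w = y \<otimes> (r0 \<otimes> (r \<otimes> ?z [^] j))" unfolding w using r0 yc r zc by (simp add: m_assoc)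
    have "y \<otimes> (r0 \<otimes> (r \<otimes> ?z [^] j)) \<in> X" by (rule XI) (use r0(1) r zc w0 w' in simp_all)
    then have wX: "?w \<in> X" unfolding w' .
    have "lann x \<subseteq> lann ?w"
    proof
      fix u assume "u \<in> lann x"
      then have u: "u \<in> carrier R" "u \<otimes> x = \<zero>" unfolding left_annihilator_elt by auto
      have "u \<otimes> ?w = (u \<otimes> x) \<otimes> (r \<otimes> ?z [^] j)" unfolding w using u(1) xc r zc by (simp add: m_assoc)
      also have "\<dots> = \<zero>" unfolding u(2) using r zc by simp
      finally show "u \<in> lann ?w" unfolding left_annihilator_elt using u by simp
    qed
    then have "lann ?w \<subseteq> lann x" using bspec[OF xmax wX] by simp
    moreover have "?z \<in> lann ?w"
      unfolding left_annihilator_elt using k zc nat_pow_Suc2[OF zc, of k] by simp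
    ultimately have "?z \<in> lann x" by (rule subsetD)
    then show ?thesis unfolding left_annihilator_elt by simp
  qed
  then have "x = \<zero>" by (rule semiprime_elt[OF sp xc])
  then show False using r0 by simp
qed

text \<open>Some x in \<open>I\<close> is not nilpotent, and the left annihilators of its powers are
  constant from some exponent on, so a high power a has the same left annihilator as a a.\<close>

lemma stable_element:
  assumes sp: "semiprime_ring R" and G: "left_Goldie_ring R"
    and I: "left_ideal R I" "I \<noteq> {\<zero>}"
  shows "\<exists>a\<in>I. a \<noteq> \<zero> \<and> (\<forall>z\<in>carrier R. z \<otimes> a \<otimes> a = \<zero> \<longrightarrow> z \<otimes> a = \<zero>)"
proof -
  obtain x where x: "x \<in> I" "\<And>n::nat. x [^] n \<noteq> \<zero>"
    using nil_left_ideal_zero[OF sp G I(1)] I(2) by blast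
  have xc: "x \<in> carrier R" using left_idealD(5)[OF I(1) x(1)] .
  let ?X = "range (\<lambda>n::nat. x [^] n)"
  have "\<exists>a\<in>?X. \<forall>b\<in>?X. lann a \<subseteq> lann b \<longrightarrow>
    lann b \<subseteq> lann a"
    by (rule annihilator_maximal[OF G]) (use xc in auto)
  then obtain N :: nat where N: "\<And>n::nat. lann (x [^] N) \<subseteq> lann (x [^] n) \<Longrightarrow>
    lann (x [^] n) \<subseteq> lann (x [^] N)" by blast
  have N': "z \<otimes> x [^] N = \<zero>" if z: "z \<in> carrier R" "z \<otimes> x [^] (N + m) = \<zero>" for z m
  proof -
    have "lann (x [^] N) \<subseteq> lann (x [^] (N + m))"
    proof
      fix u assume "u \<in> lann (x [^] N)"
      then have u: "u \<in> carrier R" "u \<otimes> x [^] N = \<zero>" unfolding left_annihilator_elt by auto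
      have "u \<otimes> x [^] (N + m) = (u \<otimes> x [^] N) \<otimes> x [^] m"
        using u(1) xc by (simp add: nat_pow_mult[symmetric] m_assoc)
      then show "u \<in> lann (x [^] (N + m))"
        unfolding left_annihilator_elt using u xc by simp
    qed
    from N[OF this] show ?thesis using z unfolding left_annihilator_elt by blast
  qed
  \<comment> \<open>The exponent is \<open>Suc N\<close>, not \<open>N\<close>: for \<open>N\<close>
    = 0 the power would be 1, which need not lie in \<open>I\<close>.\<close>
  let ?a = "x [^] Suc N"
  have "?a \<in> I" using left_idealD(4)[OF I(1) _ x(1)] xc by simp
  moreover have "z \<otimes> ?a = \<zero>" if z: "z \<in> carrier R" "z \<otimes> ?a \<otimes> ?a = \<zero>" for z
  proof -
    have "z \<otimes> ?a \<otimes> ?a = z \<otimes> (x [^] (Suc N + Suc N))"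
      unfolding nat_pow_mult[OF xc, symmetric] using z(1) xc by (intro m_assoc) auto
    also have "Suc N + Suc N = N + (N + 2)" by simp
    finally have "z \<otimes> x [^] N = \<zero>" using N'[of z "N + 2"] z by simp
    then have "z \<otimes> x [^] N \<otimes> x = \<zero>" using xc by simp
    then show ?thesis using z(1) xc by (simp add: m_assoc)
  qed
  ultimately show ?thesis using x(2)[of "Suc N"] by blast
qed

text \<open>The left singular ideal vanishes. Take a stable a = r x in R x. If a r is nonzero,
  essentiality gives z with z a r nonzero in \<open>E\<close>; then z a a = (z a r) x = 0, so z a =
  0, a contradiction. If a r = 0, then a a = 0 and stability gives a = 0.\<close>

lemma left_singular_zero:
  assumes sp: "semiprime_ring R" and G: "left_Goldie_ring R"
    and x: "x \<in> carrier R" and E: "left_essential R E" "\<And>z. z \<in> E \<Longrightarrow> z \<otimes> x = \<zero>"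
  shows "x = \<zero>"
proof (rule ccontr)
  assume x0: "x \<noteq> \<zero>"
  let ?I = "{r \<otimes> x | r. r \<in> carrier R}"
  have "?I \<noteq> {\<zero>}" using mem_principal[OF x] x0 by blast
  from stable_element[OF sp G left_ideal_principal[OF x] this]
  obtain a where a: "a \<in> ?I" "a \<noteq> \<zero>" "\<forall>z\<in>carrier R. z \<otimes> a \<otimes> a = \<zero> \<longrightarrow> z \<otimes> a = \<zero>" by (elim bexE conjE)
  obtain r where r: "r \<in> carrier R" "a = r \<otimes> x" using a(1) by blast
  have ac: "a \<in> carrier R" using r x by simp
  show False
  proof (cases "a \<otimes> r = \<zero>")
    case True
    have "\<one> \<otimes> a \<otimes> a = (a \<otimes> r) \<otimes> x" using r(1) x ac by (simp add: m_assoc r(2)[symmetric])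
    then have "\<one> \<otimes> a = \<zero>" using True a(3) x by simp
    then show False using a(2) ac by simp
  next
    case False
    then obtain z where z: "z \<in> carrier R" "z \<otimes> (a \<otimes> r) \<in> E" "z \<otimes> (a \<otimes> r) \<noteq> \<zero>"
      using E(1) ac r(1) unfolding left_essential_def by blast
    have "z \<otimes> a \<otimes> a = z \<otimes> (a \<otimes> r) \<otimes> x" using z(1) ac r(1) x by (simp add: m_assoc r(2)[symmetric])
    then have "z \<otimes> a = \<zero>" using E(2)[OF z(2)] a(3) z(1) by simp
    then have "z \<otimes> (a \<otimes> r) = \<zero>" using z(1) ac r(1) by (simp add: m_assoc[symmetric])
    then show False using z(3) by simp
  qed
qed

section \<open>Independent sequences and essential left ideals\<close>

lemma no_independent_sequence:
  assumes G: "left_Goldie_ring R" and I: "\<And>n::nat. left_ideal R (I n)" "\<And>n. I n \<noteq> {\<zero>}"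
    and ind: "\<And>(n::nat) f i. (\<And>i. f i \<in> I i) \<Longrightarrow> (\<Oplus>i\<in>{..n}. f i) = \<zero> \<Longrightarrow> i \<le> n \<Longrightarrow> f i = \<zero>"
  shows False
proof -
  have Ic: "x \<in> carrier R" if "x \<in> I i" for x i using left_idealD(5)[OF I(1) that] .
  \<comment> \<open>The hypothesis concerns initial segments; padding with zero extends it to all
    finite index sets.\<close>
  have ind': "f i = \<zero>" if F: "finite F" "\<And>i. i \<in> F \<Longrightarrow> f i \<in> I i" "(\<Oplus>i\<in>F. f i) = \<zero>" "i \<in> F" for F f i
  proof -
    obtain n where n: "F \<subseteq> {..n}" using F(1) unfolding finite_nat_set_iff_bounded_le by auto
    let ?f = "\<lambda>i. if i \<in> F then f i else \<zero>"
    have f: "?f i \<in> I i" for i using F(2) left_idealD(2)[OF I(1)] by simp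
    have "(\<Oplus>i\<in>F. f i) = (\<Oplus>i\<in>{..n}. ?f i)"
    proof (rule add.finprod_mono_neutral_cong_left)
      show "?f \<in> {..n} \<rightarrow> carrier R" using f Ic by blast
    qed (use n in auto)
    then have "(\<Oplus>i\<in>{..n}. ?f i) = \<zero>" using F(3) by simp
    then have "?f i = \<zero>" using ind[of ?f n i, OF f] n F(4) by blast
    then show ?thesis using F(4) by simp
  qed
  \<comment> \<open>The Goldie condition counts sets of left ideals, so the sequence must be
    injective. Otherwise x and -x in two equal terms would violate independence.\<close>
  have "I i \<noteq> I j" if ij: "i \<noteq> j" for i j
  proof
    assume eq: "I i = I j"
    obtain x where x: "x \<in> I i" "x \<noteq> \<zero>" using I(2)[of i] left_idealD(2)[OF I(1)] by blast
    let ?f = "\<lambda>k. if k = i then x else \<ominus> x"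
    have xc: "x \<in> carrier R" using Ic x by blast
    have "(\<Oplus>k\<in>{i, j}. ?f k) = \<zero>" using ij xc by (simp add: r_neg)
    moreover have "?f k \<in> I k" if "k \<in> {i, j}" for k
      using that x(1) eq left_ideal_neg[OF I(1) x(1)] by auto
    ultimately have "?f i = \<zero>" by (intro ind'[of "{i, j}" ?f i]) auto
    then show False using x by simp
  qed
  then have inj: "inj I" by (meson injI)
  have "sum_direct R (range I)"
    unfolding sum_direct_def
  proof (intro allI impI ballI)
    fix F f J
    assume A: "finite F \<and> F \<subseteq> range I \<and> (\<forall>J\<in>F. f J \<in> J) \<and> (\<Oplus>J\<in>F. f J) = \<zero>" and J: "J \<in> F"
    let ?G = "I -` F"
    have G: "I ` ?G = F" using A by blast
    have fin: "finite ?G" using finite_vimageI[OF _ inj] A by blast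
    have mem: "f (I i) \<in> I i" if "i \<in> ?G" for i using that A by auto
    have "(\<Oplus>J\<in>I ` ?G. f J) = (\<Oplus>i\<in>?G. f (I i))"
      by (rule finsum_reindex) (use mem Ic inj in \<open>auto simp: inj_on_def inj_def\<close>)
    then have "(\<Oplus>i\<in>?G. f (I i)) = \<zero>" using A unfolding G by simp
    moreover obtain i where i: "J = I i" "i \<in> ?G" using J A by blast
    ultimately show "f J = \<zero>" using ind'[of ?G "\<lambda>i. f (I i)" i, OF fin mem] by simp
  qed
  moreover have "infinite (range I)"
  proof
    assume "finite (range I)"
    then have "finite (UNIV :: nat set)" using inj by (rule finite_imageD)
    then show False by simp
  qed
  moreover have "\<forall>J\<in>range I. left_ideal R J \<and> J \<noteq> {\<zero>}" using I by simp
  moreover have "\<not> (\<exists>\<F>. infinite \<F> \<and> (\<forall>I\<in>\<F>. left_ideal R I \<and> I \<noteq> {\<zero>}) \<and> sum_direct R \<F>)"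
    using G unfolding left_Goldie_ring_def by (elim conjE)
  ultimately show False by blast
qed

text \<open>Otherwise \<open>R x\<close> misses \<open>R c\<close> and the left ideals \<open>R x c\<^sup>n\<close> form an infinite direct sum.\<close>

lemma principal_essential:
  assumes G: "left_Goldie_ring R" and c: "c \<in> carrier R"
    and inj: "\<And>x. x \<in> carrier R \<Longrightarrow> x \<otimes> c = \<zero> \<Longrightarrow> x = \<zero>"
  shows "left_essential R {r \<otimes> c | r. r \<in> carrier R}"
proof (rule ccontr)
  assume "\<not> ?thesis"
  then obtain x where x: "x \<in> carrier R" "x \<noteq> \<zero>"
    "\<And>r. r \<in> carrier R \<Longrightarrow> r \<otimes> x \<in> {r \<otimes> c | r. r \<in> carrier R} \<Longrightarrow> r \<otimes> x = \<zero>"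
    unfolding left_essential_def using left_ideal_principal[OF c] by auto
  have disj: "r \<otimes> x = \<zero>" if "r \<in> carrier R" "s \<in> carrier R" "r \<otimes> x = s \<otimes> c" for r s
    using x(3)[of r] that by blast
  \<comment> \<open>Induction splits off the term with exponent 0. The other terms share a right
    factor c, so r(0) x = -Y c lies in both R x and R c and is 0; then Y c = 0, and cancelling c
    leaves a shorter relation.\<close>
  have main: "\<forall>i\<le>n. r i \<otimes> x = \<zero>"
    if "\<And>i. r i \<in> carrier R" "(\<Oplus>i\<in>{..n}. r i \<otimes> x \<otimes> c [^] i) = \<zero>" for r and n :: nat
    using that
  proof (induction n arbitrary: r)
    case 0
    then show ?case using x(1) by simp
  next
    case (Suc n)
    let ?t = "\<lambda>i. r i \<otimes> x \<otimes> c [^] i" and ?u = "\<lambda>i. r (Suc i) \<otimes> x \<otimes> c [^] i"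
    let ?Y = "\<Oplus>i\<in>{..n}. ?u i"
    have rc: "r i \<in> carrier R" for i using Suc.prems(1) .
    have tc: "?t \<in> {..Suc n} \<rightarrow> carrier R" "?u \<in> {..n} \<rightarrow> carrier R" using rc x(1) c by auto
    have Yc: "?Y \<in> carrier R" using tc(2) by (rule finsum_closed)
    have "(\<Oplus>i\<in>{..Suc n}. ?t i) = (\<Oplus>i\<in>{..n}. ?t (Suc i)) \<oplus> ?t 0" by (rule finsum_Suc2[OF tc(1)])
    also have "(\<Oplus>i\<in>{..n}. ?t (Suc i)) = (\<Oplus>i\<in>{..n}. ?u i \<otimes> c)"
      by (rule finsum_cong') (use rc x(1) c in \<open>auto simp: m_assoc\<close>)
    also have "\<dots> = ?Y \<otimes> c" using finsum_ldistr[OF finite_atMost c tc(2)] by simp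
    finally have s: "?Y \<otimes> c \<oplus> r 0 \<otimes> x = \<zero>" using Suc.prems(2) rc x(1) by simp
    then have "\<ominus> (r 0 \<otimes> x) = ?Y \<otimes> c" using Yc c rc x(1) by (intro minus_equality) auto
    then have "\<ominus> (\<ominus> (r 0 \<otimes> x)) = \<ominus> (?Y \<otimes> c)" by simp
    then have "r 0 \<otimes> x = (\<ominus> ?Y) \<otimes> c" using Yc c rc[of 0] x(1) by (simp add: l_minus)
    then have 0: "r 0 \<otimes> x = \<zero>" using disj[OF rc[of 0], of "\<ominus> ?Y"] Yc by simp
    then have "?Y \<otimes> c = \<zero>" using s Yc c by simp
    then have "?Y = \<zero>" using inj Yc by blast
    then have IH: "\<forall>i\<le>n. r (Suc i) \<otimes> x = \<zero>" using Suc.IH[of "\<lambda>i. r (Suc i)"] rc by simp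
    show ?case
    proof (intro allI impI)
      fix i assume "i \<le> Suc n"
      then show "r i \<otimes> x = \<zero>" using 0 IH by (cases i) auto
    qed
  qed
  let ?I = "\<lambda>n::nat. {r \<otimes> (x \<otimes> c [^] n) | r. r \<in> carrier R}"
  have xn: "x \<otimes> c [^] (n::nat) \<in> carrier R" for n using x(1) c by simp
  show False
  proof (rule no_independent_sequence[OF G, of ?I])
    fix n :: nat
    show "left_ideal R (?I n)" using left_ideal_principal[OF xn] .
    show "?I n \<noteq> {\<zero>}" using mem_principal[OF xn[of n]] right_cancel_power[OF c inj x(1), of n] x(2) by blast
  next
    fix n :: nat and f i
    assume f: "\<And>i. f i \<in> ?I i" and s: "(\<Oplus>i\<in>{..n}. f i) = \<zero>" and i: "i \<le> n"
    have "\<forall>i. \<exists>r. r \<in> carrier R \<and> f i = r \<otimes> (x \<otimes> c [^] i)" using f by blast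
    then obtain r where r: "\<And>i. r i \<in> carrier R" "\<And>i. f i = r i \<otimes> (x \<otimes> c [^] i)" by metis
    have fr: "f i = r i \<otimes> x \<otimes> c [^] i" for i using r x(1) c by (simp add: m_assoc)
    have "f = (\<lambda>i. r i \<otimes> x \<otimes> c [^] i)" using fr by (rule ext)
    then have "r i \<otimes> x = \<zero>" using main[of r n, OF r(1)] s i by simp
    then show "f i = \<zero>" using fr c by simp
  qed
qed

text \<open>Multiply the relation on the right by a(k): terms above k vanish since a(i) a(k) = 0,
  terms below k vanish by induction, and r(k) a(k) a(k) = 0 remains, where stability
  applies.\<close>

lemma orthogonal_independent:
  fixes a :: "nat \<Rightarrow> 'a"
  assumes a: "\<And>i. i \<le> n \<Longrightarrow> a i \<in> carrier R"
    and stable: "\<And>i z. i \<le> n \<Longrightarrow> z \<in> carrier R \<Longrightarrow> z \<otimes> a i \<otimes> a i = \<zero> \<Longrightarrow> z \<otimes> a i = \<zero>"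
    and orth: "\<And>i j. i < j \<Longrightarrow> j \<le> n \<Longrightarrow> a j \<otimes> a i = \<zero>"
    and r: "\<And>i. r i \<in> carrier R" and s: "(\<Oplus>i\<in>{..n}. r i \<otimes> a i) = \<zero>" and k: "k \<le> n"
  shows "r k \<otimes> a k = \<zero>"
  using k
proof (induction k rule: less_induct)
  case (less k)
  have tc: "(\<lambda>i. r i \<otimes> a i) \<in> {..n} \<rightarrow> carrier R" using a r by auto
  have "\<zero> = (\<Oplus>i\<in>{..n}. r i \<otimes> a i) \<otimes> a k" using s a less.prems by simp
  also have "\<dots> = (\<Oplus>i\<in>{..n}. r i \<otimes> a i \<otimes> a k)"
    by (rule finsum_ldistr[OF finite_atMost a[OF less.prems] tc])
  also have "\<dots> = (\<Oplus>i\<in>{..n}. if k = i then r i \<otimes> a i \<otimes> a k else \<zero>)"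
  proof (rule finsum_cong')
    fix i assume i: "i \<in> {..n}"
    show "r i \<otimes> a i \<otimes> a k = (if k = i then r i \<otimes> a i \<otimes> a k else \<zero>)"
    proof (cases i k rule: linorder_cases)
      case less' : less
      then have "r i \<otimes> a i = \<zero>" using less.IH i by simp
      then show ?thesis using a less.prems less' by simp
    next
      case greater
      then have "a i \<otimes> a k = \<zero>" using orth i by simp
      then have "r i \<otimes> a i \<otimes> a k = \<zero>" using a[of i] a[of k] r i less.prems by (simp add: m_assoc)
      then show ?thesis using greater by simp
    qed simp
  qed (use a r less.prems in auto)
  also have "\<dots> = r k \<otimes> a k \<otimes> a k"
    by (rule finsum_singleton) (use a r less.prems in auto)
  finally have "r k \<otimes> a k \<otimes> a k = \<zero>" by simp
  then show ?case using stable less.prems r by simp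
qed

text \<open>Stable elements a(n) of \<open>E\<close> are chosen greedily in the common left
  annihilator \<open>L n\<close> of the earlier ones. Their principal left ideals are independent,
  so the choice ends with \<open>E \<inter> L n\<close> = 0, and then \<open>L n\<close> = 0 by
  essentiality. The sum c of the a(i) therefore has left annihilator 0, so R c is essential, and the
  vanishing of the left singular ideal handles the other side.\<close>

lemma essential_regular:
  assumes sp: "semiprime_ring R" and G: "left_Goldie_ring R" and ne: "\<one> \<noteq> \<zero>"
    and E: "left_essential R E"
  shows "\<exists>c\<in>E. c \<in> regular_elements R"
proof -
  have lE: "left_ideal R E" using E unfolding left_essential_def by blast
  define good where "good a L \<longleftrightarrow> a \<in> E \<inter> L \<and> a \<noteq> \<zero> \<and>
    (\<forall>z\<in>carrier R. z \<otimes> a \<otimes> a = \<zero> \<longrightarrow> z \<otimes> a = \<zero>)" for a L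
  define pick where "pick L = (SOME a. good a L)" for L
  have pick: "good (pick L) L" if "left_ideal R L" "E \<inter> L \<noteq> {\<zero>}" for L
    unfolding pick_def good_def
    by (rule someI_ex) (use stable_element[OF sp G left_ideal_Int[OF lE that(1)] that(2)] in blast)
  \<comment> \<open>After \<open>E \<inter> L n\<close> has become zero, \<open>pick\<close> returns
    an arbitrary element. That the \<open>L n\<close> are left ideals and the chosen elements are
    good is therefore proved only while the earlier intersections are nonzero.\<close>
  define L where "L = rec_nat (carrier R) (\<lambda>_ L. {z \<in> L. z \<otimes> pick L = \<zero>})"
  define a where "a n = pick (L n)" for n
  have L0: "L 0 = carrier R" and LS: "\<And>n. L (Suc n) = {z \<in> L n. z \<otimes> a n = \<zero>}"
    unfolding L_def a_def by auto
  have Ldec: "L n \<subseteq> L m" if "m \<le> n" for m n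
    by (rule lift_Suc_antimono_le[of L, OF _ that]) (use LS in blast)
  have Lc: "L n \<subseteq> carrier R" for n using Ldec[of 0 n] L0 by simp
  have orth0: "z \<otimes> a i = \<zero>" if "z \<in> L j" "i < j" for z i j
  proof -
    have "z \<in> L (Suc i)" using Ldec[of "Suc i" j] that by auto
    then show ?thesis unfolding LS by simp
  qed
  have LI: "z \<in> L n" if "z \<in> carrier R" "\<And>i. i < n \<Longrightarrow> z \<otimes> a i = \<zero>" for z n
    using that(2)
  proof (induction n)
    case 0 then show ?case using L0 that by simp
  next
    case (Suc n)
    then show ?case unfolding LS by simp
  qed
  have lL: "left_ideal R (L n)" and ga: "good (a m) (L m)"
    if "\<And>m. m < n \<Longrightarrow> E \<inter> L m \<noteq> {\<zero>}" "m < n" for n m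
  proof -
    have l: "left_ideal R (L k)" if "k \<le> n" for k
      using that
    proof (induction k)
      case 0
      then show ?case unfolding L0 left_ideal_iff by auto
    next
      case (Suc k)
      then have lk: "left_ideal R (L k)" by simp
      have "good (a k) (L k)" unfolding a_def by (rule pick[OF lk]) (use \<open>\<And>m. m < n \<Longrightarrow> E \<inter> L m \<noteq> {\<zero>}\<close> Suc in simp)
      then have "a k \<in> carrier R" unfolding good_def using left_idealD(5)[OF lE] by blast
      moreover have "L (Suc k) = L k \<inter> {z \<in> carrier R. z \<otimes> a k = \<zero>}" unfolding LS using Lc by blast
      ultimately show ?case using left_ideal_Int[OF lk left_ideal_annihilator_elt] by simp
    qed
    show "left_ideal R (L n)" using l by simp
    show "good (a m) (L m)" unfolding a_def using pick l[of m] that by simp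
  qed
  have "\<exists>n. E \<inter> L n = {\<zero>}"
  proof (rule ccontr)
    assume "\<not> ?thesis"
    then have neq: "E \<inter> L n \<noteq> {\<zero>}" for n by blast
    have g: "good (a n) (L n)" for n by (rule ga[of "Suc n"]) (use neq in auto)
    have ac: "a n \<in> carrier R" for n using g[of n] left_idealD(5)[OF lE] unfolding good_def by blast
    show False
    proof (rule no_independent_sequence[OF G, of "\<lambda>n. {r \<otimes> a n | r. r \<in> carrier R}"])
      fix n
      show "left_ideal R {r \<otimes> a n | r. r \<in> carrier R}" using left_ideal_principal[OF ac] .
      show "{r \<otimes> a n | r. r \<in> carrier R} \<noteq> {\<zero>}"
        using mem_principal[OF ac[of n]] g[of n] unfolding good_def by blast
    next
      fix n f i
      assume f: "\<And>i. f i \<in> {r \<otimes> a i | r. r \<in> carrier R}" and s: "(\<Oplus>i\<in>{..n}. f i) = \<zero>" and i: "i \<le> n"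
      have "\<forall>i. \<exists>r. r \<in> carrier R \<and> f i = r \<otimes> a i" using f by blast
      then obtain r where r: "\<And>i. r i \<in> carrier R" "\<And>i. f i = r i \<otimes> a i" by metis
      have "f = (\<lambda>i. r i \<otimes> a i)" using r(2) by (rule ext)
      then have s': "(\<Oplus>i\<in>{..n}. r i \<otimes> a i) = \<zero>" using s by simp
      have "r i \<otimes> a i = \<zero>"
      proof (rule orthogonal_independent[OF ac _ _ r(1) s' i])
        show "z \<otimes> a i = \<zero>" if "z \<in> carrier R" "z \<otimes> a i \<otimes> a i = \<zero>" for i z
          using g[of i] that unfolding good_def by blast
        show "a j \<otimes> a i = \<zero>" if "i < j" for i j
          using orth0[of "a j" j i] g[of j] that unfolding good_def by blast
      qed
      then show "f i = \<zero>" using r(2) by simp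
    qed
  qed
  then obtain n where n: "E \<inter> L n = {\<zero>}" "\<And>m. m < n \<Longrightarrow> E \<inter> L m \<noteq> {\<zero>}"
    using exists_least_iff[of "\<lambda>n. E \<inter> L n = {\<zero>}"] by blast
  have "n \<noteq> 0"
  proof
    assume "n = 0"
    then have "E \<subseteq> {\<zero>}" using n(1) L0 left_idealD(1)[OF lE] by blast
    then show False using E ne unfolding left_essential_def by blast
  qed
  then obtain k where k: "n = Suc k" by (cases n) auto
  have g: "good (a i) (L i)" if "i \<le> k" for i by (rule ga[of n]) (use n(2) k that in auto)
  have aE: "a i \<in> E" if "i \<le> k" for i using g[OF that] unfolding good_def by blast
  have ac: "a i \<in> carrier R" if "i \<le> k" for i using left_idealD(5)[OF lE aE[OF that]] .
  have Ln: "L n \<subseteq> {\<zero>}"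
  proof
    fix x assume x: "x \<in> L n"
    show "x \<in> {\<zero>}"
    proof (rule ccontr)
      assume "x \<notin> {\<zero>}"
      then obtain r where r: "r \<in> carrier R" "r \<otimes> x \<in> E" "r \<otimes> x \<noteq> \<zero>"
        using E x Lc[of n] unfolding left_essential_def by blast
      have "left_ideal R (L n)" by (rule lL[of n 0]) (use n k in auto)
      then have "r \<otimes> x \<in> L n" using left_idealD(4) r x by blast
      then show False using r n(1) by blast
    qed
  qed
  define c where "c = (\<Oplus>i\<in>{..k}. a i)"
  have cE: "c \<in> E" unfolding c_def by (rule left_ideal_finsum[OF lE]) (use aE in simp)
  have cc: "c \<in> carrier R" using left_idealD(5)[OF lE cE] .
  have linj: "z = \<zero>" if z: "z \<in> carrier R" "z \<otimes> c = \<zero>" for z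
  proof -
    have "(\<Oplus>i\<in>{..k}. z \<otimes> a i) = z \<otimes> c"
      unfolding c_def by (rule finsum_rdistr[symmetric]) (use z ac in auto)
    then have s: "(\<Oplus>i\<in>{..k}. z \<otimes> a i) = \<zero>" using z by simp
    have "z \<otimes> a i = \<zero>" if i: "i \<le> k" for i
    proof (rule orthogonal_independent[of k a "\<lambda>_. z", OF ac _ _ z(1) s i])
      show "z \<otimes> a i = \<zero>" if "i \<le> k" "z \<in> carrier R" "z \<otimes> a i \<otimes> a i = \<zero>" for i z
        using g[of i] that unfolding good_def by blast
      show "a j \<otimes> a i = \<zero>" if "i < j" "j \<le> k" for i j
        using orth0[of "a j" j i] g[of j] that unfolding good_def by blast
    qed
    then have "z \<in> L n" using LI[OF z(1), of n] k by simp
    then show ?thesis using Ln by blast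
  qed
  have ess: "left_essential R {r \<otimes> c | r. r \<in> carrier R}" by (rule principal_essential[OF G cc linj])
  have "x = \<zero>" if x: "x \<in> carrier R" "c \<otimes> x = \<zero>" for x
  proof (rule left_singular_zero[OF sp G x(1) ess])
    fix z assume "z \<in> {r \<otimes> c | r. r \<in> carrier R}"
    then obtain r where "r \<in> carrier R" "z = r \<otimes> c" by blast
    then show "z \<otimes> x = \<zero>" using x cc by (simp add: m_assoc)
  qed
  then have "c \<in> regular_elements R" unfolding regular_elements_def using cc linj by blast
  then show ?thesis using cE by blast
qed

text \<open>For regular s the left ideal R s is essential, and so is its preimage under right
  multiplication by r, the set of x with x r in R s. By \<open>essential_regular\<close> this
  preimage contains a regular element, which is the required t.\<close>

theorem Goldie_regular_Den_l:
  assumes sp: "semiprime_ring R" and G: "left_Goldie_ring R" and ne: "\<one> \<noteq> \<zero>"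
  shows "regular_elements R \<in> Den_l R"
proof (rule regular_elements_Den_lI[OF ne])
  let ?C = "regular_elements R"
  show "\<exists>t\<in>?C. \<exists>u\<in>carrier R. t \<otimes> r = u \<otimes> s" if r: "r \<in> carrier R" and s: "s \<in> ?C" for r s
  proof -
    note S = regular_elementsD[OF s]
    let ?P = "{q \<otimes> s | q. q \<in> carrier R}"
    let ?E = "{x \<in> carrier R. x \<otimes> r \<in> ?P}"
    have ess: "left_essential R ?P" using principal_essential[OF G S(1,3)] .
    have lP: "left_ideal R ?P" using left_ideal_principal[OF S(1)] .
    note P = left_idealD[OF lP]
    have "left_ideal R ?E"
      unfolding left_ideal_iff
    proof (intro conjI ballI)
      show "?E \<subseteq> carrier R" by blast
      show "\<zero> \<in> ?E" using P(2) r by simp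
      fix x assume x: "x \<in> ?E"
      show "x \<oplus> y \<in> ?E" if "y \<in> ?E" for y
      proof -
        have "(x \<oplus> y) \<otimes> r = x \<otimes> r \<oplus> y \<otimes> r" using x that r by (intro l_distr) auto
        moreover have "x \<otimes> r \<oplus> y \<otimes> r \<in> ?P" by (rule P(3)) (use x that in simp_all)
        moreover have "x \<oplus> y \<in> carrier R" using x that by simp
        ultimately show ?thesis by simp
      qed
      show "q \<otimes> x \<in> ?E" if q: "q \<in> carrier R" for q
      proof -
        have "(q \<otimes> x) \<otimes> r = q \<otimes> (x \<otimes> r)" using x q r by (intro m_assoc) auto
        moreover have "q \<otimes> (x \<otimes> r) \<in> ?P" by (rule P(4)) (use x q in simp_all)
        moreover have "q \<otimes> x \<in> carrier R" using x q by simp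
        ultimately show ?thesis by simp
      qed
    qed
    moreover have "\<exists>q\<in>carrier R. q \<otimes> x \<in> ?E \<and> q \<otimes> x \<noteq> \<zero>" if x: "x \<in> carrier R" "x \<noteq> \<zero>" for x
    proof (cases "x \<otimes> r = \<zero>")
      case True
      then have "\<one> \<otimes> x \<in> ?E" using x P(2) by simp
      moreover have "\<one> \<otimes> x \<noteq> \<zero>" using x by simp
      ultimately show ?thesis by blast
    next
      case False
      moreover have "x \<otimes> r \<in> carrier R" using x r by simp
      ultimately obtain q where q: "q \<in> carrier R" "q \<otimes> (x \<otimes> r) \<in> ?P" "q \<otimes> (x \<otimes> r) \<noteq> \<zero>"
        using ess unfolding left_essential_def by blast
      have e: "q \<otimes> (x \<otimes> r) = (q \<otimes> x) \<otimes> r" using q(1) x r by (simp add: m_assoc)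
      have "q \<otimes> x \<in> ?E" using q(1,2) x unfolding e by simp
      moreover have "q \<otimes> x \<noteq> \<zero>" using q(3) r unfolding e by auto
      ultimately show ?thesis using q(1) by blast
    qed
    ultimately have "left_essential R ?E" unfolding left_essential_def by blast
    then obtain c where "c \<in> ?E" "c \<in> ?C" using essential_regular[OF sp G ne] by blast
    then show ?thesis by blast
  qed
qed

end

text \<open>Take \<open>K\<close> maximal with \<open>J \<inter> K\<close> = 0. The contraction of
  \<open>J\<close> + \<open>K\<close> to \<open>R\<close> is essential, so it contains a regular
  element, which is a unit of \<open>Q\<close>; thus \<open>J\<close> + \<open>K\<close> is all of
  \<open>Q\<close> and \<open>K\<close> is a complement of \<open>J\<close>.\<close>

theorem (in left_localization) Goldie_split:
  assumes sp: "semiprime_ring R" and G: "left_Goldie_ring R" and ne: "\<one> \<noteq> \<zero>"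
    and C: "S = regular_elements R"
  shows "left_ideals_split Q"
  unfolding left_ideals_split_def
proof (intro allI impI)
  fix J assume J: "left_ideal Q J"
  let ?A = "{K. left_ideal Q K \<and> J \<inter> K \<subseteq> {\<zero>\<^bsub>Q\<^esub>}}"
  have "\<exists>K\<in>?A. \<forall>M\<in>?A. K \<subseteq> M \<longrightarrow> M = K"
  proof (rule subset_Zorn_nonempty)
    have "{\<zero>\<^bsub>Q\<^esub>} \<in> ?A" using Q.left_ideal_zero by simp
    then show "?A \<noteq> {}" by blast
    fix \<C> assume ne: "\<C> \<noteq> {}" and ch: "subset.chain ?A \<C>"
    have CA: "left_ideal Q K \<and> J \<inter> K \<subseteq> {\<zero>\<^bsub>Q\<^esub>}" if "K \<in> \<C>" for K
      using ch that unfolding subset_chain_def by blast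
    have lin: "K \<subseteq> M \<or> M \<subseteq> K" if "K \<in> \<C>" "M \<in> \<C>" for K M
      using ch that unfolding subset_chain_def by blast
    have "left_ideal Q (\<Union>\<C>)"
      by (rule Q.left_ideal_chain_Union[OF ne conjunct1[OF CA] lin])
    moreover have "J \<inter> \<Union>\<C> \<subseteq> {\<zero>\<^bsub>Q\<^esub>}" using CA by blast
    ultimately show "\<Union>\<C> \<in> ?A" by simp
  qed
  then obtain K where KA: "K \<in> ?A" and max: "\<forall>M\<in>?A. K \<subseteq> M \<longrightarrow> M = K" by (rule bexE)
  have K: "left_ideal Q K" "J \<inter> K \<subseteq> {\<zero>\<^bsub>Q\<^esub>}" using KA by simp_all
  let ?B = "left_ideal_plus Q J K"
  have B: "left_ideal Q ?B" using Q.left_ideal_plus[OF J K(1)] .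
  let ?E = "{r \<in> carrier R. \<phi> r \<in> ?B}"
  have "\<exists>r\<in>carrier R. r \<otimes> x \<in> ?E \<and> r \<otimes> x \<noteq> \<zero>" if x: "x \<in> carrier R" "x \<noteq> \<zero>" for x
  proof (rule ccontr)
    assume neg: "\<not> ?thesis"
    have z: "r \<otimes> x = \<zero>" if "r \<in> carrier R" "\<phi> (r \<otimes> x) \<in> ?B" for r using neg that x by auto
    let ?P = "{q \<star> \<phi> x | q. q \<in> carrier Q}"
    have P: "left_ideal Q ?P" using Q.left_ideal_principal x by simp
    \<comment> \<open>Clearing the denominator of q moves a common element of Q \<phi>(x) and
      \<open>J\<close> + \<open>K\<close> into the contraction, which contains no nonzero multiple
      of x. Then Q \<phi>(x) could be added to \<open>K\<close>, against maximality.\<close>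
    have PB: "p = \<zero>\<^bsub>Q\<^esub>" if p: "p \<in> ?P" "p \<in> ?B" for p
    proof -
      obtain q where q: "q \<in> carrier Q" "p = q \<star> \<phi> x" using p by blast
      obtain s r where s: "s \<in> S" "r \<in> carrier R" "\<phi> s \<star> q = \<phi> r" using frac[OF q(1)] by blast
      have e: "\<phi> s \<star> p = \<phi> (r \<otimes> x)"
        unfolding q(2) using s q(1) x by (simp add: Q.m_assoc[symmetric] phi_mult)
      have "\<phi> s \<star> p \<in> ?B" using Q.left_idealD(4)[OF B _ p(2)] s by simp
      then have "r \<otimes> x = \<zero>" using z s(2) unfolding e by blast
      then have "\<phi> s \<star> p = \<zero>\<^bsub>Q\<^esub>" using e by simp
      then show ?thesis using unit_zero s(1) q x by simp
    qed
    let ?K = "left_ideal_plus Q K ?P"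
    have K': "left_ideal Q ?K" using Q.left_ideal_plus[OF K(1) P] .
    note KK = Q.left_ideal_plus_incl[OF K(1) P]
    have "J \<inter> ?K \<subseteq> {\<zero>\<^bsub>Q\<^esub>}"
    proof
      fix j assume j: "j \<in> J \<inter> ?K"
      then obtain k p where kp: "j = k \<oplus>\<^bsub>Q\<^esub> p" "k \<in> K" "p \<in> ?P" unfolding left_ideal_plus_def by blast
      have c: "k \<in> carrier Q" "p \<in> carrier Q" "j \<in> carrier Q"
        using Q.left_idealD(5)[OF K(1) kp(2)] Q.left_idealD(5)[OF P kp(3)] Q.left_idealD(5)[OF J] j
        by blast+
      have "p = j \<oplus>\<^bsub>Q\<^esub> (\<ominus>\<^bsub>Q\<^esub> k)"
        unfolding kp(1) using Q.add_minus_cancel_left[OF c(1,2)] by (simp add: a_minus_def)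
      moreover have "\<ominus>\<^bsub>Q\<^esub> k \<in> K" using Q.left_ideal_neg[OF K(1) kp(2)] .
      ultimately have "p \<in> ?B" unfolding left_ideal_plus_def using j by blast
      then have "p = \<zero>\<^bsub>Q\<^esub>" using PB kp(3) by blast
      then have "j = k" using kp(1) c by simp
      then show "j \<in> {\<zero>\<^bsub>Q\<^esub>}" using j kp(2) K(2) by blast
    qed
    then have "?K \<in> ?A" using K' by simp
    then have "?K = K" using bspec[OF max] KK(1) by blast
    moreover have xP: "\<phi> x \<in> ?P" using Q.mem_principal x by simp
    ultimately have "\<phi> x \<in> K" using KK(2) by blast
    then have "\<phi> x \<in> ?B" using Q.left_ideal_plus_incl(2)[OF J K(1)] by blast
    then have "\<one> \<otimes> x = \<zero>" using z[of \<one>] x by simp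
    then show False using x by simp
  qed
  then have "left_essential R ?E"
    unfolding left_essential_def using left_ideal_contraction[OF B] by blast
  then obtain c where c: "c \<in> ?E" "c \<in> S" using essential_regular[OF sp G ne] C by blast
  have u: "\<phi> c \<in> Units Q" using unit[OF c(2)] .
  have "inv\<^bsub>Q\<^esub> (\<phi> c) \<star> \<phi> c \<in> ?B"
    by (rule Q.left_idealD(4)[OF B]) (use c u in simp_all)
  then have "\<one>\<^bsub>Q\<^esub> \<in> ?B" unfolding Q.Units_l_inv[OF u] .
  then show "\<exists>e\<in>J. \<forall>x\<in>J. x \<star> e = x" using Q.complement_imp_generator[OF J K] by blast
qed

section \<open>The largest strong left quotient ring\<close>

context left_localization begin

context
  assumes reg: "S \<subseteq> regular_elements R" and split: "left_ideals_split Q"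
begin

text \<open>Right cancellation is the side that left fractions make checkable: with \<phi>(s) x =
  \<phi>(r), the equation x \<phi>(c) = 0 becomes r c = 0 in \<open>R\<close>.\<close>

lemma regular_unit:
  assumes c: "c \<in> regular_elements R" shows "\<phi> c \<in> Units Q"
proof (rule Q.artinian_right_cancel_imp_unit)
  note C = regular_elementsD[OF c]
  show "left_artinian Q" by (rule Q.split_imp_artinian[OF split])
  show "\<phi> c \<in> carrier Q" using C(1) by simp
  fix x assume x: "x \<in> carrier Q" "x \<star> \<phi> c = \<zero>\<^bsub>Q\<^esub>"
  obtain s r where s: "s \<in> S" "r \<in> carrier R" "\<phi> s \<star> x = \<phi> r" using frac[OF x(1)] by blast
  have "\<phi> (r \<otimes> c) = \<phi> s \<star> (x \<star> \<phi> c)"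
    using s(1,2) x(1) C(1) by (simp add: phi_mult s(3)[symmetric] Q.m_assoc)
  also have "\<dots> = \<zero>\<^bsub>Q\<^esub>" unfolding x(2) using s(1) by simp
  finally have "r \<otimes> c = \<zero>" using phi_eq_zero[OF reg split] s(2) C(1) by simp
  then have "r = \<zero>" using C(3) s(2) by blast
  then show "x = \<zero>\<^bsub>Q\<^esub>" using unit_zero[OF s(1) x(1)] s(3) by simp
qed

text \<open>The Ore multiple is read off from a left fraction for \<phi>(r) \<phi>(c)^-1; its
  denominator lies in \<open>S\<close> and is thus regular.\<close>

lemma regular_Den_l: "regular_elements R \<in> Den_l R"
proof (rule regular_elements_Den_lI)
  let ?C = "regular_elements R"
  show "\<one> \<noteq> \<zero>" using one_S D(3) by metis
  show "\<exists>t\<in>?C. \<exists>u\<in>carrier R. t \<otimes> r = u \<otimes> c" if r: "r \<in> carrier R" and c: "c \<in> ?C" for r c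
  proof -
    have cc: "c \<in> carrier R" using regular_elementsD(1)[OF c] .
    have U: "\<phi> c \<in> Units Q" using regular_unit[OF c] .
    let ?q = "\<phi> r \<star> inv\<^bsub>Q\<^esub> (\<phi> c)"
    have qc: "?q \<in> carrier Q" using r U by simp
    obtain s u where s: "s \<in> S" "u \<in> carrier R" "\<phi> s \<star> ?q = \<phi> u" using frac[OF qc] by blast
    have "\<phi> (u \<otimes> c) = \<phi> s \<star> (\<phi> r \<star> (inv\<^bsub>Q\<^esub> (\<phi> c) \<star> \<phi> c))"
      using s(1,2) r cc U by (simp add: phi_mult s(3)[symmetric] Q.m_assoc del: Q.Units_l_inv)
    also have "\<dots> = \<phi> (s \<otimes> r)" using s(1) r U by (simp add: phi_mult)
    finally have "s \<otimes> r = u \<otimes> c" by (intro phi_inj[OF reg split]) (use s r cc in simp_all)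
    then show ?thesis using s reg by blast
  qed
qed

lemma regular_localization: "left_localization R (regular_elements R) Q \<phi>"
proof
  show "regular_elements R \<in> Den_l R" by (rule regular_Den_l)
  show "\<phi> \<in> ring_hom R Q" by (rule hom)
  show "\<phi> s \<in> Units Q" if "s \<in> regular_elements R" for s using regular_unit[OF that] .
  show "\<phi> r = \<zero>\<^bsub>Q\<^esub> \<longleftrightarrow> (\<exists>s\<in>regular_elements R. s \<otimes> r = \<zero>)" if r: "r \<in> carrier R" for r
  proof
    assume "\<phi> r = \<zero>\<^bsub>Q\<^esub>"
    then have "r = \<zero>" using phi_eq_zero[OF reg split r] by simp
    then show "\<exists>s\<in>regular_elements R. s \<otimes> r = \<zero>" using one_regular by (intro bexI[of _ \<one>]) simp_all
  next
    assume "\<exists>s\<in>regular_elements R. s \<otimes> r = \<zero>"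
    then have "r = \<zero>" using regular_elementsD(2) r by blast
    then show "\<phi> r = \<zero>\<^bsub>Q\<^esub>" by simp
  qed
  show "\<exists>s\<in>regular_elements R. \<exists>r\<in>carrier R. \<phi> s \<star> q = \<phi> r" if "q \<in> carrier Q" for q
    using frac[OF that] reg by blast
qed

text \<open>Choose s in \<open>E\<close> with Q \<phi>(s) minimal. If t r = 0 with t in
  \<open>E\<close>, take u s = v t in \<open>E\<close>; then Q \<phi>(u s) = Q \<phi>(s), so
  \<phi>(s) is a left multiple of \<phi>(v t), and s r = 0. The chain condition is that of
  \<open>Q\<close>, although \<open>E\<close> may contain zero divisors of \<open>R\<close>.\<close>

lemma uniform_annihilator:
  assumes E: "E \<in> Den_l R"
  shows "\<exists>s\<in>E. \<forall>r\<in>left_ass R E. s \<otimes> r = \<zero>"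
proof -
  interpret E: left_denominator R E by standard (rule E)
  let ?P = "\<lambda>t. {q \<star> \<phi> t | q. q \<in> carrier Q}"
  have "?P ` E \<noteq> {}" using E.one_S by blast
  moreover have "left_ideal Q I" if "I \<in> ?P ` E" for I
    using that Q.left_ideal_principal[OF phi_closed[OF E.S_carrier]] by auto
  ultimately have "\<exists>M\<in>?P ` E. \<forall>J\<in>?P ` E. J \<subseteq> M \<longrightarrow> J = M"
    by (rule Q.artinian_minimal[OF Q.split_imp_artinian[OF split]])
  then obtain s where s: "s \<in> E" and min: "\<forall>J\<in>?P ` E. J \<subseteq> ?P s \<longrightarrow> J = ?P s" by (elim bexE imageE) simp
  have "s \<otimes> r = \<zero>" if r: "r \<in> left_ass R E" for r
  proof -
    obtain t where t: "t \<in> E" "t \<otimes> r = \<zero>" "r \<in> carrier R" using r unfolding left_ass_def by blast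
    obtain u v where uv: "u \<in> E" "v \<in> carrier R" "u \<otimes> s = v \<otimes> t" "u \<otimes> s \<in> E"
      using E.common_S[OF s t(1)] .
    have "?P (u \<otimes> s) \<subseteq> ?P s"
    proof
      fix x assume "x \<in> ?P (u \<otimes> s)"
      then obtain q where q: "q \<in> carrier Q" "x = q \<star> \<phi> (u \<otimes> s)" by blast
      have "x = (q \<star> \<phi> u) \<star> \<phi> s"
        unfolding q(2) using q(1) uv(1) s by (simp add: phi_mult Q.m_assoc)
      moreover have "q \<star> \<phi> u \<in> carrier Q" using q(1) uv(1) by simp
      ultimately show "x \<in> ?P s" by blast
    qed
    moreover have "?P (u \<otimes> s) \<in> ?P ` E" using uv(4) by (rule imageI)
    ultimately have "?P (u \<otimes> s) = ?P s" using bspec[OF min] by simp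
    moreover have "\<phi> s \<in> ?P s" by (rule Q.mem_principal) (use s in simp)
    ultimately have "\<phi> s \<in> ?P (u \<otimes> s)" by simp
    then obtain q where q: "q \<in> carrier Q" "\<phi> s = q \<star> \<phi> (u \<otimes> s)" by blast
    have "\<phi> (s \<otimes> r) = q \<star> \<phi> (u \<otimes> s) \<star> \<phi> r"
      using phi_mult[of s r] s t(3) q(2) by simp
    also have "\<dots> = q \<star> \<phi> (v \<otimes> (t \<otimes> r))"
      unfolding uv(3) using q(1) uv(2) t(1,3) by (simp add: phi_mult Q.m_assoc)
    also have "\<dots> = \<zero>\<^bsub>Q\<^esub>" unfolding t(2) using q(1) uv(2) by simp
    finally show ?thesis using phi_eq_zero[OF reg split] s t(3) by simp
  qed
  then show ?thesis using s by blast
qed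

end

end

section \<open>Regularity modulo \<open>left_ass\<close>\<close>

context ring begin

lemma left_ass_ideal:
  assumes "S \<in> Den_l R" shows "ideal (left_ass R S) R"
proof (rule left_ideal_imp_ideal)
  interpret left_denominator R S by standard (rule assms)
  show "left_ideal R (left_ass R S)"
    unfolding left_ideal_iff
  proof (intro conjI ballI)
    show "left_ass R S \<subseteq> carrier R" unfolding left_ass_def by blast
    have "\<one> \<otimes> \<zero> = \<zero>" by simp
    then show "\<zero> \<in> left_ass R S" unfolding left_ass_def using one_S by blast
    fix x assume "x \<in> left_ass R S"
    then obtain s where x: "x \<in> carrier R" "s \<in> S" "s \<otimes> x = \<zero>" unfolding left_ass_def by blast
    {
      fix y assume "y \<in> left_ass R S"
      then obtain t where y: "y \<in> carrier R" "t \<in> S" "t \<otimes> y = \<zero>" unfolding left_ass_def by blast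
      obtain u v where uv: "u \<in> S" "v \<in> carrier R" "u \<otimes> s = v \<otimes> t" "u \<otimes> s \<in> S"
        using common_S[OF x(2) y(2)] .
      have "(u \<otimes> s) \<otimes> (x \<oplus> y) = u \<otimes> (s \<otimes> x) \<oplus> v \<otimes> (t \<otimes> y)"
      proof -
        have "(u \<otimes> s) \<otimes> (x \<oplus> y) = (u \<otimes> s) \<otimes> x \<oplus> (v \<otimes> t) \<otimes> y"
          unfolding uv(3)[symmetric] using uv(1) x y by (intro r_distr) auto
        then show ?thesis using uv(1,2) x(1,2) y(1,2) by (simp add: m_assoc)
      qed
      also have "\<dots> = \<zero>" unfolding x(3) y(3) using uv(1,2) by simp
      finally show "x \<oplus> y \<in> left_ass R S" unfolding left_ass_def using x(1) y(1) uv(4) by blast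
    }
    fix r assume r: "r \<in> carrier R"
    obtain t u where tu: "t \<in> S" "u \<in> carrier R" "t \<otimes> r = u \<otimes> s" using ore[OF r x(2)] .
    have "t \<otimes> (r \<otimes> x) = (t \<otimes> r) \<otimes> x" using tu(1) r x(1) by (simp add: m_assoc)
    also have "\<dots> = u \<otimes> (s \<otimes> x)" unfolding tu(3) using tu(2) x(1,2) by (simp add: m_assoc)
    also have "\<dots> = \<zero>" unfolding x(3) using tu(2) by simp
    finally show "r \<otimes> x \<in> left_ass R S" unfolding left_ass_def using tu(1) r x(1) by blast
  qed
  show "x \<otimes> r \<in> left_ass R S" if x: "x \<in> left_ass R S" and r: "r \<in> carrier R" for x r
  proof -
    obtain s where s: "x \<in> carrier R" "s \<in> S" "s \<otimes> x = \<zero>" using x unfolding left_ass_def by blast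
    then have "s \<otimes> (x \<otimes> r) = \<zero>" using r by (simp add: m_assoc[symmetric])
    then show ?thesis unfolding left_ass_def using s r by blast
  qed
qed

text \<open>Both directions apply \<open>semiprime_elt\<close> to a product: (y x) r (y x) contains
  (x r) y, and (x y) r (x y) contains y (r x), where x r and r x are again in the ideal.\<close>

lemma semiprime_annihilator_swap:
  assumes sp: "semiprime_ring R" and b: "ideal b R" and y: "y \<in> carrier R"
  shows "(\<forall>x\<in>b. x \<otimes> y = \<zero>) \<longleftrightarrow> (\<forall>x\<in>b. y \<otimes> x = \<zero>)"
proof (intro iffI ballI)
  fix x assume x: "x \<in> b"
  have xc: "x \<in> carrier R" using ideal.Icarr[OF b x] .
  {
    assume A: "\<forall>x\<in>b. x \<otimes> y = \<zero>"
    show "y \<otimes> x = \<zero>"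
    proof (rule semiprime_elt[OF sp])
      show "y \<otimes> x \<in> carrier R" using xc y by simp
      fix r assume r: "r \<in> carrier R"
      have "x \<otimes> r \<in> b" using ideal.I_r_closed[OF b x r] .
      then have "(x \<otimes> r) \<otimes> y = \<zero>" using A by blast
      then have "y \<otimes> ((x \<otimes> r) \<otimes> y) \<otimes> x = \<zero>" using xc y by simp
      then show "y \<otimes> x \<otimes> r \<otimes> (y \<otimes> x) = \<zero>" using xc y r by (simp add: m_assoc)
    qed
  }
  {
    assume A: "\<forall>x\<in>b. y \<otimes> x = \<zero>"
    show "x \<otimes> y = \<zero>"
    proof (rule semiprime_elt[OF sp])
      show "x \<otimes> y \<in> carrier R" using xc y by simp
      fix r assume r: "r \<in> carrier R"
      have "r \<otimes> x \<in> b" using ideal.I_l_closed[OF b x r] .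
      then have "y \<otimes> (r \<otimes> x) = \<zero>" using A by blast
      then have "x \<otimes> (y \<otimes> (r \<otimes> x)) \<otimes> y = \<zero>" using xc y by simp
      then show "x \<otimes> y \<otimes> r \<otimes> (x \<otimes> y) = \<zero>" using xc y r by (simp add: m_assoc)
    qed
  }
qed

text \<open>The ideal \<open>left_ass R E\<close> is the right annihilator of b, and by
  \<open>semiprime_annihilator_swap\<close> also its left annihilator. The first description suits y
  c, where c is cancelled from (x y) c; the second suits c y, where c is cancelled from c (y
  x).\<close>

lemma regular_mod_left_ass:
  assumes sp: "semiprime_ring R" and E: "E \<in> Den_l R"
    and s: "s \<in> E" "\<forall>r\<in>left_ass R E. s \<otimes> r = \<zero>"
    and c: "c \<in> regular_elements R" and y: "y \<in> carrier R"
  shows "c \<otimes> y \<in> left_ass R E \<Longrightarrow> y \<in> left_ass R E" "y \<otimes> c \<in> left_ass R E \<Longrightarrow> y \<in> left_ass R E"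
proof -
  let ?a = "left_ass R E"
  note C = regular_elementsD[OF c]
  have a: "ideal ?a R" using left_ass_ideal[OF E] .
  have ac: "x \<in> carrier R" if "x \<in> ?a" for x using that unfolding left_ass_def by blast
  define b where "b = left_annihilator R ?a"
  have b: "ideal b R" unfolding b_def by (rule left_annihilator_ideal[OF ideal_imp_left_ideal[OF a]])
  note b_def = b_def[unfolded left_annihilator_def]
  have bc: "x \<in> carrier R" if "x \<in> b" for x using that unfolding b_def by blast
  \<comment> \<open>The uniform annihilator s makes b large enough to recover
    \<open>left_ass R E\<close> as its annihilator.\<close>
  have sb: "s \<in> b" unfolding b_def using s Den_lD(7)[OF E] by simp
  have a_iff: "z \<in> ?a \<longleftrightarrow> (\<forall>x\<in>b. x \<otimes> z = \<zero>)" if z: "z \<in> carrier R" for z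
  proof
    show "\<forall>x\<in>b. x \<otimes> z = \<zero>" if "z \<in> ?a" using that unfolding b_def by blast
    assume "\<forall>x\<in>b. x \<otimes> z = \<zero>"
    then have "s \<otimes> z = \<zero>" using sb by blast
    then show "z \<in> ?a" unfolding left_ass_def using z s(1) by blast
  qed
  have a_iff': "z \<in> ?a \<longleftrightarrow> (\<forall>x\<in>b. z \<otimes> x = \<zero>)" if z: "z \<in> carrier R" for z
    using a_iff[OF z] semiprime_annihilator_swap[OF sp b z] by simp
  show "y \<in> ?a" if cy: "c \<otimes> y \<in> ?a"
  proof -
    have "y \<otimes> x = \<zero>" if x: "x \<in> b" for x
    proof -
      have "(c \<otimes> y) \<otimes> x = \<zero>" using a_iff'[of "c \<otimes> y"] cy x C(1) y by blast
      then have "c \<otimes> (y \<otimes> x) = \<zero>" using C(1) y bc[OF x] by (simp add: m_assoc)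
      then show ?thesis using C(2) y bc[OF x] by simp
    qed
    then show ?thesis using a_iff'[OF y] by blast
  qed
  show "y \<in> ?a" if yc: "y \<otimes> c \<in> ?a"
  proof -
    have "x \<otimes> y = \<zero>" if x: "x \<in> b" for x
    proof -
      have "x \<otimes> (y \<otimes> c) = \<zero>" using a_iff[of "y \<otimes> c"] yc x C(1) y by blast
      then have "(x \<otimes> y) \<otimes> c = \<zero>" using C(1) y bc[OF x] by (simp add: m_assoc)
      then show ?thesis using C(3) y bc[OF x] by simp
    qed
    then show ?thesis using a_iff[OF y] by blast
  qed
qed

lemma denominator_mod_left_ass:
  assumes E: "E \<in> Den_l R" and c: "c \<in> E" and y: "y \<in> carrier R"
  shows "c \<otimes> y \<in> left_ass R E \<Longrightarrow> y \<in> left_ass R E" "y \<otimes> c \<in> left_ass R E \<Longrightarrow> y \<in> left_ass R E"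
proof -
  interpret left_denominator R E by standard (rule E)
  show "y \<in> left_ass R E" if cy: "c \<otimes> y \<in> left_ass R E"
  proof -
    obtain t where t: "t \<in> E" "t \<otimes> (c \<otimes> y) = \<zero>" using cy unfolding left_ass_def by blast
    then have "(t \<otimes> c) \<otimes> y = \<zero>" using c y by (simp add: m_assoc)
    moreover have "t \<otimes> c \<in> E" using t c by simp
    ultimately show ?thesis unfolding left_ass_def using y by blast
  qed
  show "y \<in> left_ass R E" if yc: "y \<otimes> c \<in> left_ass R E"
  proof -
    obtain t where t: "t \<in> E" "t \<otimes> (y \<otimes> c) = \<zero>" using yc unfolding left_ass_def by blast
    then have "(t \<otimes> y) \<otimes> c = \<zero>" using c y by (simp add: m_assoc)
    then obtain u where u: "u \<in> E" "u \<otimes> (t \<otimes> y) = \<zero>" using D(6)[of "t \<otimes> y" c] c t y by auto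
    then have "(u \<otimes> t) \<otimes> y = \<zero>" using t y by (simp add: m_assoc)
    moreover have "u \<otimes> t \<in> E" using t u by simp
    ultimately show ?thesis unfolding left_ass_def using y by blast
  qed
qed

lemma one_notin_left_ass:
  assumes E: "E \<in> Den_l R" shows "\<one> \<notin> left_ass R E"
proof
  assume "\<one> \<in> left_ass R E"
  then obtain t where t: "t \<in> E" "t \<otimes> \<one> = \<zero>" unfolding left_ass_def by blast
  then show False using Den_lD(3,7)[OF E] by simp
qed

end

text \<open>Both \<open>C\<close> and a maximal denominator set \<open>E\<close> act regularly modulo \<open>left_ass R E\<close>, so the monoid
  they generate does not contain 0 and is a denominator set; maximality puts \<open>C\<close> inside \<open>E\<close>.\<close>

lemma (in left_localization) regular_subset_T_l:
  assumes S: "S = regular_elements R" and split: "left_ideals_split Q"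
  shows "regular_elements R \<subseteq> T_l R"
proof (rule T_l_upper)
  let ?C = "regular_elements R"
  show C: "?C \<in> Den_l R" using Den S by simp
  show "?C \<subseteq> strong_L R"
    unfolding strong_L_def
  proof (rule Inter_greatest)
    fix E assume "E \<in> max_Den_l R"
    then have E: "E \<in> Den_l R" and max: "\<forall>E'\<in>Den_l R. E \<subseteq> E' \<longrightarrow> E' = E"
      unfolding max_Den_l_def by simp_all
    let ?a = "left_ass R E"
    have reg: "S \<subseteq> ?C" using S by simp
    have sp: "semiprime_ring R" using order_semiprime[OF reg split] .
    obtain s where s: "s \<in> E" "\<forall>r\<in>?a. s \<otimes> r = \<zero>" using uniform_annihilator[OF reg split E] by blast
    \<comment> \<open>The elements that become regular modulo \<open>left_ass R E\<close>, described
      without forming the quotient ring.\<close>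
    define M where "M = {m \<in> carrier R. \<forall>y\<in>carrier R. (m \<otimes> y \<in> ?a \<longrightarrow> y \<in> ?a) \<and> (y \<otimes> m \<in> ?a \<longrightarrow> y \<in> ?a)}"
    have MD: "m \<in> carrier R" "y \<in> carrier R \<Longrightarrow> m \<otimes> y \<in> ?a \<Longrightarrow> y \<in> ?a"
      "y \<in> carrier R \<Longrightarrow> y \<otimes> m \<in> ?a \<Longrightarrow> y \<in> ?a" if "m \<in> M" for m y using that unfolding M_def by blast+
    have CM: "?C \<subseteq> M"
    proof
      fix c assume c: "c \<in> ?C"
      have "c \<in> carrier R" using regular_elementsD(1)[OF c] .
      then show "c \<in> M" unfolding M_def
        by (intro CollectI conjI ballI impI) (assumption | erule regular_mod_left_ass[OF sp E s c, rotated])+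
    qed
    have EM: "E \<subseteq> M"
    proof
      fix c assume c: "c \<in> E"
      have "c \<in> carrier R" using Den_lD(7)[OF E c] .
      then show "c \<in> M" unfolding M_def
        by (intro CollectI conjI ballI impI) (assumption | erule denominator_mod_left_ass[OF E c, rotated])+
    qed
    have mul: "m \<otimes> n \<in> M" if m: "m \<in> M" and n: "n \<in> M" for m n
    proof -
      have c: "m \<in> carrier R" "n \<in> carrier R" using m n MD(1) by simp_all
      show ?thesis unfolding M_def
      proof (intro CollectI conjI ballI impI)
        show "m \<otimes> n \<in> carrier R" using c by simp
        fix y assume y: "y \<in> carrier R"
        show "y \<in> ?a" if "(m \<otimes> n) \<otimes> y \<in> ?a"
        proof -
          have "m \<otimes> (n \<otimes> y) \<in> ?a" using that unfolding m_assoc[OF c y] .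
          then have "n \<otimes> y \<in> ?a" by (rule MD(2)[OF m m_closed[OF c(2) y]])
          then show ?thesis by (rule MD(2)[OF n y])
        qed
        show "y \<in> ?a" if "y \<otimes> (m \<otimes> n) \<in> ?a"
        proof -
          have "(y \<otimes> m) \<otimes> n \<in> ?a" using that unfolding m_assoc[OF y c] .
          then have "y \<otimes> m \<in> ?a" by (rule MD(3)[OF n m_closed[OF y c(1)]])
          then show ?thesis by (rule MD(3)[OF m y])
        qed
      qed
    qed
    have z: "\<zero> \<notin> M"
    proof
      assume "\<zero> \<in> M"
      moreover have "\<zero> \<otimes> \<one> \<in> ?a"
        using additive_subgroup.zero_closed[OF ideal.axioms(1)[OF left_ass_ideal[OF E]]] by simp
      ultimately have "\<one> \<in> ?a" using MD(2) by blast
      then show False using one_notin_left_ass[OF E] by simp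
    qed
    have oneM: "\<one> \<in> M" unfolding M_def by simp
    let ?G = "gen_monoid R (\<Union>{?C, E})"
    have GM: "?G \<subseteq> M" by (rule gen_monoid_subset) (use CM EM oneM mul in auto)
    have GD: "?G \<in> Den_l R" by (rule gen_monoid_Den_l) (use C E GM z in auto)
    have "\<Union>{?C, E} \<subseteq> ?G"
      by (rule gen_monoid_incl) (use Den_lD(1)[OF C] Den_lD(1)[OF E] in auto)
    then have sub: "?C \<subseteq> ?G" "E \<subseteq> ?G" by auto
    then have "?G = E" using max GD by simp
    then show "?C \<subseteq> E" using sub(1) by simp
  qed
qed

text \<open>Models the projection of \<open>R\<close> onto its quotient by
  \<open>left_ass R T\<close> as a surjective homomorphism with that kernel, so the arguments do not
  handle cosets.\<close>

locale denominator_quotient = left_denominator R T + A: ring A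
  for R (structure) and T and A +
  fixes \<pi>
  assumes hom: "\<pi> \<in> ring_hom R A" and surj: "\<pi> ` carrier R = carrier A"
    and ker: "r \<in> carrier R \<Longrightarrow> \<pi> r = \<zero>\<^bsub>A\<^esub> \<longleftrightarrow> (\<exists>t\<in>T. t \<otimes> r = \<zero>)"
begin

abbreviation mult_A (infixl "\<star>" 70) where "x \<star> y \<equiv> x \<otimes>\<^bsub>A\<^esub> y"

lemma pi_closed [simp]: "r \<in> carrier R \<Longrightarrow> \<pi> r \<in> carrier A"
  by (rule ring_hom_closed[OF hom])

lemma pi_mult: "r \<in> carrier R \<Longrightarrow> s \<in> carrier R \<Longrightarrow> \<pi> (r \<otimes> s) = \<pi> r \<star> \<pi> s"
  by (rule ring_hom_mult[OF hom])

lemma pi_one [simp]: "\<pi> \<one> = \<one>\<^bsub>A\<^esub>"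
  by (rule ring_hom_one[OF hom])

lemma pi_zero [simp]: "\<pi> \<zero> = \<zero>\<^bsub>A\<^esub>"
  using ring_hom_zero[OF hom ring_axioms A.ring_axioms] .

lemma pi_eq:
  assumes "a \<in> carrier R" "b \<in> carrier R" "\<pi> a = \<pi> b"
  shows "\<exists>t\<in>T. t \<otimes> a = t \<otimes> b"
proof -
  have "\<pi> (a \<ominus> b) \<oplus>\<^bsub>A\<^esub> \<pi> b = \<pi> a"
    using assms(1,2) by (simp add: ring_hom_add[OF hom, symmetric]) (simp add: a_minus_def a_assoc l_neg)
  then have "\<pi> (a \<ominus> b) \<oplus>\<^bsub>A\<^esub> \<pi> a = \<pi> a" using assms(3) by simp
  then have "\<pi> (a \<ominus> b) = \<zero>\<^bsub>A\<^esub>" using assms(1,2) by (simp add: A.add.r_cancel_one)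
  then obtain t where t: "t \<in> T" "t \<otimes> (a \<ominus> b) = \<zero>" using ker[of "a \<ominus> b"] assms(1,2) by auto
  then have "t \<otimes> a = t \<otimes> b" using mult_minus_eq_zero_iff assms(1,2) by simp
  then show ?thesis using t(1) by blast
qed

lemma lift:
  assumes "x \<in> carrier A" obtains r where "r \<in> carrier R" "x = \<pi> r"
  using assms unfolding surj[symmetric] by blast

text \<open>Vanishing in \<open>A\<close> lifts to \<open>R\<close> up to a left factor from
  \<open>T\<close>, and \<open>T \<subseteq> S\<close> keeps that factor inside \<open>S\<close>; in
  particular the image avoids 0.\<close>

lemma image_Den_l:
  assumes S: "S \<in> Den_l R" and TS: "T \<subseteq> S"
  shows "\<pi> ` S \<in> Den_l A"
  unfolding A.Den_l_iff
proof (intro conjI ballI impI)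
  note SD = Den_lD[OF S]
  show "\<pi> ` S \<subseteq> carrier A" using SD(7) by auto
  have "\<pi> \<one> \<in> \<pi> ` S" using SD(2) by (rule imageI)
  then show "\<one>\<^bsub>A\<^esub> \<in> \<pi> ` S" by simp
  show "\<zero>\<^bsub>A\<^esub> \<notin> \<pi> ` S"
  proof
    assume "\<zero>\<^bsub>A\<^esub> \<in> \<pi> ` S"
    then obtain s where s: "s \<in> S" "\<pi> s = \<zero>\<^bsub>A\<^esub>" by (metis imageE)
    then obtain t where "t \<in> T" "t \<otimes> s = \<zero>" using ker[OF SD(7)[OF s(1)]] by blast
    then show False using SD(3) SD(4)[of t s] s(1) TS by auto
  qed
  fix y assume "y \<in> \<pi> ` S"
  then obtain s where s: "s \<in> S" "y = \<pi> s" by blast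
  show "x \<star> y \<in> \<pi> ` S" if "x \<in> \<pi> ` S" for x
  proof -
    obtain t where t: "t \<in> S" "x = \<pi> t" using \<open>x \<in> \<pi> ` S\<close> by blast
    have "x \<star> y = \<pi> (t \<otimes> s)" using s t SD(7) by (simp add: pi_mult)
    then show ?thesis using SD(4) s t by blast
  qed
  fix x assume "x \<in> carrier A"
  then obtain r where r: "r \<in> carrier R" "x = \<pi> r" by (rule lift)
  have sc: "s \<in> carrier R" using SD(7) s by blast
  show "\<exists>t\<in>\<pi> ` S. \<exists>u\<in>carrier A. t \<star> x = u \<star> y"
  proof -
    obtain t u where tu: "t \<in> S" "u \<in> carrier R" "t \<otimes> r = u \<otimes> s" using SD(5)[OF r(1) s(1)] by blast
    have "\<pi> t \<star> \<pi> r = \<pi> u \<star> \<pi> s"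
      using pi_mult[of t r] pi_mult[of u s] tu SD(7) r(1) sc by simp
    then show ?thesis using tu pi_closed r(2) s(2) by blast
  qed
  assume "x \<star> y = \<zero>\<^bsub>A\<^esub>"
  then have "\<pi> (r \<otimes> s) = \<zero>\<^bsub>A\<^esub>" using r s sc by (simp add: pi_mult)
  then obtain t where t: "t \<in> T" "t \<otimes> (r \<otimes> s) = \<zero>" using ker[of "r \<otimes> s"] r sc by auto
  have "(t \<otimes> r) \<otimes> s = \<zero>" using t r(1) sc by (simp add: m_assoc)
  then obtain u where u: "u \<in> S" "u \<otimes> (t \<otimes> r) = \<zero>" using SD(6)[of "t \<otimes> r" s] s(1) t(1) r(1) by auto
  have "\<pi> (u \<otimes> t) \<star> x = \<pi> (u \<otimes> (t \<otimes> r))"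
    using r u(1) t(1) SD(7) by (simp add: pi_mult A.m_assoc)
  also have "\<dots> = \<zero>\<^bsub>A\<^esub>" unfolding u(2) by simp
  finally have "\<pi> (u \<otimes> t) \<star> x = \<zero>\<^bsub>A\<^esub>" .
  moreover have "u \<otimes> t \<in> S" using SD(4) u(1) t(1) TS by blast
  ultimately show "\<exists>t\<in>\<pi> ` S. t \<star> x = \<zero>\<^bsub>A\<^esub>" by blast
qed

text \<open>An equation over \<open>A\<close> lifts to \<open>R\<close> after multiplication by some
  t in \<open>T\<close>; since \<pi> maps \<open>T\<close> into \<open>U\<close>, this t can be
  absorbed into the preimage.\<close>

lemma vimage_Den_l:
  assumes U: "U \<in> Den_l A" and TU: "\<pi> ` T \<subseteq> U"
  shows "{r \<in> carrier R. \<pi> r \<in> U} \<in> Den_l R" (is "?V \<in> _")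
  unfolding Den_l_iff
proof (intro conjI ballI impI)
  note UD = A.Den_lD[OF U]
  have TV: "T \<subseteq> ?V" using TU by auto
  have mul: "x \<otimes> y \<in> ?V" if "x \<in> ?V" "y \<in> ?V" for x y using that UD(4) by (simp add: pi_mult)
  show "?V \<subseteq> carrier R" by blast
  show "\<one> \<in> ?V" using UD(2) by simp
  show "\<zero> \<notin> ?V" using UD(3) by simp
  fix s assume s: "s \<in> ?V"
  show "x \<otimes> s \<in> ?V" if "x \<in> ?V" for x using mul that s by blast
  fix r assume r: "r \<in> carrier R"
  have sc: "s \<in> carrier R" "\<pi> s \<in> U" using s by auto
  show "\<exists>t\<in>?V. \<exists>u\<in>carrier R. t \<otimes> r = u \<otimes> s"
  proof -
    obtain u w where u: "u \<in> U" "w \<in> carrier A" "u \<star> \<pi> r = w \<star> \<pi> s"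
      using UD(5)[OF pi_closed[OF r] sc(2)] by blast
    obtain u0 where u0: "u0 \<in> carrier R" "u = \<pi> u0" using lift[OF UD(7)[OF u(1)]] .
    obtain w0 where w0: "w0 \<in> carrier R" "w = \<pi> w0" using lift[OF u(2)] .
    have "\<pi> (u0 \<otimes> r) = \<pi> (w0 \<otimes> s)" using u(3) u0 w0 r sc(1) by (simp add: pi_mult)
    then obtain t where t: "t \<in> T" "t \<otimes> (u0 \<otimes> r) = t \<otimes> (w0 \<otimes> s)"
      using pi_eq[of "u0 \<otimes> r" "w0 \<otimes> s"] u0 w0 r sc(1) by auto
    have "(t \<otimes> u0) \<otimes> r = (t \<otimes> w0) \<otimes> s" using t u0(1) w0(1) r sc(1) by (simp add: m_assoc)
    moreover have "t \<otimes> u0 \<in> ?V" by (rule mul) (use TV t(1) u0 u(1) in auto)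
    moreover have "t \<otimes> w0 \<in> carrier R" using t(1) w0(1) by simp
    ultimately show ?thesis by blast
  qed
  assume rs: "r \<otimes> s = \<zero>"
  have "\<pi> r \<star> \<pi> s = \<zero>\<^bsub>A\<^esub>" using pi_mult[OF r sc(1)] rs by simp
  then obtain u where u: "u \<in> U" "u \<star> \<pi> r = \<zero>\<^bsub>A\<^esub>" using UD(6)[OF pi_closed[OF r] sc(2)] by blast
  obtain u0 where u0: "u0 \<in> carrier R" "u = \<pi> u0" using lift[OF UD(7)[OF u(1)]] .
  have "\<pi> (u0 \<otimes> r) = \<zero>\<^bsub>A\<^esub>" using u(2) u0 r by (simp add: pi_mult)
  then obtain t where t: "t \<in> T" "t \<otimes> (u0 \<otimes> r) = \<zero>" using ker[of "u0 \<otimes> r"] u0(1) r by auto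
  have "(t \<otimes> u0) \<otimes> r = \<zero>" using t u0(1) r by (simp add: m_assoc)
  moreover have "t \<otimes> u0 \<in> ?V" by (rule mul) (use TV t(1) u0 u(1) in auto)
  ultimately show "\<exists>t\<in>?V. t \<otimes> r = \<zero>" by blast
qed

lemma image_regular: "\<pi> ` T \<subseteq> regular_elements A"
proof
  have iT: "\<pi> ` T \<in> Den_l A" using image_Den_l[OF Den] by simp
  fix c assume c: "c \<in> \<pi> ` T"
  then obtain t where t: "t \<in> T" "c = \<pi> t" by blast
  have 1: "x = \<zero>\<^bsub>A\<^esub>" if x: "x \<in> carrier A" "\<pi> t' \<star> x = \<zero>\<^bsub>A\<^esub>" "t' \<in> T" for x t'
  proof -
    obtain r where r: "r \<in> carrier R" "x = \<pi> r" using lift[OF x(1)] .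
    have "\<pi> (t' \<otimes> r) = \<zero>\<^bsub>A\<^esub>" using x r by (simp add: pi_mult)
    then obtain u where u: "u \<in> T" "u \<otimes> (t' \<otimes> r) = \<zero>" using ker[of "t' \<otimes> r"] x(3) r(1) by auto
    then have "(u \<otimes> t') \<otimes> r = \<zero>" using x(3) r(1) by (simp add: m_assoc)
    moreover have "u \<otimes> t' \<in> T" using u(1) x(3) by simp
    ultimately show ?thesis using ker[OF r(1)] r(2) by blast
  qed
  have 2: "x = \<zero>\<^bsub>A\<^esub>" if x: "x \<in> carrier A" "x \<star> c = \<zero>\<^bsub>A\<^esub>" for x
  proof -
    obtain u where u: "u \<in> \<pi> ` T" "u \<star> x = \<zero>\<^bsub>A\<^esub>" using A.Den_lD(6)[OF iT x(1) c x(2)] by blast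
    then show ?thesis using 1 x(1) by blast
  qed
  show "c \<in> regular_elements A"
    unfolding regular_elements_def
  proof (intro CollectI conjI ballI impI)
    show "c \<in> carrier A" using t by simp
    fix x assume x: "x \<in> carrier A"
    show "x = \<zero>\<^bsub>A\<^esub>" if "c \<star> x = \<zero>\<^bsub>A\<^esub>" using 1[OF x _ t(1)] that t(2) by simp
    show "x = \<zero>\<^bsub>A\<^esub>" if "x \<star> c = \<zero>\<^bsub>A\<^esub>" using 2[OF x that] .
  qed
qed

text \<open>Dividing out the kernel first does not change the localization: the image of
  \<open>T\<close> is regular in \<open>A\<close>, so no further elements die.\<close>

lemma localization_comp:
  assumes "left_localization A (\<pi> ` T) Q \<phi>"
  shows "left_localization R T Q (\<lambda>r. \<phi> (\<pi> r))"
proof -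
  interpret L: left_localization A "\<pi> ` T" Q \<phi> by fact
  show ?thesis
  proof
    show "(\<lambda>r. \<phi> (\<pi> r)) \<in> ring_hom R Q"
      by (rule ring_hom_memI) (simp_all add: pi_mult L.phi_mult L.phi_add ring_hom_add[OF hom])
    show "\<phi> (\<pi> s) \<in> Units Q" if "s \<in> T" for s using L.unit that by blast
    show "\<phi> (\<pi> r) = \<zero>\<^bsub>Q\<^esub> \<longleftrightarrow> (\<exists>s\<in>T. s \<otimes> r = \<zero>)" if r: "r \<in> carrier R" for r
    proof
      assume "\<phi> (\<pi> r) = \<zero>\<^bsub>Q\<^esub>"
      then obtain t where t: "t \<in> T" "\<pi> t \<star> \<pi> r = \<zero>\<^bsub>A\<^esub>" using L.ker[OF pi_closed[OF r]] by blast
      have "\<pi> r = \<zero>\<^bsub>A\<^esub>"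
        using A.regular_elementsD(2)[OF subsetD[OF image_regular imageI[OF t(1)]] pi_closed[OF r] t(2)] .
      then show "\<exists>s\<in>T. s \<otimes> r = \<zero>" using ker[OF r] by simp
    next
      assume "\<exists>s\<in>T. s \<otimes> r = \<zero>"
      then show "\<phi> (\<pi> r) = \<zero>\<^bsub>Q\<^esub>" using ker[OF r] by simp
    qed
    show "\<exists>s\<in>T. \<exists>r\<in>carrier R. \<phi> (\<pi> s) \<otimes>\<^bsub>Q\<^esub> q = \<phi> (\<pi> r)" if q: "q \<in> carrier Q" for q
    proof -
      obtain s x where s: "s \<in> T" "x \<in> carrier A" "\<phi> (\<pi> s) \<otimes>\<^bsub>Q\<^esub> q = \<phi> x" using L.frac[OF q] by blast
      obtain r where "r \<in> carrier R" "x = \<pi> r" using lift[OF s(2)] .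
      then show ?thesis using s by blast
    qed
  qed
qed

text \<open>Every maximal \<open>S\<close> in \<open>R\<close> contains \<open>T\<close>, and its
  image is maximal in \<open>A\<close>, since a larger \<open>U\<close> would pull back to a
  denominator set containing \<open>S\<close>. So the preimage of \<open>T_l A\<close> lies in every
  maximal \<open>S\<close>; being a denominator set, it lies in \<open>T_l R\<close>.\<close>

lemma vimage_T_l_quotient:
  assumes T: "T = T_l R" and ne: "\<one>\<^bsub>A\<^esub> \<noteq> \<zero>\<^bsub>A\<^esub>" and sub: "\<pi> ` T \<subseteq> T_l A"
  shows "{r \<in> carrier R. \<pi> r \<in> T_l A} = T" "T_l A = \<pi> ` T"
proof -
  let ?V = "{r \<in> carrier R. \<pi> r \<in> T_l A}"
  have V: "?V \<in> Den_l R" by (rule vimage_Den_l[OF A.T_l_Den_l[OF ne] sub])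
  have "?V \<subseteq> S" if Sm: "S \<in> max_Den_l R" for S
  proof -
    have S: "S \<in> Den_l R" and max: "\<And>U. U \<in> Den_l R \<Longrightarrow> S \<subseteq> U \<Longrightarrow> U = S"
      using Sm unfolding max_Den_l_def by simp_all
    have TS: "T \<subseteq> S" using T_l_subset Sm unfolding T strong_L_def by blast
    have iS: "\<pi> ` S \<in> Den_l A" using image_Den_l[OF S TS] .
    \<comment> \<open>With the image of \<open>S\<close> in place of \<open>U\<close> this also
      shows that \<open>S\<close> is the full preimage of its image.\<close>
    have eq: "{r \<in> carrier R. \<pi> r \<in> U} = S" if U: "U \<in> Den_l A" "\<pi> ` S \<subseteq> U" for U
      by (rule max[OF vimage_Den_l[OF U(1)]]) (use U(2) TS Den_lD(7)[OF S] in auto)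
    have "U = \<pi> ` S" if U: "U \<in> Den_l A" "\<pi> ` S \<subseteq> U" for U
    proof
      show "U \<subseteq> \<pi> ` S"
      proof
        fix x assume x: "x \<in> U"
        obtain r where r: "r \<in> carrier R" "x = \<pi> r" using lift[OF A.Den_lD(7)[OF U(1) x]] .
        then have "r \<in> {r \<in> carrier R. \<pi> r \<in> U}" using x by simp
        then show "x \<in> \<pi> ` S" unfolding eq[OF U] r(2) by (rule imageI)
      qed
    qed (rule U(2))
    then have "\<pi> ` S \<in> max_Den_l A" unfolding max_Den_l_def using iS by simp
    then have "T_l A \<subseteq> \<pi> ` S" using A.T_l_subset unfolding strong_L_def by blast
    then show ?thesis using eq[OF iS] by blast
  qed
  then have "?V \<subseteq> strong_L R" unfolding strong_L_def by blast
  then have VT: "?V \<subseteq> T" unfolding T by (rule T_l_upper[OF V])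
  then show "?V = T" using sub by auto
  have "T_l A \<subseteq> \<pi> ` T"
  proof
    fix x assume x: "x \<in> T_l A"
    obtain r where r: "r \<in> carrier R" "x = \<pi> r" using lift[OF A.Den_lD(7)[OF A.T_l_Den_l[OF ne] x]] .
    then have "r \<in> T" using VT x by blast
    then show "x \<in> \<pi> ` T" unfolding r(2) by (rule imageI)
  qed
  then show "T_l A = \<pi> ` T" using sub by blast
qed

end

lemma (in ring) quotient_denominator_quotient:
  assumes T: "T \<in> Den_l R"
  shows "denominator_quotient R T (R Quot left_ass R T) ((+>) (left_ass R T))"
proof -
  let ?I = "left_ass R T"
  interpret I: ideal ?I R by (rule left_ass_ideal[OF T])
  interpret Q: ring "R Quot ?I" by (rule I.quotient_is_ring)
  show ?thesis
  proof
    show "T \<in> Den_l R" by (rule T)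
    show "(+>) ?I \<in> ring_hom R (R Quot ?I)" by (rule I.rcos_ring_hom)
    show "(+>) ?I ` carrier R = carrier (R Quot ?I)"
      unfolding FactRing_def A_RCOSETS_def' by auto
    show "?I +> r = \<zero>\<^bsub>R Quot ?I\<^esub> \<longleftrightarrow> (\<exists>t\<in>T. t \<otimes> r = \<zero>)" if r: "r \<in> carrier R" for r
    proof -
      have "?I +> r = ?I \<longleftrightarrow> r \<in> ?I"
        using I.a_rcos_self[OF r] I.a_rcos_const by blast
      then show ?thesis unfolding FactRing_def left_ass_def using r by simp
    qed
  qed
qed

text \<open>The given localization at \<open>S\<close> is also one at all regular elements, so
  semisimplicity passes to \<open>Q_lcl R\<close> by uniqueness. The lemma serves both the image of
  \<open>T_l R\<close> and \<open>S_l0\<close> of the quotient.\<close>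

lemma (in ring) order_regular_semisimple:
  assumes S: "S \<in> Den_l R" "S \<subseteq> regular_elements R" and ss: "semisimple_ring (left_loc R S)"
  shows "left_Ore_set R (regular_elements R) \<and> semisimple_ring (Q_lcl R)"
proof -
  interpret left_denominator R S by standard (rule S(1))
  interpret L: left_localization R S L "fc \<one>" by (rule left_loc_localization)
  have split: "left_ideals_split L" using L.Q.semisimple_imp_split[OF ss] .
  have C: "regular_elements R \<in> Den_l R" using L.regular_Den_l[OF S(2) split] .
  interpret C: left_denominator R "regular_elements R" by standard (rule C)
  have "L \<simeq> Q_lcl R" unfolding Q_lcl_def
    by (rule left_localization_unique[OF L.regular_localization[OF S(2) split] C.left_loc_localization])
  then have "left_ideals_split (Q_lcl R)"
    using left_ideals_split_iso[OF L.Q.ring_axioms C.loc_ring] split unfolding Q_lcl_def by blast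
  then show ?thesis
    using ring.split_imp_semisimple[OF C.loc_ring] C left_Ore_regular_Den_l unfolding Q_lcl_def by blast
qed

section \<open>Goldie's theorem and the final equivalences\<close>

theorem (in ring) Goldie:
  assumes ne: "\<one> \<noteq> \<zero>"
  shows "semiprime_ring R \<and> left_Goldie_ring R \<longleftrightarrow>
    left_Ore_set R (regular_elements R) \<and> semisimple_ring (Q_lcl R)"
proof
  assume A: "semiprime_ring R \<and> left_Goldie_ring R"
  have C: "regular_elements R \<in> Den_l R" using Goldie_regular_Den_l A ne by blast
  interpret C: left_denominator R "regular_elements R" by standard (rule C)
  interpret L: left_localization R "regular_elements R" C.L "C.fc \<one>" by (rule C.left_loc_localization)
  have "left_ideals_split C.L" using L.Goldie_split A ne by blast
  then show "left_Ore_set R (regular_elements R) \<and> semisimple_ring (Q_lcl R)"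
    using L.Q.split_imp_semisimple C left_Ore_regular_Den_l unfolding Q_lcl_def by blast
next
  assume A: "left_Ore_set R (regular_elements R) \<and> semisimple_ring (Q_lcl R)"
  have C: "regular_elements R \<in> Den_l R" using A left_Ore_regular_Den_l by blast
  interpret C: left_denominator R "regular_elements R" by standard (rule C)
  interpret L: left_localization R "regular_elements R" C.L "C.fc \<one>" by (rule C.left_loc_localization)
  have "left_ideals_split C.L" using A L.Q.semisimple_imp_split unfolding Q_lcl_def by blast
  then show "semiprime_ring R \<and> left_Goldie_ring R"
    using L.order_semiprime L.order_Goldie by blast
qed

theorem theorem1p3:
  fixes R :: "('a, 'b) ring_scheme"
  assumes "ring R" and "\<one>\<^bsub>R\<^esub> \<noteq> \<zero>\<^bsub>R\<^esub>"
  shows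
    "(semisimple_ring (Q_ls R) \<longleftrightarrow>
        semiprime_ring (R Quot strong_l R) \<and> left_Goldie_ring (R Quot strong_l R)) \<and>
     (semisimple_ring (Q_ls R) \<longleftrightarrow> semisimple_ring (Q_l (R Quot strong_l R))) \<and>
     (semisimple_ring (Q_ls R) \<longleftrightarrow>
        left_Ore_set (R Quot strong_l R) (regular_elements (R Quot strong_l R)) \<and>
        semisimple_ring (Q_lcl (R Quot strong_l R))) \<and>
     (semisimple_ring (Q_ls R) \<longrightarrow>
        Q_ls R \<simeq> Q_l (R Quot strong_l R) \<and>
        Q_l (R Quot strong_l R) \<simeq> Q_lcl (R Quot strong_l R) \<and>
        T_l R = {r \<in> carrier R. strong_l R +>\<^bsub>R\<^esub> r \<in> regular_elements (R Quot strong_l R)} \<and>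
        T_l (R Quot strong_l R) = regular_elements (R Quot strong_l R))"
proof -
  interpret R: ring R by fact
  define A where "A = R Quot strong_l R"
  define \<pi> where "\<pi> = (\<lambda>r. strong_l R +>\<^bsub>R\<^esub> r)"
  let ?C = "regular_elements A" and ?T = "T_l R"
  have T: "?T \<in> Den_l R" using R.T_l_Den_l assms(2) by blast
  interpret D: denominator_quotient R ?T A \<pi>
    using R.quotient_denominator_quotient[OF T] unfolding A_def \<pi>_def strong_l_def .
  have ne: "\<one>\<^bsub>A\<^esub> \<noteq> \<zero>\<^bsub>A\<^esub>"
  proof
    assume "\<one>\<^bsub>A\<^esub> = \<zero>\<^bsub>A\<^esub>"
    then have "\<pi> \<one>\<^bsub>R\<^esub> = \<zero>\<^bsub>A\<^esub>" by simp
    then have "\<one>\<^bsub>R\<^esub> \<in> left_ass R ?T" using D.ker[of "\<one>\<^bsub>R\<^esub>"] unfolding left_ass_def by simp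
    then show False using R.one_notin_left_ass[OF T] by simp
  qed
  let ?U = "\<pi> ` ?T"
  have U: "?U \<in> Den_l A" using D.image_Den_l[OF T] by simp
  have UC: "?U \<subseteq> ?C" by (rule D.image_regular)
  interpret U: left_denominator A ?U by standard (rule U)
  \<comment> \<open>The localization of \<open>A\<close> at the image of \<open>T_l R\<close> and
    \<open>Q_ls R\<close> are both localizations of \<open>R\<close> at \<open>T_l R\<close>, hence
    isomorphic.\<close>
  have loc: "left_localization R ?T U.L (\<lambda>r. U.fc \<one>\<^bsub>A\<^esub> (\<pi> r))"
    by (rule D.localization_comp[OF U.left_loc_localization])
  have iso: "Q_ls R \<simeq> U.L" and iso': "U.L \<simeq> Q_ls R"
    unfolding Q_ls_def
    by (rule left_localization_unique[OF D.left_loc_localization loc]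
        left_localization_unique[OF loc D.left_loc_localization])+
  have ss_iff: "semisimple_ring (Q_ls R) \<longleftrightarrow> semisimple_ring U.L"
    unfolding Q_ls_def ring.semisimple_iff_split[OF D.loc_ring] ring.semisimple_iff_split[OF U.loc_ring]
    using left_ideals_split_iso[OF D.loc_ring U.loc_ring] left_ideals_split_iso[OF U.loc_ring D.loc_ring]
      iso iso' unfolding Q_ls_def by blast
  \<comment> \<open>The condition on the classical quotient ring is the hub with which the others
    are compared.\<close>
  let ?X = "left_Ore_set A ?C \<and> semisimple_ring (Q_lcl A)"
  \<comment> \<open>Consequently \<open>Q_l A\<close> and \<open>Q_lcl A\<close> are equal as
    constructed rings, not just isomorphic.\<close>
  have S0: "S_l0 A = ?C" if "left_Ore_set A ?C"
    using D.A.S_l0_greatest[OF ne] that D.A.left_Ore_regular_Den_l by blast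
  have X_imp: "T_l A = ?C \<and> ?U = ?C \<and> {r \<in> carrier R. \<pi> r \<in> ?C} = ?T" if X: ?X
  proof -
    have C: "?C \<in> Den_l A" using X D.A.left_Ore_regular_Den_l by blast
    interpret C: left_denominator A ?C by standard (rule C)
    interpret L: left_localization A ?C C.L "C.fc \<one>\<^bsub>A\<^esub>" by (rule C.left_loc_localization)
    have "left_ideals_split C.L" using X L.Q.semisimple_imp_split unfolding Q_lcl_def by blast
    then have CT: "?C \<subseteq> T_l A" using L.regular_subset_T_l by blast
    \<comment> \<open>From \<open>?U \<subseteq> ?C\<close>, \<open>?C \<subseteq> T_l A\<close> and
      the equality \<open>T_l A = ?U\<close> that this inclusion yields, all three sets
      coincide.\<close>
    then have "?U \<subseteq> T_l A" using UC by blast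
    from D.vimage_T_l_quotient[OF refl ne this] show ?thesis using CT UC by auto
  qed
  have U_iff: "semisimple_ring U.L \<longleftrightarrow> ?X"
  proof
    show ?X if "semisimple_ring U.L" using D.A.order_regular_semisimple[OF U UC that] .
    show "semisimple_ring U.L" if ?X using X_imp[OF that] that unfolding Q_lcl_def by simp
  qed
  have l_iff: "semisimple_ring (Q_l A) \<longleftrightarrow> ?X"
  proof
    show ?X if "semisimple_ring (Q_l A)"
      using D.A.order_regular_semisimple[OF D.A.S_l0_greatest(1,2)[OF ne]] that unfolding Q_l_def by blast
    show "semisimple_ring (Q_l A)" if ?X using S0 that unfolding Q_l_def Q_lcl_def by simp
  qed
  have Goldie: "semiprime_ring A \<and> left_Goldie_ring A \<longleftrightarrow> ?X" by (rule D.A.Goldie[OF ne])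
  have fin: "Q_ls R \<simeq> Q_l A \<and> Q_l A \<simeq> Q_lcl A \<and> ?T = {r \<in> carrier R. \<pi> r \<in> ?C} \<and> T_l A = ?C" if X: ?X
  proof -
    have "Q_l A = Q_lcl A" using S0 X unfolding Q_l_def Q_lcl_def by simp
    moreover have "U.L = Q_lcl A" using X_imp[OF X] unfolding Q_lcl_def by simp
    moreover have "Q_lcl A \<simeq> Q_lcl A" unfolding is_ring_iso_def using ring_iso_set_refl by blast
    ultimately show ?thesis using iso X_imp[OF X] by simp
  qed
  have "(semisimple_ring (Q_ls R) \<longleftrightarrow> semiprime_ring A \<and> left_Goldie_ring A) \<and>
     (semisimple_ring (Q_ls R) \<longleftrightarrow> semisimple_ring (Q_l A)) \<and>
     (semisimple_ring (Q_ls R) \<longleftrightarrow> ?X) \<and>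
     (semisimple_ring (Q_ls R) \<longrightarrow>
        Q_ls R \<simeq> Q_l A \<and> Q_l A \<simeq> Q_lcl A \<and> ?T = {r \<in> carrier R. \<pi> r \<in> ?C} \<and> T_l A = ?C)"
    unfolding ss_iff U_iff l_iff Goldie using fin by blast
  then show ?thesis unfolding A_def \<pi>_def .
qed

end
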